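(* Let $\theta>0$ and suppose Assumption 1 (stated in the context) holds. Suppose that a pair $(g,h)$, with $g\in\mathbb{R}$ and $h:S\to\mathbb{R}$, satisfies for every $i\in S$ $$e^{\theta h(i)}=\sup_{\varphi\in \mathcal{P}(B(i))}\inf_{\psi\in \mathcal{P}(A(i))}\Big[\int_{A(i)}\int_{B(i)}\psi(da)\,\varphi(db)\, e^{\theta C(i,a,b)}\int_{0}^{\bar s} e^{\theta[\int_{0}^{s}\rho_{(i,a,b)}(t)dt-gs]}dF_{i,a,b}(s)\sum_{j\in S}e^{\theta h(j)}p_{i,j}(a,b)\Big],\qquad (E_1)$$ and hence (by Fan's minimax theorem) also, for every $i\in S$, $$e^{\theta h(i)}=\inf_{\psi\in \mathcal{P}(A(i))}\sup_{\varphi\in \mathcal{P}(B(i))}\Big[\int_{A(i)}\int_{B(i)}\psi(da)\,\varphi(db)\, e^{\theta C(i,a,b)}\int_{0}^{\bar s} e^{\theta[\int_{0}^{s}\rho_{(i,a,b)}(t)dt-gs]}dF_{i,a,b}(s)\sum_{j\in S}e^{\theta h(j)}p_{i,j}(a,b)\Big].\qquad (E_2)$$ Then the zero-sum game has a value $V(\cdot,\theta)$, and $V(i,\theta)=g$ for all $i\in S$. Further, if $\phi^{*1}\in\Phi^1$ is an outer minimizing selector of the right-hand side of $(E_2)$ (i.e. for each $i\in S$, $\psi=\phi^{*1}(\cdot|i)$ attains the outer infimum) and $\phi^{*2}\in\Phi^2$ is an outer maximizing selector of the right-hand side of $(E_1)$ (i.e. for each $i\in S$, $\varphi=\phi^{*2}(\cdot|i)$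 attains the outer supremum), then $(\phi^{*1},\phi^{*2})$ is a saddle point equilibrium.
   Context: Zero-sum semi-Markov game model. $S$ is a finite state space with the discrete topology. $A$ and $B$ are Borel spaces (action sets of players 1 and 2); for each $i\in S$, $A(i)\subset A$ and $B(i)\subset B$ are Borel subsets (admissible actions). $\mathbb{K}=\{(i,a,b): i\in S, a\in A(i), b\in B(i)\}$. $C:\mathbb{K}\to\mathbb{R}$ is the immediate cost to player 1 (reward to player 2); for each $(i,a,b)\in\mathbb{K}$, $\rho_{(i,a,b)}:[0,\infty)\to\mathbb{R}$ is the running cost of player 1 (running reward of player 2); $F_{i,a,b}$ is the sojourn time distribution function, with $F_{i,a,b}(0)=0$; $[p_{i,j}(a,b)]$ is the controlled transition law, $\sum_{j\in S}p_{i,j}(a,b)=1$. $\mathcal{P}(E)$ is the set of probability measures on $E$. Assumption 1. (i) For each $i\in S$, $A(i)$ and $B(i)$ are compact. (ii) For each $i,j\in S$, $(a,b)\mapsto C(i,a,b)$ and $(a,b)\mapsto p_{i,j}(a,b)$ are continuous on $A(i)\times B(i)$. (iii) There is a constant $\bar s>0$ such that $F_{i,a,b}(\bar s)=1$ for all $(i,a,b)\in\mathbb{K}$, and for each $i\in S$ and each bounded measurable $u$, $(a,b)\mapsto\int_0^{\bar s}u(s)\,dF_{i,a,b}(s)$ is continuous on $A(i)\times B(i)$. (iv) For each $i\in S$, $(a,b,s)\mapsto\rho_{(i,a,b)}(s)$ is continuous on $A(i)\times B(i)\times[0,\bar s]$. Policies. $H_0=S$, $H_n=\mathbb{K}\times(0,\infty)\times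 H_{n-1}$ is the space of histories $h_n=(i_0,a_0,b_0,s_0,\ldots,i_{n-1},a_{n-1},b_{n-1},s_{n-1},i_n)$. A policy for player 1 is a sequence $\pi^1=\{\pi^1_n\}_{n\ge0}$ of stochastic kernels on $A$ given $H_n$ with $\pi^1_n(A(i_n)|h_n)=1$; policies $\pi^2$ for player 2 are analogous (on $B$). $\Pi_m$ is the set of all policies of player $m$. $\Phi^1$ is the set of stochastic kernels $\phi^1$ on $A$ given $S$ with $\phi^1(A(i)|i)=1$, identified with the stationary policies $\pi^1_n(\cdot|h_n)=\phi^1(\cdot|i_n)$; $\Phi^2$ is defined analogously for player 2. Given $X_0=i$ and $(\pi^1,\pi^2)$, $\mathbb{P}_i^{\pi^1,\pi^2}$ (expectation $\mathbb{E}_i^{\pi^1,\pi^2}$) is the law of $\{(X_n,A_n,B_n,S_n)\}_{n\ge 0}$ (states, actions of players 1 and 2, sojourn times) determined, with $\mathcal{H}_n=(X_0,A_0,B_0,S_0,\ldots,X_{n-1},A_{n-1},B_{n-1},S_{n-1},X_n)$, by: $\mathbb{P}[X_0=i]=1$; $\mathbb{P}[A_n\in G,B_n\in D|\mathcal{H}_n]=\pi^1_n(G|\mathcal{H}_n)\pi^2_n(D|\mathcal{H}_n)$; $\mathbb{P}[S_n\le t|\mathcal{H}_n,A_n,B_n]=F_{X_n,A_n,B_n}(t)$; $\mathbb{P}[X_{n+1}=j|\mathcal{H}_n,A_n,B_n,S_n]=p_{X_n,j}(A_n,B_n)$. Set $T_0=0$, $T_n=\sum_{k=0}^{n-1}S_k$,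 and $N_t=\sup\{n: T_n\le t\}$. Criterion. The total cost up to time $t>0$ is $$\mathcal{C}_t=\sum_{k=0}^{N_t-1}\Big[C(X_k,A_k,B_k)+\int_0^{S_k}\rho_{(X_k,A_k,B_k)}(r)dr\Big]+C(X_{N_t},A_{N_t},B_{N_t})+\int_0^{t-T_{N_t}}\rho_{(X_{N_t},A_{N_t},B_{N_t})}(r)dr,$$ and $J_\theta(i,\pi^1,\pi^2)=\limsup_{t\to\infty}\frac{1}{\theta t}\log\mathbb{E}_i^{\pi^1,\pi^2}[e^{\theta\mathcal{C}_t}]$. Player 1 minimizes, player 2 maximizes. Lower value: $L(i,\theta)=\sup_{\pi^2\in\Pi_2}\inf_{\pi^1\in\Pi_1}J_\theta(i,\pi^1,\pi^2)$; upper value: $U(i,\theta)=\inf_{\pi^1\in\Pi_1}\sup_{\pi^2\in\Pi_2}J_\theta(i,\pi^1,\pi^2)$. The game has a value if $U(i,\theta)=L(i,\theta)$ for all $i\in S$; the common function is the value $V(i,\theta)$. A policy $\pi^{*1}\in\Pi_1$ is optimal for player 1 if $V(i,\theta)=\sup_{\pi^2\in\Pi_2}J_\theta(i,\pi^{*1},\pi^2)$ for all $i\in S$; $\pi^{*2}\in\Pi_2$ is optimal for player 2 if $V(i,\theta)=\inf_{\pi^1\in\Pi_1}J_\theta(i,\pi^1,\pi^{*2})$ for all $i\in S$. If both are optimal, $(\pi^{*1},\pi^{*2})$ is a saddle point equilibrium. *)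

theory Defs
  imports "HOL-Probability.Probability"
begin

text \<open>
  The state space is a finite type \<open>'s\<close>. The Borel spaces of actions are Borel subsets
  \<open>act1\<close>, \<open>act2\<close> of Polish spaces. \<open>cost\<close>, \<open>rate\<close>, \<open>sojourn\<close> and \<open>transition\<close> are total functions,
  but only their values on the set of admissible triples matter;
  \<open>rate G i a b\<close> is used on \<open>[0, \<infinity>)\<close> only.
\<close>

record ('s, 'a, 'b) smg =
  act1 :: "'a set"
  act2 :: "'b set"
  adm1 :: "'s \<Rightarrow> 'a set"
  adm2 :: "'s \<Rightarrow> 'b set"
  cost :: "'s \<Rightarrow> 'a \<Rightarrow> 'b \<Rightarrow> real"
  rate :: "'s \<Rightarrow> 'a \<Rightarrow> 'b \<Rightarrow> real \<Rightarrow> real"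
  sojourn :: "'s \<Rightarrow> 'a \<Rightarrow> 'b \<Rightarrow> real \<Rightarrow> real"
  transition :: "'s \<Rightarrow> 's \<Rightarrow> 'a \<Rightarrow> 'b \<Rightarrow> real"

definition distribution_function :: "(real \<Rightarrow> real) \<Rightarrow> bool" where
  "distribution_function F \<longleftrightarrow>
     mono F \<and> (\<forall>x. continuous (at_right x) F) \<and> (F \<longlongrightarrow> 0) at_bot \<and> (F \<longlongrightarrow> 1) at_top"

definition semi_markov_game :: "('s::finite, 'a::polish_space, 'b::polish_space) smg \<Rightarrow> bool" where
  "semi_markov_game G \<longleftrightarrow>
     act1 G \<in> sets borel \<and> act2 G \<in> sets borel \<and>
     (\<forall>i. adm1 G i \<in> sets borel \<and> adm1 G i \<subseteq> act1 G) \<and>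
     (\<forall>i. adm2 G i \<in> sets borel \<and> adm2 G i \<subseteq> act2 G) \<and>
     (\<forall>i. \<forall>a\<in>adm1 G i. \<forall>b\<in>adm2 G i.
        distribution_function (sojourn G i a b) \<and> sojourn G i a b 0 = 0 \<and>
        (\<forall>j. 0 \<le> transition G i j a b) \<and> (\<Sum>j\<in>UNIV. transition G i j a b) = 1)"

text \<open>
  The library's Lebesgue-Stieltjes measure \<open>interval_measure F\<close> is used for \<open>dF\<close>.
  As \<open>F\<close> vanishes on \<open>(-\<infinity>, 0]\<close>, including the endpoint \<open>0\<close> is immaterial.
\<close>

definition assumption1 ::
  "('s::finite, 'a::polish_space, 'b::polish_space) smg \<Rightarrow> real \<Rightarrow> bool" where
  "assumption1 G sbar \<longleftrightarrow>
     (\<forall>i. compact (adm1 G i) \<and> compact (adm2 G i)) \<and>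
     (\<forall>i. continuous_on (adm1 G i \<times> adm2 G i) (\<lambda>(a, b). cost G i a b)) \<and>
     (\<forall>i j. continuous_on (adm1 G i \<times> adm2 G i) (\<lambda>(a, b). transition G i j a b)) \<and>
     sbar > 0 \<and>
     (\<forall>i. \<forall>a\<in>adm1 G i. \<forall>b\<in>adm2 G i. sojourn G i a b sbar = 1) \<and>
     (\<forall>i. \<forall>u :: real \<Rightarrow> real. u \<in> borel_measurable borel \<and> bounded (range u) \<longrightarrow>
        continuous_on (adm1 G i \<times> adm2 G i)
          (\<lambda>(a, b). LINT s:{0..sbar}|interval_measure (sojourn G i a b). u s)) \<and>
     (\<forall>i. continuous_on (adm1 G i \<times> adm2 G i \<times> {0..sbar}) (\<lambda>(a, b, s). rate G i a b s))"

subsection \<open>Histories and policies\<close>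

text \<open>
  A stage is a tuple \<open>(i, a, b, s)\<close> with \<open>(i, a, b)\<close> admissible and \<open>s > 0\<close>. A history
  \<open>h\<^sub>n\<close> is a pair of the \<open>n\<close> completed stages and the current state \<open>i\<^sub>n\<close>.
\<close>

definition stage_space ::
  "('s::finite, 'a::polish_space, 'b::polish_space) smg \<Rightarrow> ('s \<times> 'a \<times> 'b \<times> real) measure" where
  "stage_space G =
     restrict_space (count_space UNIV \<Otimes>\<^sub>M borel \<Otimes>\<^sub>M borel \<Otimes>\<^sub>M borel)
       {(i, a, b, s). a \<in> adm1 G i \<and> b \<in> adm2 G i \<and> 0 < s}"

type_synonym ('s, 'a, 'b) history = "(nat \<Rightarrow> 's \<times> 'a \<times> 'b \<times> real) \<times> 's"

definition history_space ::
  "('s::finite, 'a::polish_space, 'b::polish_space) smg \<Rightarrow> nat \<Rightarrow> ('s, 'a, 'b) history measure" where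
  "history_space G n = (\<Pi>\<^sub>M k\<in>{0..<n}. stage_space G) \<Otimes>\<^sub>M count_space UNIV"

definition policies1 ::
  "('s::finite, 'a::polish_space, 'b::polish_space) smg
    \<Rightarrow> (nat \<Rightarrow> ('s, 'a, 'b) history \<Rightarrow> 'a measure) set" where
  "policies1 G =
     {\<pi>. \<forall>n. \<pi> n \<in> history_space G n \<rightarrow>\<^sub>M prob_algebra (restrict_space borel (act1 G)) \<and>
          (\<forall>h\<in>space (history_space G n). emeasure (\<pi> n h) (adm1 G (snd h)) = 1)}"

definition policies2 ::
  "('s::finite, 'a::polish_space, 'b::polish_space) smg
    \<Rightarrow> (nat \<Rightarrow> ('s, 'a, 'b) history \<Rightarrow> 'b measure) set" where
  "policies2 G =
     {\<pi>. \<forall>n. \<pi> n \<in> history_space G n \<rightarrow>\<^sub>M prob_algebra (restrict_space borel (act2 G)) \<and>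
          (\<forall>h\<in>space (history_space G n). emeasure (\<pi> n h) (adm2 G (snd h)) = 1)}"

definition selectors1 ::
  "('s::finite, 'a::polish_space, 'b::polish_space) smg \<Rightarrow> ('s \<Rightarrow> 'a measure) set" where
  "selectors1 G =
     {\<phi>. \<phi> \<in> count_space UNIV \<rightarrow>\<^sub>M prob_algebra (restrict_space borel (act1 G)) \<and>
         (\<forall>i. emeasure (\<phi> i) (adm1 G i) = 1)}"

definition selectors2 ::
  "('s::finite, 'a::polish_space, 'b::polish_space) smg \<Rightarrow> ('s \<Rightarrow> 'b measure) set" where
  "selectors2 G =
     {\<phi>. \<phi> \<in> count_space UNIV \<rightarrow>\<^sub>M prob_algebra (restrict_space borel (act2 G)) \<and>
         (\<forall>i. emeasure (\<phi> i) (adm2 G i) = 1)}"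

definition stationary :: "('s \<Rightarrow> 'c measure) \<Rightarrow> nat \<Rightarrow> ('s, 'a, 'b) history \<Rightarrow> 'c measure" where
  "stationary \<phi> n h = \<phi> (snd h)"

subsection \<open>The law of the process\<close>

definition next_state ::
  "('s::finite, 'a::polish_space, 'b::polish_space) smg \<Rightarrow> 's \<times> 'a \<times> 'b \<times> real \<Rightarrow> 's measure" where
  "next_state G = (\<lambda>(i, a, b, s). point_measure UNIV (\<lambda>j. ennreal (transition G i j a b)))"

text \<open>
  Conditional law of the \<open>n\<close>-th stage \<open>(X\<^sub>n, A\<^sub>n, B\<^sub>n, S\<^sub>n)\<close> given the stages \<open>\<omega> 0, \<dots>, \<omega> (n - 1)\<close>.
  The actions and the sojourn time are restricted to sets that carry the full mass, so that the
  result is a measure on the stage space.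
\<close>

definition stage_kernel ::
  "('s::finite, 'a::polish_space, 'b::polish_space) smg \<Rightarrow> 's
    \<Rightarrow> (nat \<Rightarrow> ('s, 'a, 'b) history \<Rightarrow> 'a measure) \<Rightarrow> (nat \<Rightarrow> ('s, 'a, 'b) history \<Rightarrow> 'b measure)
    \<Rightarrow> nat \<Rightarrow> (nat \<Rightarrow> 's \<times> 'a \<times> 'b \<times> real) \<Rightarrow> ('s \<times> 'a \<times> 'b \<times> real) measure" where
  "stage_kernel G i \<pi>1 \<pi>2 n \<omega> =
     (if n = 0 then return (count_space UNIV) i else next_state G (\<omega> (n - 1))) \<bind> (\<lambda>x.
     (restrict_space (\<pi>1 n (\<omega>, x)) (adm1 G x) \<Otimes>\<^sub>M restrict_space (\<pi>2 n (\<omega>, x)) (adm2 G x)) \<bind>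
     (\<lambda>(a, b). distr (restrict_space (interval_measure (sojourn G x a b)) {0<..}) (stage_space G)
                 (\<lambda>s. (x, a, b, s))))"

text \<open>The measure on infinite sequences of stages given by the Ionescu-Tulcea theorem.\<close>

definition process_law ::
  "('s::finite, 'a::polish_space, 'b::polish_space) smg \<Rightarrow> 's
    \<Rightarrow> (nat \<Rightarrow> ('s, 'a, 'b) history \<Rightarrow> 'a measure) \<Rightarrow> (nat \<Rightarrow> ('s, 'a, 'b) history \<Rightarrow> 'b measure)
    \<Rightarrow> (nat \<Rightarrow> 's \<times> 'a \<times> 'b \<times> real) measure" where
  "process_law G i \<pi>1 \<pi>2 =
     projective_family.lim UNIV
       (Ionescu_Tulcea.CI (stage_kernel G i \<pi>1 \<pi>2) (\<lambda>_. stage_space G)) (\<lambda>_. stage_space G)"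

subsection \<open>The risk-sensitive criterion\<close>

definition jump_time :: "(nat \<Rightarrow> 's \<times> 'a \<times> 'b \<times> real) \<Rightarrow> nat \<Rightarrow> real" where
  "jump_time \<omega> n = (\<Sum>k<n. case \<omega> k of (i, a, b, s) \<Rightarrow> s)"

text \<open>
  The set is almost surely finite under the continuity assumptions; on the exceptional event
  the supremum in \<^typ>\<open>nat\<close> is an arbitrary number.
\<close>

definition jump_count :: "(nat \<Rightarrow> 's \<times> 'a \<times> 'b \<times> real) \<Rightarrow> real \<Rightarrow> nat" where
  "jump_count \<omega> t = Sup {n. jump_time \<omega> n \<le> t}"

definition stage_cost :: "('s, 'a, 'b) smg \<Rightarrow> 's \<times> 'a \<times> 'b \<times> real \<Rightarrow> real \<Rightarrow> real" where
  "stage_cost G = (\<lambda>(i, a, b, s) r. cost G i a b + (LBINT t:{0..r}. rate G i a b t))"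

definition total_cost ::
  "('s, 'a, 'b) smg \<Rightarrow> real \<Rightarrow> (nat \<Rightarrow> 's \<times> 'a \<times> 'b \<times> real) \<Rightarrow> real" where
  "total_cost G t \<omega> =
     (let N = jump_count \<omega> t in
        (\<Sum>k<N. stage_cost G (\<omega> k) (case \<omega> k of (i, a, b, s) \<Rightarrow> s)) +
        stage_cost G (\<omega> N) (t - jump_time \<omega> N))"

definition elog :: "ennreal \<Rightarrow> ereal" where
  "elog x = (if x = 0 then -\<infinity> else if x = \<infinity> then \<infinity> else ereal (ln (enn2real x)))"

definition J ::
  "('s::finite, 'a::polish_space, 'b::polish_space) smg \<Rightarrow> real \<Rightarrow> 's
    \<Rightarrow> (nat \<Rightarrow> ('s, 'a, 'b) history \<Rightarrow> 'a measure) \<Rightarrow> (nat \<Rightarrow> ('s, 'a, 'b) history \<Rightarrow> 'b measure)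
    \<Rightarrow> ereal" where
  "J G \<theta> i \<pi>1 \<pi>2 =
     Limsup at_top (\<lambda>t :: real. ereal (1 / (\<theta> * t)) *
       elog (\<integral>\<^sup>+\<omega>. ennreal (exp (\<theta> * total_cost G t \<omega>)) \<partial>process_law G i \<pi>1 \<pi>2))"

definition lower_value ::
  "('s::finite, 'a::polish_space, 'b::polish_space) smg \<Rightarrow> real \<Rightarrow> 's \<Rightarrow> ereal" where
  "lower_value G \<theta> i = (SUP \<pi>2\<in>policies2 G. INF \<pi>1\<in>policies1 G. J G \<theta> i \<pi>1 \<pi>2)"

definition upper_value ::
  "('s::finite, 'a::polish_space, 'b::polish_space) smg \<Rightarrow> real \<Rightarrow> 's \<Rightarrow> ereal" where
  "upper_value G \<theta> i = (INF \<pi>1\<in>policies1 G. SUP \<pi>2\<in>policies2 G. J G \<theta> i \<pi>1 \<pi>2)"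

text \<open>\<open>V\<close> is the value of the game, i.e. the common function of the upper and the lower values.\<close>

definition is_value ::
  "('s::finite, 'a::polish_space, 'b::polish_space) smg \<Rightarrow> real \<Rightarrow> ('s \<Rightarrow> ereal) \<Rightarrow> bool" where
  "is_value G \<theta> V \<longleftrightarrow> (\<forall>i. upper_value G \<theta> i = V i \<and> lower_value G \<theta> i = V i)"

definition optimal1 ::
  "('s::finite, 'a::polish_space, 'b::polish_space) smg \<Rightarrow> real
    \<Rightarrow> (nat \<Rightarrow> ('s, 'a, 'b) history \<Rightarrow> 'a measure) \<Rightarrow> bool" where
  "optimal1 G \<theta> \<pi>1 \<longleftrightarrow> \<pi>1 \<in> policies1 G \<and>
     (\<exists>V. is_value G \<theta> V \<and> (\<forall>i. V i = (SUP \<pi>2\<in>policies2 G. J G \<theta> i \<pi>1 \<pi>2)))"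

definition optimal2 ::
  "('s::finite, 'a::polish_space, 'b::polish_space) smg \<Rightarrow> real
    \<Rightarrow> (nat \<Rightarrow> ('s, 'a, 'b) history \<Rightarrow> 'b measure) \<Rightarrow> bool" where
  "optimal2 G \<theta> \<pi>2 \<longleftrightarrow> \<pi>2 \<in> policies2 G \<and>
     (\<exists>V. is_value G \<theta> V \<and> (\<forall>i. V i = (INF \<pi>1\<in>policies1 G. J G \<theta> i \<pi>1 \<pi>2)))"

definition saddle_point ::
  "('s::finite, 'a::polish_space, 'b::polish_space) smg \<Rightarrow> real
    \<Rightarrow> (nat \<Rightarrow> ('s, 'a, 'b) history \<Rightarrow> 'a measure) \<Rightarrow> (nat \<Rightarrow> ('s, 'a, 'b) history \<Rightarrow> 'b measure)
    \<Rightarrow> bool" where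
  "saddle_point G \<theta> \<pi>1 \<pi>2 \<longleftrightarrow> optimal1 G \<theta> \<pi>1 \<and> optimal2 G \<theta> \<pi>2"

subsection \<open>The optimality equation\<close>

definition prob_measures :: "'c::topological_space set \<Rightarrow> 'c measure set" where
  "prob_measures E = space (prob_algebra (restrict_space borel E))"

text \<open>
  The bracket of the optimality equation, with \<open>\<psi>\<close>, \<open>\<phi>\<close> probability measures on
  \<open>adm1 G i\<close>, \<open>adm2 G i\<close>.
\<close>

definition bracket ::
  "('s::finite, 'a::polish_space, 'b::polish_space) smg \<Rightarrow> real \<Rightarrow> real \<Rightarrow> real \<Rightarrow> ('s \<Rightarrow> real)
    \<Rightarrow> 's \<Rightarrow> 'a measure \<Rightarrow> 'b measure \<Rightarrow> real" where
  "bracket G sbar \<theta> g h i \<psi> \<phi> =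
     (LINT a|\<psi>. LINT b|\<phi>.
        exp (\<theta> * cost G i a b) *
        (LINT s:{0..sbar}|interval_measure (sojourn G i a b).
           exp (\<theta> * ((LBINT t:{0..s}. rate G i a b t) - g * s))) *
        (\<Sum>j\<in>UNIV. exp (\<theta> * h j) * transition G i j a b))"

definition sup_inf_rhs ::
  "('s::finite, 'a::polish_space, 'b::polish_space) smg \<Rightarrow> real \<Rightarrow> real \<Rightarrow> real \<Rightarrow> ('s \<Rightarrow> real)
    \<Rightarrow> 's \<Rightarrow> ereal" where
  "sup_inf_rhs G sbar \<theta> g h i =
     (SUP \<phi>\<in>prob_measures (adm2 G i). INF \<psi>\<in>prob_measures (adm1 G i).
        ereal (bracket G sbar \<theta> g h i \<psi> \<phi>))"

definition inf_sup_rhs ::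
  "('s::finite, 'a::polish_space, 'b::polish_space) smg \<Rightarrow> real \<Rightarrow> real \<Rightarrow> real \<Rightarrow> ('s \<Rightarrow> real)
    \<Rightarrow> 's \<Rightarrow> ereal" where
  "inf_sup_rhs G sbar \<theta> g h i =
     (INF \<psi>\<in>prob_measures (adm1 G i). SUP \<phi>\<in>prob_measures (adm2 G i).
        ereal (bracket G sbar \<theta> g h i \<psi> \<phi>))"

text \<open>
  A kernel on the whole action space concentrated on the admissible set is turned into a
  probability measure on the admissible set by restriction.
\<close>

definition outer_minimizing ::
  "('s::finite, 'a::polish_space, 'b::polish_space) smg \<Rightarrow> real \<Rightarrow> real \<Rightarrow> real \<Rightarrow> ('s \<Rightarrow> real)
    \<Rightarrow> ('s \<Rightarrow> 'a measure) \<Rightarrow> bool" where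
  "outer_minimizing G sbar \<theta> g h \<phi>1 \<longleftrightarrow>
     (\<forall>i. (SUP \<phi>\<in>prob_measures (adm2 G i).
             ereal (bracket G sbar \<theta> g h i (restrict_space (\<phi>1 i) (adm1 G i)) \<phi>))
          = inf_sup_rhs G sbar \<theta> g h i)"

definition outer_maximizing ::
  "('s::finite, 'a::polish_space, 'b::polish_space) smg \<Rightarrow> real \<Rightarrow> real \<Rightarrow> real \<Rightarrow> ('s \<Rightarrow> real)
    \<Rightarrow> ('s \<Rightarrow> 'b measure) \<Rightarrow> bool" where
  "outer_maximizing G sbar \<theta> g h \<phi>2 \<longleftrightarrow>
     (\<forall>i. (INF \<psi>\<in>prob_measures (adm1 G i).
             ereal (bracket G sbar \<theta> g h i \<psi> (restrict_space (\<phi>2 i) (adm2 G i))))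
          = sup_inf_rhs G sbar \<theta> g h i)"

end

theory Submission
  imports Defs
begin

text \<open>
  Let \<open>k\<^sub>g(i, a, b)\<close> be the function that the optimality equation integrates against mixed actions,
  and let \<open>c\<^sub>k\<close>, \<open>S\<^sub>k\<close>, \<open>T\<^sub>n\<close> be stage costs, sojourn times and jump times. The process
  \<open>M\<^sub>n = exp (\<theta> (c\<^sub>0 + \<dots> + c\<^bsub>n-1\<^esub> - g T\<^sub>n)) H\<^sub>n\<close>, where \<open>H\<^sub>n\<close> is the conditional expectation of
  \<open>exp (\<theta> h(X\<^sub>n))\<close> given the first \<open>n\<close> stages, is adapted to the stages, and its conditional one-step
  expectation is obtained by replacing \<open>exp (\<theta> h(X\<^sub>n))\<close> by the bracket of the equation at \<open>X\<^sub>n\<close>,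
  evaluated at the mixed actions in use (\<open>nn_integral_potential_Suc\<close>). A player who keeps the bracket
  below (or above) \<open>exp (\<theta> h)\<close> thus makes \<open>M\<close> a supermartingale (or a submartingale). At the jumps
  next to time \<open>t\<close> the accumulated stage costs differ from the total cost \<open>\<C>\<^sub>t\<close> by a bounded amount and
  the jump time differs from \<open>t\<close> by at most \<open>sbar\<close> (\<open>regular_path_bounds\<close>). Hence
  \<open>E exp (\<theta> \<C>\<^sub>t)\<close> is bounded above (or below) by a constant times \<open>exp (\<theta> g t)\<close>, that is,
  \<open>J \<le> g\<close> (or \<open>J \<ge> g\<close>).

  This is carried out with a number \<open>g'\<close> slightly different from \<open>g\<close>. Sojourn times are positive
  and the data are continuous on compact sets, so passing from \<open>g\<close> to a larger \<open>g'\<close> multiplies all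
  brackets by at most one factor \<open>q < 1\<close> (\<open>bracket_contraction\<close>). The factor has two uses. For the
  upper bound \<open>E M\<^sub>n\<close> decays geometrically, and \<open>E exp (\<theta> \<C>\<^sub>t)\<close> is at most a multiple of
  \<open>exp (\<theta> g' t) \<Sum>\<^sub>n E M\<^sub>n\<close> (\<open>expected_cost_upper\<close>). Moreover, it absorbs a relative error, so that a
  selector within a factor \<open>1 + \<epsilon>\<close> of optimality in the equation guarantees \<open>J \<le> g'\<close>
  (\<open>J_le_of_near_minimizer\<close>), and dually for the other player (\<open>J_ge_of_near_maximizer\<close>). Such
  selectors exist by the definition of infimum and supremum, and an optimal selector is near-optimal
  for every \<open>\<epsilon>\<close>; letting \<open>g'\<close> tend to \<open>g\<close> gives both the value and the saddle point.

  For the lower bound the submartingale is stopped at the first jump after \<open>t\<close>. No mass is lost in the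
  limit because for large \<open>\<beta>\<close> the Laplace transforms \<open>\<integral> exp (- \<beta> s) dF(s)\<close> are small uniformly in
  state and actions, so that the small probability of \<open>T\<^sub>n \<le> t\<close> outweighs the exponential growth of \<open>M\<^sub>n\<close>
  (\<open>uniform_laplace_small\<close>, \<open>alive_vanishes\<close>). The same estimate shows that almost surely
  only finitely many jumps occur up to time \<open>t\<close>.

  The infimum and the supremum in the equation may be exchanged by a minimax theorem for continuous
  payoffs on compact sets (\<open>minimax_mixed\<close>): one player runs the multiplicative weights algorithm
  on a finite net of actions, the other one secures the value \<open>v\<close> in every round by a pure reply, and
  the empirical distribution of the replies secures nearly \<open>v\<close> against every action.
\<close>

section \<open>A minimax theorem for mixed strategies\<close>

text \<open>
  Sequential play: each action \<open>a\<close> carries a weight, which after a reply \<open>b\<close> is multiplied by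
  \<open>1 - \<eta> k a b\<close>. As every reply secures at least \<open>v\<close> on average, the total weight shrinks at least
  like \<open>exp (- \<eta> v t)\<close>; since it dominates the weight of each single action, no action can have
  paid less than about \<open>v\<close> per round.
\<close>

lemma multiplicative_weights:
  fixes k :: "'a \<Rightarrow> 'b \<Rightarrow> real"
  assumes A: "finite A" "A \<noteq> {}"
    and bound: "\<And>a b. a \<in> A \<Longrightarrow> b \<in> B \<Longrightarrow> \<bar>k a b\<bar> \<le> M"
    and reply: "\<And>w. (\<And>a. a \<in> A \<Longrightarrow> w a > 0) \<Longrightarrow> \<exists>b\<in>B. v * (\<Sum>a\<in>A. w a) \<le> (\<Sum>a\<in>A. w a * k a b)"
    and "\<epsilon> > 0"
  shows "\<exists>n y. n > (0::nat) \<and> (\<forall>t. y t \<in> B) \<and> (\<forall>a\<in>A. v - \<epsilon> \<le> (\<Sum>t<n. k a (y t)) / real n)"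
proof -
  define M' where "M' = \<bar>M\<bar> + 1"
  have M': "M' \<ge> 1" "\<And>a b. a \<in> A \<Longrightarrow> b \<in> B \<Longrightarrow> \<bar>k a b\<bar> \<le> M'"
  proof -
    show "M' \<ge> 1" by (simp add: M'_def)
    show "\<bar>k a b\<bar> \<le> M'" if "a \<in> A" "b \<in> B" for a b
      using bound[OF that] by (simp add: M'_def)
  qed
  (* The first bound on the learning rate keeps the factors 1 - \<eta> k in [1/2, 3/2], the second
     one makes the error from the second order term of the logarithm at most \<epsilon>/2. *)
  define \<eta> where "\<eta> = min (1 / (2 * M')) (\<epsilon> / (4 * M'^2))"
  have M'_pos: "M' > 0" using M'(1) by linarith
  have le: "\<eta> \<le> 1 / (2 * M')" "\<eta> \<le> \<epsilon> / (4 * M'^2)"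
    unfolding \<eta>_def by (rule min.cobounded1, rule min.cobounded2)
  have \<eta>: "\<eta> > 0" "\<eta> * M' \<le> 1/2" "2 * \<eta> * M'^2 \<le> \<epsilon> / 2"
  proof -
    show "\<eta> > 0" unfolding \<eta>_def min_less_iff_conj using M'_pos \<open>\<epsilon> > 0\<close> by simp
    show "\<eta> * M' \<le> 1/2" using mult_right_mono[OF le(1), of M'] M'_pos by simp
    show "2 * \<eta> * M'^2 \<le> \<epsilon> / 2" using mult_right_mono[OF le(2), of "M'^2"] M'_pos by simp
  qed
  define best where "best w = (SOME b. b \<in> B \<and> v * (\<Sum>a\<in>A. w a) \<le> (\<Sum>a\<in>A. w a * k a b))" for w
  define w where "w = rec_nat (\<lambda>_. 1) (\<lambda>_ w a. w a * (1 - \<eta> * k a (best w)))"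
  define y where "y t = best (w t)" for t
  have w_0: "w 0 a = 1" and w_Suc: "w (Suc t) a = w t a * (1 - \<eta> * k a (y t))" for t a
    by (simp_all add: w_def y_def)
  have best: "best u \<in> B \<and> v * (\<Sum>a\<in>A. u a) \<le> (\<Sum>a\<in>A. u a * k a (best u))"
    if "\<And>a. a \<in> A \<Longrightarrow> u a > 0" for u
    unfolding best_def using someI_ex[OF reply[OF that, unfolded Bex_def]] by simp
  have small: "\<bar>\<eta> * k a b\<bar> \<le> 1/2" if "a \<in> A" "b \<in> B" for a b
  proof -
    have "\<eta> * \<bar>k a b\<bar> \<le> \<eta> * M'" using \<eta> M'(2)[OF that] by (intro mult_left_mono) auto
    also have "\<dots> \<le> 1/2" by (rule \<eta>(2))
    finally show ?thesis using \<eta>(1) by (simp only: abs_mult abs_of_pos)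
  qed
  have w_pos: "w t a > 0" if "a \<in> A" for t a
  proof -
    have "\<forall>a\<in>A. w t a > 0"
    proof (induction t)
      case (Suc t)
      then have yB: "y t \<in> B" using best[of "w t"] by (simp add: y_def)
      show ?case
      proof
        fix a assume a: "a \<in> A"
        have "1 - \<eta> * k a (y t) > 0" using small[OF a yB] by linarith
        then show "w (Suc t) a > 0" using Suc a by (simp add: w_Suc)
      qed
    qed (simp add: w_0)
    then show ?thesis using that by auto
  qed
  have y: "y t \<in> B" "v * (\<Sum>a\<in>A. w t a) \<le> (\<Sum>a\<in>A. w t a * k a (y t))" for t
    using best[of "w t"] w_pos by (simp_all add: y_def)
  define m where "m = real (card A)"
  have m: "m > 0" using A by (auto simp: m_def card_gt_0_iff)
  have total: "(\<Sum>a\<in>A. w t a) \<le> m * exp (- \<eta> * v * t)" for t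
  proof (induction t)
    case (Suc t)
    have "(\<Sum>a\<in>A. w (Suc t) a) = (\<Sum>a\<in>A. w t a) - \<eta> * (\<Sum>a\<in>A. w t a * k a (y t))"
      by (simp add: w_Suc sum_subtractf sum_distrib_left algebra_simps)
    also have "\<dots> \<le> (\<Sum>a\<in>A. w t a) - \<eta> * (v * (\<Sum>a\<in>A. w t a))"
      using mult_left_mono[OF y(2), of \<eta> t] \<eta>(1) by simp
    also have "\<dots> = (\<Sum>a\<in>A. w t a) * (1 + (- \<eta> * v))" by (simp add: algebra_simps)
    also have "\<dots> \<le> (\<Sum>a\<in>A. w t a) * exp (- \<eta> * v)"
    proof (rule mult_left_mono)
      show "1 + - \<eta> * v \<le> exp (- \<eta> * v)" by (rule exp_ge_add_one_self)
      show "0 \<le> (\<Sum>a\<in>A. w t a)" by (intro sum_nonneg less_imp_le w_pos)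
    qed
    also have "\<dots> \<le> m * exp (- \<eta> * v * t) * exp (- \<eta> * v)"
      using Suc by (intro mult_right_mono) auto
    also have "\<dots> = m * exp (- \<eta> * v * Suc t)" by (simp add: exp_add[symmetric] algebra_simps)
    finally show ?case .
  qed (simp add: m_def w_0)
  have single: "- \<eta> * (\<Sum>s<t. k a (y s)) - 2 * \<eta>^2 * M'^2 * t \<le> ln (w t a)" if a: "a \<in> A" for a t
  proof (induction t)
    case (Suc t)
    let ?x = "- (\<eta> * k a (y t))"
    have x: "\<bar>?x\<bar> \<le> 1/2" using small[OF a y(1)] by simp
    have "?x^2 \<le> \<eta>^2 * M'^2"
      using power_mono[OF M'(2)[OF a y(1)[of t]], of 2] by (simp add: power_mult_distrib mult_left_mono)
    then have "?x - 2 * \<eta>^2 * M'^2 \<le> ln (1 + ?x)"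
      using abs_ln_one_plus_x_minus_x_bound[OF x] by (simp add: abs_le_iff)
    moreover have "ln (w (Suc t) a) = ln (w t a) + ln (1 + ?x)"
      using w_pos[OF a, of t] x by (simp add: w_Suc ln_mult)
    ultimately show ?case using Suc by (simp add: algebra_simps)
  qed (simp add: w_0)
  obtain n :: nat where n: "n > 0" "ln m / (\<eta> * n) \<le> \<epsilon> / 2"
  proof -
    obtain n :: nat where "real n > max 1 (2 * ln m / (\<eta> * \<epsilon>))"
      using reals_Archimedean2 by blast
    then have "n > 0" "real n > 2 * ln m / (\<eta> * \<epsilon>)" by auto
    then show ?thesis using that[of n] \<eta>(1) \<open>\<epsilon> > 0\<close> by (auto simp: field_simps)
  qed
  have "v - \<epsilon> \<le> (\<Sum>t<n. k a (y t)) / n" if a: "a \<in> A" for a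
  proof -
    have "w n a \<le> (\<Sum>a\<in>A. w n a)"
      using A(1) a w_pos by (intro member_le_sum) (auto intro: less_imp_le)
    then have "ln (w n a) \<le> ln (m * exp (- \<eta> * v * n))"
      using total[of n] w_pos[OF a] m by (subst ln_le_cancel_iff) auto
    also have "\<dots> = ln m - \<eta> * v * n" using m by (simp add: ln_mult)
    finally have "\<eta> * v * n - \<eta> * (2 * \<eta> * M'^2 * n) - ln m \<le> \<eta> * (\<Sum>t<n. k a (y t))"
      using single[OF a, of n] by (simp add: algebra_simps power2_eq_square)
    then have "(\<eta> * v * n - \<eta> * (2 * \<eta> * M'^2 * n) - ln m) / (\<eta> * n) \<le> \<eta> * (\<Sum>t<n. k a (y t)) / (\<eta> * n)"
      using \<eta>(1) by (intro divide_right_mono) auto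
    moreover have "(\<eta> * v * n - \<eta> * (2 * \<eta> * M'^2 * n) - ln m) / (\<eta> * n) = v - 2 * \<eta> * M'^2 - ln m / (\<eta> * n)"
      using \<eta>(1) n(1) by (simp add: field_simps)
    moreover have "\<eta> * (\<Sum>t<n. k a (y t)) / (\<eta> * n) = (\<Sum>t<n. k a (y t)) / n"
      using \<eta>(1) by simp
    ultimately show ?thesis using n(2) \<eta>(3) by linarith
  qed
  then show ?thesis using n(1) y(1) by blast
qed

lemma continuous_on_slice_measurable:
  fixes k :: "'a::polish_space \<times> 'b::polish_space \<Rightarrow> real"
  assumes "continuous_on (A \<times> B) k"
  shows "a \<in> A \<Longrightarrow> (\<lambda>b. k (a, b)) \<in> borel_measurable (restrict_space borel B)"
    and "b \<in> B \<Longrightarrow> (\<lambda>a. k (a, b)) \<in> borel_measurable (restrict_space borel A)"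
proof -
  assume "a \<in> A"
  then have "continuous_on B (\<lambda>b. k (a, b))"
    by (intro continuous_on_compose2[OF assms, of B "\<lambda>b. (a, b)"] continuous_intros) auto
  then show "(\<lambda>b. k (a, b)) \<in> borel_measurable (restrict_space borel B)"
    by (rule borel_measurable_continuous_on_restrict)
next
  assume "b \<in> B"
  then have "continuous_on A (\<lambda>a. k (a, b))"
    by (intro continuous_on_compose2[OF assms, of A "\<lambda>a. (a, b)"] continuous_intros) auto
  then show "(\<lambda>a. k (a, b)) \<in> borel_measurable (restrict_space borel A)"
    by (rule borel_measurable_continuous_on_restrict)
qed

lemma identity_to_restrict_prod:
  fixes A :: "'a::second_countable_topology set" and B :: "'b::second_countable_topology set"
  shows "(\<lambda>x. x) \<in> restrict_space borel A \<Otimes>\<^sub>M restrict_space borel B \<rightarrow>\<^sub>M restrict_space borel (A \<times> B)"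
proof (rule measurable_restrict_space2)
  have "(\<lambda>x. (fst x, snd x)) \<in> restrict_space borel A \<Otimes>\<^sub>M restrict_space borel B \<rightarrow>\<^sub>M borel \<Otimes>\<^sub>M borel"
    by (intro measurable_Pair measurable_compose[OF measurable_fst] measurable_compose[OF measurable_snd]
        measurable_restrict_space1 measurable_ident_sets refl)
  then show "(\<lambda>x. x) \<in> restrict_space borel A \<Otimes>\<^sub>M restrict_space borel B \<rightarrow>\<^sub>M borel"
    by (simp add: borel_prod)
qed (auto simp: space_pair_measure space_restrict_space)

lemma continuous_on_prod_measurable:
  fixes k :: "'a::second_countable_topology \<times> 'b::second_countable_topology \<Rightarrow> 'c::topological_space"
  assumes "continuous_on (A \<times> B) k"
  shows "k \<in> borel_measurable (restrict_space borel A \<Otimes>\<^sub>M restrict_space borel B)"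
  using measurable_compose[OF identity_to_restrict_prod borel_measurable_continuous_on_restrict[OF assms]] .

lemma prob_measures_iff: "\<psi> \<in> prob_measures A \<longleftrightarrow> prob_space \<psi> \<and> sets \<psi> = sets (restrict_space borel A)"
  by (auto simp: prob_measures_def space_prob_algebra)

lemma prob_measures_space: "\<psi> \<in> prob_measures A \<Longrightarrow> space \<psi> = A"
  using sets_eq_imp_space_eq[of \<psi> "restrict_space borel A"] by (simp add: prob_measures_iff space_restrict_space)

text \<open>
  Turns the time average over \<open>n\<close> replies into an integral against a mixed strategy.
\<close>

lemma uniform_on_points:
  fixes y :: "nat \<Rightarrow> 'b::topological_space"
  assumes "n > 0" and y: "\<And>t. y t \<in> B"
  obtains \<phi> where "\<phi> \<in> prob_measures B"
    "\<And>f :: 'b \<Rightarrow> real. f \<in> borel_measurable (restrict_space borel B) \<Longrightarrow>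
       (\<integral>b. f b \<partial>\<phi>) = (\<Sum>t<n. f (y t)) / real n"
proof
  let ?u = "measure_pmf (pmf_of_set {..<n})"
  let ?\<phi> = "distr ?u (restrict_space borel B) y"
  have ne: "{..<n} \<noteq> {}" using \<open>n > 0\<close> by auto
  have y_meas: "y \<in> ?u \<rightarrow>\<^sub>M restrict_space borel B"
    using y by (simp add: measurable_pmf_measure1 space_restrict_space)
  then show "?\<phi> \<in> prob_measures B"
    unfolding prob_measures_iff by (intro conjI measure_pmf.prob_space_distr) simp_all
  show "(\<integral>b. f b \<partial>?\<phi>) = (\<Sum>t<n. f (y t)) / real n"
    if "f \<in> borel_measurable (restrict_space borel B)" for f :: "'b \<Rightarrow> real"
    using ne by (simp add: integral_distr[OF y_meas that] integral_pmf_of_set)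
qed

text \<open>
  Turns the normalised weights of the algorithm into a mixed strategy.
\<close>

lemma weighted_points:
  fixes w :: "'b::topological_space \<Rightarrow> real"
  assumes A: "finite A" "A \<noteq> {}" "A \<subseteq> B" and w: "\<And>a. a \<in> A \<Longrightarrow> w a > 0"
  obtains \<phi> where "\<phi> \<in> prob_measures B"
    "\<And>f :: 'b \<Rightarrow> real. f \<in> borel_measurable (restrict_space borel B) \<Longrightarrow>
       (\<integral>b. f b \<partial>\<phi>) = (\<Sum>a\<in>A. w a * f a) / (\<Sum>a\<in>A. w a)"
proof
  let ?W = "\<Sum>a\<in>A. w a"
  let ?u = "point_measure A (\<lambda>a. ennreal (w a / ?W))"
  let ?\<phi> = "distr ?u (restrict_space borel B) (\<lambda>x. x)"
  have W: "?W > 0" using A w by (intro sum_pos) auto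
  have "(\<Sum>a\<in>A. ennreal (w a / ?W)) = ennreal (\<Sum>a\<in>A. w a / ?W)"
    using W w by (intro sum_ennreal) (auto intro: less_imp_le)
  also have "\<dots> = 1" using W by (simp add: sum_divide_distrib[symmetric])
  finally have u: "prob_space ?u"
    using A by (intro prob_spaceI) (simp add: space_point_measure emeasure_point_measure_finite)
  have id_meas: "(\<lambda>x. x) \<in> ?u \<rightarrow>\<^sub>M restrict_space borel B"
    using A by (auto simp: measurable_restrict_space2_iff space_point_measure)
  then show "?\<phi> \<in> prob_measures B"
    unfolding prob_measures_iff by (intro conjI prob_space.prob_space_distr[OF u]) simp_all
  show "(\<integral>b. f b \<partial>?\<phi>) = (\<Sum>a\<in>A. w a * f a) / ?W"
    if "f \<in> borel_measurable (restrict_space borel B)" for f :: "'b \<Rightarrow> real"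
  proof -
    have "(\<integral>b. f b \<partial>?\<phi>) = (\<Sum>a\<in>A. (w a / ?W) *\<^sub>R f a)"
      unfolding integral_distr[OF id_meas that]
      using A W w by (subst lebesgue_integral_point_measure_finite) (auto intro: less_imp_le)
    then show ?thesis by (simp add: sum_divide_distrib)
  qed
qed

lemma compact_finite_net_uniform:
  fixes k :: "'a::metric_space \<times> 'b::topological_space \<Rightarrow> real"
  assumes A: "compact A" and B: "compact B" and k: "continuous_on (A \<times> B) k" and "\<epsilon> > 0"
  obtains N where "finite N" "N \<subseteq> A" "\<And>a. a \<in> A \<Longrightarrow> \<exists>a'\<in>N. \<forall>b\<in>B. \<bar>k (a, b) - k (a', b)\<bar> \<le> \<epsilon>"
proof -
  have "\<exists>U. a \<in> U \<and> open U \<and> (\<forall>x\<in>U \<inter> A. \<forall>b\<in>B. dist (k (x, b)) (k (a, b)) \<le> \<epsilon>)" if "a \<in> A" for a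
    using continuous_on_prod_compactE[OF k B that \<open>\<epsilon> > 0\<close>] by metis
  then obtain U where U: "\<And>a. a \<in> A \<Longrightarrow> a \<in> U a \<and> open (U a) \<and>
      (\<forall>x\<in>U a \<inter> A. \<forall>b\<in>B. dist (k (x, b)) (k (a, b)) \<le> \<epsilon>)"
    by metis
  obtain N where N: "N \<subseteq> A" "finite N" "A \<subseteq> (\<Union>a\<in>N. U a)"
    by (rule compactE_image[OF A, of A U]) (use U in blast)+
  show ?thesis
  proof
    fix a assume "a \<in> A"
    then obtain a' where "a' \<in> N" "a \<in> U a'" using N by auto
    moreover from this have "a' \<in> A" using N by auto
    ultimately show "\<exists>a'\<in>N. \<forall>b\<in>B. \<bar>k (a, b) - k (a', b)\<bar> \<le> \<epsilon>"
      using U[of a'] \<open>a \<in> A\<close> by (intro bexI[of _ a']) (auto simp: dist_real_def)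
  qed (use N in auto)
qed

text \<open>
  The weights live on a finite net of \<open>A\<close> that is fine uniformly in \<open>b\<close>. The bound on the empirical
  distribution of the replies then extends from the net to all of \<open>A\<close>, half of \<open>\<epsilon>\<close> being spent
  on the algorithm and half on the net.
\<close>

lemma minimax_mixed:
  fixes k :: "'a::polish_space \<times> 'b::polish_space \<Rightarrow> real"
  assumes A: "compact A" "A \<noteq> {}" and B: "compact B" and k: "continuous_on (A \<times> B) k"
    and reply: "\<And>\<psi>. \<psi> \<in> prob_measures A \<Longrightarrow> \<exists>b\<in>B. v \<le> (\<integral>a. k (a, b) \<partial>\<psi>)"
    and "\<epsilon> > 0"
  shows "\<exists>\<phi>\<in>prob_measures B. \<forall>a\<in>A. v - \<epsilon> \<le> (\<integral>b. k (a, b) \<partial>\<phi>)"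
proof -
  obtain N where N: "finite N" "N \<subseteq> A"
    and net: "\<And>a. a \<in> A \<Longrightarrow> \<exists>a'\<in>N. \<forall>b\<in>B. \<bar>k (a, b) - k (a', b)\<bar> \<le> \<epsilon> / 2"
    using compact_finite_net_uniform[OF A(1) B k, of "\<epsilon> / 2"] \<open>\<epsilon> > 0\<close> by auto
  have "N \<noteq> {}" using net A(2) by auto
  obtain M where M: "\<And>z. z \<in> A \<times> B \<Longrightarrow> \<bar>k z\<bar> \<le> M"
    using compact_imp_bounded[OF compact_continuous_image[OF k compact_Times[OF A(1) B]]]
    by (auto simp: bounded_iff)
  have "\<exists>n y. n > (0::nat) \<and> (\<forall>t. y t \<in> B) \<and> (\<forall>a\<in>N. v - \<epsilon> / 2 \<le> (\<Sum>t<n. k (a, y t)) / real n)"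
  proof (rule multiplicative_weights[where k = "\<lambda>a b. k (a, b)" and M = M])
    fix w :: "'a \<Rightarrow> real" assume w: "\<And>a. a \<in> N \<Longrightarrow> w a > 0"
    then obtain \<psi> where \<psi>: "\<psi> \<in> prob_measures A"
      "\<And>f :: 'a \<Rightarrow> real. f \<in> borel_measurable (restrict_space borel A) \<Longrightarrow>
         (\<integral>a. f a \<partial>\<psi>) = (\<Sum>a\<in>N. w a * f a) / (\<Sum>a\<in>N. w a)"
      using weighted_points[OF N(1) \<open>N \<noteq> {}\<close> N(2), of w] by metis
    obtain b where b: "b \<in> B" "v \<le> (\<integral>a. k (a, b) \<partial>\<psi>)" using reply[OF \<psi>(1)] by auto
    have "(\<Sum>a\<in>N. w a) > 0" using w N \<open>N \<noteq> {}\<close> by (intro sum_pos) auto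
    then show "\<exists>b\<in>B. v * (\<Sum>a\<in>N. w a) \<le> (\<Sum>a\<in>N. w a * k (a, b))"
      using b(2) unfolding \<psi>(2)[OF continuous_on_slice_measurable(2)[OF k b(1)]]
      by (intro bexI[OF _ b(1)]) (simp add: pos_le_divide_eq)
  qed (use N M \<open>N \<noteq> {}\<close> \<open>\<epsilon> > 0\<close> in auto)
  then obtain n y where n: "n > (0::nat)" and y: "\<And>t. y t \<in> B"
    and avg: "\<And>a. a \<in> N \<Longrightarrow> v - \<epsilon> / 2 \<le> (\<Sum>t<n. k (a, y t)) / real n"
    by auto
  obtain \<phi> where \<phi>: "\<phi> \<in> prob_measures B"
    "\<And>f :: 'b \<Rightarrow> real. f \<in> borel_measurable (restrict_space borel B) \<Longrightarrow>
       (\<integral>b. f b \<partial>\<phi>) = (\<Sum>t<n. f (y t)) / real n"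
    using uniform_on_points[OF n, of y B] y by metis
  have "v - \<epsilon> \<le> (\<integral>b. k (a, b) \<partial>\<phi>)" if a: "a \<in> A" for a
  proof -
    obtain a' where a': "a' \<in> N" "\<forall>b\<in>B. \<bar>k (a, b) - k (a', b)\<bar> \<le> \<epsilon> / 2"
      using net[OF a] by auto
    have "(\<Sum>t<n. k (a', y t)) \<le> (\<Sum>t<n. k (a, y t) + \<epsilon> / 2)"
    proof (rule sum_mono)
      show "k (a', y t) \<le> k (a, y t) + \<epsilon> / 2" for t
        using a'(2)[rule_format, OF y[of t]] by linarith
    qed
    also have "\<dots> = (\<Sum>t<n. k (a, y t)) + n * (\<epsilon> / 2)" by (simp add: sum.distrib)
    finally have "(\<Sum>t<n. k (a', y t)) / real n \<le> (\<Sum>t<n. k (a, y t)) / real n + \<epsilon> / 2"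
      using n by (simp add: field_simps)
    then show ?thesis
      using avg[OF a'(1)] \<phi>(2)[OF continuous_on_slice_measurable(1)[OF k a]] by linarith
  qed
  then show ?thesis using \<phi>(1) by auto
qed

section \<open>Integrals against pairs of mixed strategies\<close>

lemma mixed_integrable:
  fixes f :: "'a::polish_space \<times> 'b::polish_space \<Rightarrow> real"
  assumes A: "compact A" and B: "compact B" and f: "continuous_on (A \<times> B) f"
    and \<psi>: "\<psi> \<in> prob_measures A" and \<phi>: "\<phi> \<in> prob_measures B"
  shows "integrable (\<psi> \<Otimes>\<^sub>M \<phi>) f" and "space (\<psi> \<Otimes>\<^sub>M \<phi>) = A \<times> B" and "pair_sigma_finite \<psi> \<phi>"
    and "prob_space (\<psi> \<Otimes>\<^sub>M \<phi>)"
proof -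
  interpret P1: prob_space \<psi> using \<psi> by (simp add: prob_measures_iff)
  interpret P2: prob_space \<phi> using \<phi> by (simp add: prob_measures_iff)
  interpret P: pair_prob_space \<psi> \<phi> ..
  show "pair_sigma_finite \<psi> \<phi>" by (rule P.pair_sigma_finite_axioms)
  show "prob_space (\<psi> \<Otimes>\<^sub>M \<phi>)" by (rule P.prob_space_axioms)
  show sp: "space (\<psi> \<Otimes>\<^sub>M \<phi>) = A \<times> B"
    using prob_measures_space[OF \<psi>] prob_measures_space[OF \<phi>] by (simp add: space_pair_measure)
  obtain M where "\<forall>y\<in>f ` (A \<times> B). norm y \<le> M"
    using compact_imp_bounded[OF compact_continuous_image[OF f compact_Times[OF A B]]] unfolding bounded_iff by blast
  then have M: "\<bar>f z\<bar> \<le> M" if "z \<in> A \<times> B" for z using that by (metis imageI real_norm_def)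
  have "sets (\<psi> \<Otimes>\<^sub>M \<phi>) = sets (restrict_space borel A \<Otimes>\<^sub>M restrict_space borel B)"
    using \<psi> \<phi> unfolding prob_measures_iff by (intro sets_pair_measure_cong) blast+
  then have "f \<in> borel_measurable (\<psi> \<Otimes>\<^sub>M \<phi>)"
    using continuous_on_prod_measurable[OF f] measurable_cong_sets[OF _ refl] by blast
  then show "integrable (\<psi> \<Otimes>\<^sub>M \<phi>) f"
    by (intro P.integrable_const_bound[of _ M] AE_I2) (simp_all only: sp real_norm_def M)
qed

lemma mixed_eq_pair_integral:
  fixes f :: "'a::polish_space \<times> 'b::polish_space \<Rightarrow> real"
  assumes "compact A" "compact B" "continuous_on (A \<times> B) f" "\<psi> \<in> prob_measures A" "\<phi> \<in> prob_measures B"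
  shows "(LINT a|\<psi>. LINT b|\<phi>. f (a, b)) = (\<integral>z. f z \<partial>(\<psi> \<Otimes>\<^sub>M \<phi>))"
    and "(LINT a|\<psi>. LINT b|\<phi>. f (a, b)) = (LINT b|\<phi>. LINT a|\<psi>. f (a, b))"
proof -
  interpret pair_sigma_finite \<psi> \<phi> by (rule mixed_integrable[OF assms])
  show "(LINT a|\<psi>. LINT b|\<phi>. f (a, b)) = (\<integral>z. f z \<partial>(\<psi> \<Otimes>\<^sub>M \<phi>))"
    by (rule integral_fst'[OF mixed_integrable(1)[OF assms]])
  show "(LINT a|\<psi>. LINT b|\<phi>. f (a, b)) = (LINT b|\<phi>. LINT a|\<psi>. f (a, b))"
    using mixed_integrable(1)[OF assms] by (intro Fubini_integral[symmetric]) simp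
qed

lemma mixed_mono:
  fixes f f' :: "'a::polish_space \<times> 'b::polish_space \<Rightarrow> real"
  assumes "compact A" "compact B" and f: "continuous_on (A \<times> B) f" and f': "continuous_on (A \<times> B) f'"
    and "\<psi> \<in> prob_measures A" "\<phi> \<in> prob_measures B" and le: "\<And>z. z \<in> A \<times> B \<Longrightarrow> f z \<le> f' z"
  shows "(LINT a|\<psi>. LINT b|\<phi>. f (a, b)) \<le> (LINT a|\<psi>. LINT b|\<phi>. f' (a, b))"
  unfolding mixed_eq_pair_integral(1)[OF assms(1,2) f assms(5,6)] mixed_eq_pair_integral(1)[OF assms(1,2) f' assms(5,6)]
  using mixed_integrable(2)[OF assms(1,2) f assms(5,6)]
  by (intro integral_mono mixed_integrable(1)[OF assms(1,2) _ assms(5,6)] f f' le) simp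

lemma nn_mixed:
  fixes f :: "'a::polish_space \<times> 'b::polish_space \<Rightarrow> real"
  assumes "compact A" "compact B" "continuous_on (A \<times> B) f" "\<psi> \<in> prob_measures A" "\<phi> \<in> prob_measures B"
    and nonneg: "\<And>z. z \<in> A \<times> B \<Longrightarrow> 0 \<le> f z"
  shows "(\<integral>\<^sup>+a. \<integral>\<^sup>+b. ennreal (f (a, b)) \<partial>\<phi> \<partial>\<psi>) = ennreal (LINT a|\<psi>. LINT b|\<phi>. f (a, b))"
proof -
  note I = mixed_integrable[OF assms(1-5)]
  interpret pair_sigma_finite \<psi> \<phi> by (rule I)
  have "(\<integral>\<^sup>+a. \<integral>\<^sup>+b. ennreal (f (a, b)) \<partial>\<phi> \<partial>\<psi>) = (\<integral>\<^sup>+z. ennreal (f z) \<partial>(\<psi> \<Otimes>\<^sub>M \<phi>))"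
    by (rule M2.nn_integral_fst) (rule measurable_compose[OF borel_measurable_integrable[OF I(1)] measurable_ennreal])
  also have "\<dots> = ennreal (\<integral>z. f z \<partial>(\<psi> \<Otimes>\<^sub>M \<phi>))"
    using nonneg by (intro nn_integral_eq_integral[OF I(1)] AE_I2) (simp add: I(2))
  finally show ?thesis by (simp add: mixed_eq_pair_integral(1)[OF assms(1-5)])
qed

lemma mixed_bound_slices:
  fixes f :: "'a::polish_space \<times> 'b::polish_space \<Rightarrow> real"
  assumes A: "compact A" and B: "compact B" and f: "continuous_on (A \<times> B) f"
    and \<psi>: "\<psi> \<in> prob_measures A" and \<phi>: "\<phi> \<in> prob_measures B"
  shows "(\<And>a. a \<in> A \<Longrightarrow> v \<le> (LINT b|\<phi>. f (a, b))) \<Longrightarrow> v \<le> (LINT a|\<psi>. LINT b|\<phi>. f (a, b))"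
    and "(\<And>b. b \<in> B \<Longrightarrow> (LINT a|\<psi>. f (a, b)) \<le> v) \<Longrightarrow> (LINT a|\<psi>. LINT b|\<phi>. f (a, b)) \<le> v"
proof -
  interpret P1: prob_space \<psi> using \<psi> unfolding prob_measures_iff by blast
  interpret P2: prob_space \<phi> using \<phi> unfolding prob_measures_iff by blast
  interpret P: pair_sigma_finite \<psi> \<phi> by (rule mixed_integrable[OF A B f \<psi> \<phi>])
  note int = mixed_integrable(1)[OF A B f \<psi> \<phi>]
  have sp: "space \<psi> = A" "space \<phi> = B" by (rule prob_measures_space[OF \<psi>], rule prob_measures_space[OF \<phi>])
  show "v \<le> (LINT a|\<psi>. LINT b|\<phi>. f (a, b))" if "\<And>a. a \<in> A \<Longrightarrow> v \<le> (LINT b|\<phi>. f (a, b))"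
    by (intro P1.integral_ge_const P.integrable_fst' int AE_I2 that) (simp only: sp)
  show "(LINT a|\<psi>. LINT b|\<phi>. f (a, b)) \<le> v" if "\<And>b. b \<in> B \<Longrightarrow> (LINT a|\<psi>. f (a, b)) \<le> v"
    unfolding mixed_eq_pair_integral(2)[OF A B f \<psi> \<phi>]
  proof (intro P2.integral_le_const AE_I2 that)
    show "integrable \<phi> (\<lambda>b. LINT a|\<psi>. f (a, b))"
      by (rule P.integrable_snd) (simp add: int)
  qed (simp only: sp)
qed

lemma prob_measures_empty: "prob_measures {} = {}"
proof -
  have "False" if \<psi>: "\<psi> \<in> prob_measures {}" for \<psi> :: "'c::topological_space measure"
  proof -
    interpret prob_space \<psi> using \<psi> unfolding prob_measures_iff by blast
    show False using not_empty prob_measures_space[OF \<psi>] by simp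
  qed
  then show ?thesis by blast
qed

text \<open>
  Relates the two forms in which mixed actions occur: probability measures on the admissible set,
  and kernels on the whole action space that are concentrated on it.
\<close>

lemma extend_prob_measure:
  fixes X Y :: "'c::topological_space set"
  assumes \<psi>: "\<psi> \<in> prob_measures X" and X: "X \<in> sets borel" "X \<subseteq> Y" and Y: "Y \<in> sets borel"
  defines "\<kappa> \<equiv> distr \<psi> (restrict_space borel Y) (\<lambda>x. x)"
  shows "\<kappa> \<in> space (prob_algebra (restrict_space borel Y))" and "emeasure \<kappa> X = 1" and "restrict_space \<kappa> X = \<psi>"
proof -
  interpret prob_space \<psi> using \<psi> unfolding prob_measures_iff by blast
  have sets_\<psi>: "sets \<psi> = sets (restrict_space borel X)" using \<psi> unfolding prob_measures_iff by blast
  have sp: "space \<psi> = X" by (rule prob_measures_space[OF \<psi>])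
  have id: "(\<lambda>x. x) \<in> \<psi> \<rightarrow>\<^sub>M restrict_space borel Y"
    unfolding measurable_cong_sets[OF sets_\<psi> refl] using X(2)
    by (intro measurable_restrict_space2 measurable_restrict_space1 measurable_ident_sets refl)
       (auto simp: space_restrict_space)
  show "\<kappa> \<in> space (prob_algebra (restrict_space borel Y))"
    unfolding space_prob_algebra \<kappa>_def using prob_space_distr[OF id] by simp
  have XY: "X \<in> sets (restrict_space borel Y)" using X Y by (simp add: sets_restrict_space_iff)
  show "emeasure \<kappa> X = 1"
    unfolding \<kappa>_def using emeasure_space_1 by (simp add: emeasure_distr[OF id XY] sp)
  have space_\<kappa>: "X \<inter> space \<kappa> \<in> sets \<kappa>" using XY X(2) by (simp add: \<kappa>_def space_restrict_space Int_absorb2)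
  show "restrict_space \<kappa> X = \<psi>"
  proof (rule measure_eqI)
    show "sets (restrict_space \<kappa> X) = sets \<psi>"
      unfolding sets_\<psi> \<kappa>_def using X(2)
      by (subst sets_restrict_space_cong[of _ "restrict_space borel Y"]) (simp_all add: sets_restrict_restrict_space inf.absorb2)
    fix Z assume "Z \<in> sets (restrict_space \<kappa> X)"
    then have Z: "Z \<subseteq> X" "Z \<in> sets (restrict_space borel Y)"
      using space_\<kappa> by (simp_all add: sets_restrict_space_iff) (simp add: \<kappa>_def)
    then show "emeasure (restrict_space \<kappa> X) Z = emeasure \<psi> Z"
      using space_\<kappa> sp by (simp add: emeasure_restrict_space) (simp add: \<kappa>_def emeasure_distr[OF id] Int_absorb2)
  qed
qed

section \<open>Exponential growth rates\<close>

lemma SUP_INF_le_INF_SUP: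
  fixes f :: "'a \<Rightarrow> 'b \<Rightarrow> 'c::complete_lattice"
  shows "(SUP y\<in>Y. INF x\<in>X. f x y) \<le> (INF x\<in>X. SUP y\<in>Y. f x y)"
  by (intro SUP_least INF_greatest) (meson INF_lower SUP_upper order_trans)

lemma le_ereal_if_le_all_above:
  assumes le: "\<And>r'. r < r' \<Longrightarrow> y \<le> ereal r'"
  shows "y \<le> ereal r"
proof (rule ereal_le_epsilon2)
  show "y \<le> ereal r + ereal e" if "0 < e" for e using le[of "r + e"] that by simp
qed

lemma ereal_le_if_le_all_below:
  assumes le: "\<And>r'. r' < r \<Longrightarrow> ereal r' \<le> y"
  shows "ereal r \<le> y"
proof (rule ereal_le_epsilon2)
  show "ereal r \<le> y + ereal e" if "0 < e" for e
    using le[of "r - e"] that by (cases y) simp_all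
qed

lemma elog_mono: "x \<le> y \<Longrightarrow> elog x \<le> elog y"
  by (cases x; cases y) (auto simp: elog_def ennreal_le_iff2 top_unique)

lemma elog_ennreal: "r > 0 \<Longrightarrow> elog (ennreal r) = ereal (ln r)"
  by (simp add: elog_def)

text \<open>
  The constant \<open>c\<close> contributes \<open>ln c / (\<theta> t)\<close>, which vanishes in the limit.
\<close>

lemma exponential_rate_tendsto:
  fixes \<theta> g c :: real
  assumes "\<theta> > 0" "c > 0"
  shows "((\<lambda>t. ereal (1 / (\<theta> * t)) * elog (ennreal (c * exp (\<theta> * g * t)))) \<longlongrightarrow> ereal g) at_top"
proof -
  have "((\<lambda>t. ln c / \<theta> * inverse t + g) \<longlongrightarrow> ln c / \<theta> * 0 + g) at_top"
    by (intro tendsto_intros tendsto_inverse_0_at_top filterlim_ident)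
  then have "((\<lambda>t. ereal (ln c / \<theta> * inverse t + g)) \<longlongrightarrow> ereal g) at_top" by simp
  moreover have "\<forall>\<^sub>F t in at_top. ereal (ln c / \<theta> * inverse t + g) = ereal (1 / (\<theta> * t)) * elog (ennreal (c * exp (\<theta> * g * t)))"
    using eventually_gt_at_top[of 0]
  proof eventually_elim
    case (elim t)
    have "elog (ennreal (c * exp (\<theta> * g * t))) = ereal (ln c + \<theta> * g * t)"
      using assms by (simp add: elog_ennreal ln_mult)
    then show ?case using assms elim by (simp add: field_simps)
  qed
  ultimately show ?thesis by (rule Lim_transform_eventually)
qed

lemma growth_rate_upper:
  fixes \<theta> g c :: real and E :: "real \<Rightarrow> ennreal"
  assumes "\<theta> > 0" "c > 0" and le: "\<And>t. t > 0 \<Longrightarrow> E t \<le> ennreal (c * exp (\<theta> * g * t))"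
  shows "Limsup at_top (\<lambda>t. ereal (1 / (\<theta> * t)) * elog (E t)) \<le> ereal g"
proof -
  have "Limsup at_top (\<lambda>t. ereal (1 / (\<theta> * t)) * elog (E t))
      \<le> Limsup at_top (\<lambda>t. ereal (1 / (\<theta> * t)) * elog (ennreal (c * exp (\<theta> * g * t))))"
  proof (rule Limsup_mono)
    show "\<forall>\<^sub>F t in at_top. ereal (1 / (\<theta> * t)) * elog (E t) \<le> ereal (1 / (\<theta> * t)) * elog (ennreal (c * exp (\<theta> * g * t)))"
      using eventually_gt_at_top[of 0]
      by eventually_elim (use assms(1) in \<open>auto intro!: ereal_mult_left_mono elog_mono le\<close>)
  qed
  also have "\<dots> = ereal g"
    by (rule lim_imp_Limsup[OF trivial_limit_at_top_linorder exponential_rate_tendsto[OF assms(1,2)]])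
  finally show ?thesis .
qed

lemma growth_rate_lower:
  fixes \<theta> g c :: real and E :: "real \<Rightarrow> ennreal"
  assumes "\<theta> > 0" "c > 0" and ge: "\<And>t. t > 0 \<Longrightarrow> ennreal (c * exp (\<theta> * g * t)) \<le> E t"
  shows "ereal g \<le> Limsup at_top (\<lambda>t. ereal (1 / (\<theta> * t)) * elog (E t))"
proof -
  have "ereal g = Limsup at_top (\<lambda>t. ereal (1 / (\<theta> * t)) * elog (ennreal (c * exp (\<theta> * g * t))))"
    by (rule lim_imp_Limsup[OF trivial_limit_at_top_linorder exponential_rate_tendsto[OF assms(1,2)], symmetric])
  also have "\<dots> \<le> Limsup at_top (\<lambda>t. ereal (1 / (\<theta> * t)) * elog (E t))"
  proof (rule Limsup_mono)
    show "\<forall>\<^sub>F t in at_top. ereal (1 / (\<theta> * t)) * elog (ennreal (c * exp (\<theta> * g * t))) \<le> ereal (1 / (\<theta> * t)) * elog (E t)"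
      using eventually_gt_at_top[of 0]
      by eventually_elim (use assms(1) in \<open>auto intro!: ereal_mult_left_mono elog_mono ge\<close>)
  qed
  finally show ?thesis .
qed

section \<open>Continuity and compactness of the stage data\<close>

text \<open>
  Substituting \<open>t = s u\<close> moves the variable upper limit into the integrand, so that the continuity of
  parameter integrals over the fixed interval \<open>[0, 1]\<close> applies.
\<close>

lemma continuous_on_primitive_param:
  fixes \<rho> :: "'z::topological_space \<Rightarrow> real \<Rightarrow> real"
  assumes \<rho>: "continuous_on (K \<times> {0..c}) (\<lambda>(z, t). \<rho> z t)"
  shows "continuous_on (K \<times> {0..c}) (\<lambda>(z, s). LBINT t:{0..s}. \<rho> z t)"
proof -
  have scaled: "continuous_on ((K \<times> {0..c}) \<times> {0..1}) (\<lambda>(p, u). \<rho> (fst p) (snd p * u))"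
    unfolding split_beta
    by (rule continuous_on_compose2[OF \<rho>, unfolded split_beta, where f = "\<lambda>q. (fst (fst q), snd (fst q) * snd q)", simplified])
       (auto intro!: continuous_intros mult_nonneg_nonneg intro: order_trans[OF mult_right_le_one_le])
  have "continuous_on (K \<times> {0..c}) (\<lambda>p. integral (cbox 0 1) (\<lambda>u. \<rho> (fst p) (snd p * u)))"
    by (rule integral_continuous_on_param) (use scaled in \<open>simp add: cbox_interval split_beta\<close>)
  then have "continuous_on (K \<times> {0..c}) (\<lambda>p. snd p * integral {0..1} (\<lambda>u. \<rho> (fst p) (snd p * u)))"
    by (intro continuous_intros) (simp add: cbox_interval)
  then show ?thesis
  proof (rule continuous_on_cong[THEN iffD1, rotated -1, OF _ refl])
    fix p assume "p \<in> K \<times> {0..c}"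
    then obtain z s where p: "p = (z, s)" and z: "z \<in> K" and s: "0 \<le> s" "s \<le> c" by auto
    have cont: "continuous_on {0..1} (\<lambda>u. \<rho> z (s * u))"
      using s z by (intro continuous_on_compose2[OF scaled, where f = "\<lambda>u. ((z, s), u)", simplified split_beta fst_conv snd_conv])
         (auto intro!: continuous_intros)
    have "(LBINT t:{0..s}. \<rho> z t) = s * integral {0..1} (\<lambda>u. \<rho> z (s * u))"
    proof (cases "s = 0")
      case True
      then show ?thesis
        using set_borel_integral_eq_integral(2)[OF borel_integrable_atLeastAtMost', of 0 0 "\<rho> z"] by simp
    next
      case False
      with s have "s > 0" by simp
      have "(LBINT t:{0..s}. \<rho> z t) = s * (\<integral>u. indicator {0..s} (s * u) * \<rho> z (s * u) \<partial>lborel)"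
        unfolding set_lebesgue_integral_def
        using lborel_integral_real_affine[of s "\<lambda>t. indicator {0..s} t *\<^sub>R \<rho> z t" 0] \<open>s > 0\<close> by simp
      also have "(\<lambda>u. indicator {0..s} (s * u) * \<rho> z (s * u)) = (\<lambda>u. indicator {0..1} u *\<^sub>R \<rho> z (s * u))"
        using \<open>s > 0\<close> by (auto simp: indicator_def zero_le_mult_iff fun_eq_iff)
      finally show ?thesis
        using set_borel_integral_eq_integral(2)[OF borel_integrable_atLeastAtMost'[OF cont]]
        by (simp add: set_lebesgue_integral_def)
    qed
    then show "snd p * integral {0..1} (\<lambda>u. \<rho> (fst p) (snd p * u)) = (case p of (z, s) \<Rightarrow> LBINT t:{0..s}. \<rho> z t)"
      by (simp add: p)
  qed
qed

text \<open>
  Dini's argument: points where \<open>f n\<close> is at least \<open>\<epsilon>\<close> would accumulate at a point where, by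
  monotonicity, all \<open>f m\<close> are at least \<open>\<epsilon>\<close>.
\<close>

lemma decreasing_to_zero_uniformly:
  fixes f :: "nat \<Rightarrow> 'a::metric_space \<Rightarrow> real"
  assumes K: "compact K" and cont: "\<And>n. continuous_on K (f n)"
    and dec: "\<And>m n z. z \<in> K \<Longrightarrow> m \<le> n \<Longrightarrow> f n z \<le> f m z"
    and lim: "\<And>z. z \<in> K \<Longrightarrow> (\<lambda>n. f n z) \<longlonglongrightarrow> 0" and "\<epsilon> > 0"
  shows "\<exists>n. \<forall>z\<in>K. f n z < \<epsilon>"
proof (rule ccontr)
  assume "\<not> ?thesis"
  then obtain z where z: "\<And>n. z n \<in> K" "\<And>n. f n (z n) \<ge> \<epsilon>" by (metis not_le)
  then obtain l r where l: "l \<in> K" "strict_mono (r :: nat \<Rightarrow> nat)" "(z \<circ> r) \<longlonglongrightarrow> l"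
    using K unfolding compact_def by blast
  have "\<epsilon> \<le> f m l" for m
  proof (rule tendsto_lowerbound)
    show "(\<lambda>n. f m ((z \<circ> r) n)) \<longlonglongrightarrow> f m l"
    proof -
      have "(f m \<circ> (z \<circ> r)) \<longlonglongrightarrow> f m l"
        using cont[of m] l(1,3) z(1) unfolding continuous_on_sequentially by simp
      then show ?thesis by (simp add: comp_def)
    qed
    have "\<epsilon> \<le> f m ((z \<circ> r) n)" if "n \<ge> m" for n
      using dec[OF z(1), of m "r n" "r n"] z(2)[of "r n"] that seq_suble[OF l(2), of n] by simp
    then show "\<forall>\<^sub>F n in sequentially. \<epsilon> \<le> f m ((z \<circ> r) n)" by (auto simp: eventually_sequentially)
  qed simp
  then have "\<epsilon> \<le> 0" using lim[OF l(1)] by (intro LIMSEQ_le_const) auto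
  then show False using \<open>\<epsilon> > 0\<close> by simp
qed

text \<open>
  Pairs \<open>z = (a, b)\<close> of actions are used throughout, so that continuity in both actions is
  continuity on the compact set \<open>K x\<close>.
\<close>

locale regular_game =
  fixes G :: "('s::finite, 'a::polish_space, 'b::polish_space) smg" and sbar \<theta> :: real
  assumes game: "semi_markov_game G" and assumption1: "assumption1 G sbar" and \<theta>_pos: "\<theta> > 0"
    and adm1_nonempty: "\<And>x. adm1 G x \<noteq> {}" and adm2_nonempty: "\<And>x. adm2 G x \<noteq> {}"
begin

abbreviation "K x \<equiv> adm1 G x \<times> adm2 G x"
abbreviation "law_S x z \<equiv> interval_measure (sojourn G x (fst z) (snd z))"
abbreviation "run x z s \<equiv> LBINT t:{0..s}. rate G x (fst z) (snd z) t"

lemma sbar_pos: "sbar > 0"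
  and compact_adm1: "compact (adm1 G x)"
  and compact_adm2: "compact (adm2 G x)"
  and cost_continuous: "continuous_on (K x) (\<lambda>z. cost G x (fst z) (snd z))"
  and transition_continuous: "continuous_on (K x) (\<lambda>z. transition G x j (fst z) (snd z))"
  and sojourn_integral_continuous: "(u :: real \<Rightarrow> real) \<in> borel_measurable borel \<Longrightarrow> bounded (range u) \<Longrightarrow>
        continuous_on (K x) (\<lambda>z. LINT s:{0..sbar}|law_S x z. u s)"
proof -
  note regular = assumption1[unfolded assumption1_def split_beta]
  show "sbar > 0" "compact (adm1 G x)" "compact (adm2 G x)"
    "continuous_on (K x) (\<lambda>z. cost G x (fst z) (snd z))"
    "continuous_on (K x) (\<lambda>z. transition G x j (fst z) (snd z))"
    using regular by simp_all
  show "continuous_on (K x) (\<lambda>z. LINT s:{0..sbar}|law_S x z. u s)"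
    if "u \<in> borel_measurable borel" "bounded (range u)" for u :: "real \<Rightarrow> real"
    using regular[THEN conjunct2, THEN conjunct2, THEN conjunct2, THEN conjunct2, THEN conjunct2, THEN conjunct1,
      rule_format, OF conjI[OF that], of x] .
qed

lemma compact_K: "compact (K x)"
  by (intro compact_Times compact_adm1 compact_adm2)

lemma K_nonempty: "K x \<noteq> {}"
  using adm1_nonempty adm2_nonempty by auto

lemma adm1_borel: "adm1 G x \<in> sets borel" "adm1 G x \<subseteq> act1 G"
  and adm2_borel: "adm2 G x \<in> sets borel" "adm2 G x \<subseteq> act2 G"
  and act1_borel: "act1 G \<in> sets borel" and act2_borel: "act2 G \<in> sets borel"
  using game unfolding semi_markov_game_def by auto

lemma transition_nonneg: "z \<in> K x \<Longrightarrow> 0 \<le> transition G x j (fst z) (snd z)"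
  and transition_sum: "z \<in> K x \<Longrightarrow> (\<Sum>j\<in>UNIV. transition G x j (fst z) (snd z)) = 1"
  using game unfolding semi_markov_game_def by auto

lemma sojourn_law:
  assumes "z \<in> K x"
  shows "real_distribution (law_S x z)" and "emeasure (law_S x z) {0<..sbar} = 1"
proof -
  let ?F = "sojourn G x (fst z) (snd z)"
  have F: "distribution_function ?F" "?F 0 = 0" "?F sbar = 1"
    using game assumption1 assms unfolding semi_markov_game_def assumption1_def by auto
  then show "real_distribution (law_S x z)"
    unfolding distribution_function_def
    by (intro real_distribution_interval_measure) (auto dest: monoD)
  show "emeasure (law_S x z) {0<..sbar} = 1"
    using F sbar_pos unfolding distribution_function_def
    by (subst emeasure_interval_measure_Ioc) (auto dest: monoD)
qed

lemma AE_sojourn: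
  assumes "z \<in> K x"
  shows "AE s in law_S x z. 0 < s \<and> s \<le> sbar"
proof -
  interpret real_distribution "law_S x z" using sojourn_law(1)[OF assms] .
  have "AE s in law_S x z. s \<in> {0<..sbar}"
    using sojourn_law(2)[OF assms] by (subst AE_in_set_eq_1) (auto simp: measure_def)
  then show ?thesis by simp
qed

lemma set_integrable_sojourn:
  fixes u :: "real \<Rightarrow> real"
  assumes z: "z \<in> K x" and u: "continuous_on {0..sbar} u"
  shows "set_integrable (law_S x z) {0..sbar} u"
proof -
  interpret real_distribution "law_S x z" using sojourn_law(1)[OF z] .
  obtain M where M: "\<And>s. s \<in> {0..sbar} \<Longrightarrow> \<bar>u s\<bar> \<le> M"
    using compact_imp_bounded[OF compact_continuous_image[OF u compact_Icc]] unfolding bounded_iff by force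
  have "(\<lambda>s. indicator {0..sbar} s *\<^sub>R u s) \<in> borel_measurable borel"
    by (rule borel_measurable_continuous_on_indicator[OF _ u]) simp
  moreover have "\<bar>M\<bar> \<ge> M" by simp
  ultimately show ?thesis unfolding set_integrable_def
    by (intro integrable_const_bound[where B = "\<bar>M\<bar>"] AE_I2)
       (auto simp: indicator_def intro: order_trans[OF M])
qed

lemma sojourn_integral_mono:
  fixes u v :: "real \<Rightarrow> real"
  assumes z: "z \<in> K x" and u: "continuous_on {0..sbar} u" and v: "continuous_on {0..sbar} v"
    and le: "\<And>s. 0 \<le> s \<Longrightarrow> s \<le> sbar \<Longrightarrow> u s \<le> v s"
  shows "(LINT s:{0..sbar}|law_S x z. u s) \<le> (LINT s:{0..sbar}|law_S x z. v s)"
  by (rule set_integral_mono[OF set_integrable_sojourn[OF z u] set_integrable_sojourn[OF z v]])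
     (use le in auto)

lemma sojourn_integral_const:
  assumes "z \<in> K x"
  shows "(LINT s:{0..sbar}|law_S x z. c) = (c :: real)"
proof -
  interpret real_distribution "law_S x z" using sojourn_law(1)[OF assms] .
  have "(LINT s:{0..sbar}|law_S x z. c) = (\<integral>s. c \<partial>law_S x z)"
    unfolding set_lebesgue_integral_def
  proof (rule integral_cong_AE)
    show "AE s in law_S x z. indicator {0..sbar} s *\<^sub>R c = c"
      using AE_sojourn[OF assms] by eventually_elim simp
  qed simp_all
  then show ?thesis using prob_space by simp
qed

lemma sojourn_integral_pos:
  fixes u :: "real \<Rightarrow> real"
  assumes z: "z \<in> K x" and u: "continuous_on {0..sbar} u" and pos: "\<And>s. 0 < s \<Longrightarrow> s \<le> sbar \<Longrightarrow> 0 < u s"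
    and nonneg: "0 \<le> u 0"
  shows "0 < (LINT s:{0..sbar}|law_S x z. u s)"
proof -
  interpret real_distribution "law_S x z" using sojourn_law(1)[OF z] .
  let ?v = "\<lambda>s. indicator {0..sbar} s *\<^sub>R u s"
  have int: "integrable (law_S x z) ?v"
    using set_integrable_sojourn[OF z u] by (simp add: set_integrable_def)
  have nn: "?v s \<ge> 0" for s
    using pos[of s] nonneg by (cases "s = 0") (auto simp: indicator_def)
  have "(\<integral>s. ?v s \<partial>law_S x z) \<noteq> 0"
  proof
    assume "(\<integral>s. ?v s \<partial>law_S x z) = 0"
    then have "AE s in law_S x z. ?v s = 0"
      using integral_nonneg_eq_0_iff_AE[OF int] nn by simp
    with AE_sojourn[OF z] have "AE s in law_S x z. False"
      by eventually_elim (use pos in \<open>force simp: indicator_def\<close>)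
    then show False by simp
  qed
  moreover have "(\<integral>s. ?v s \<partial>law_S x z) \<ge> 0" using nn by (intro Bochner_Integration.integral_nonneg) auto
  ultimately show ?thesis by (simp add: set_lebesgue_integral_def)
qed

text \<open>
  The continuity hypothesis on sojourn times is about integrands that do not depend on the actions.
  Compactness of \<open>[0, sbar]\<close> makes \<open>u z\<close> uniformly close to \<open>u z0\<close> for \<open>z\<close> near \<open>z0\<close>, and the
  sojourn laws are probability measures, so freezing the integrand at \<open>z0\<close> costs little.
\<close>

lemma sojourn_integral_param_continuous:
  fixes u :: "'a \<times> 'b \<Rightarrow> real \<Rightarrow> real"
  assumes u: "continuous_on (K x \<times> {0..sbar}) (\<lambda>(z, s). u z s)"
  shows "continuous_on (K x) (\<lambda>z. LINT s:{0..sbar}|law_S x z. u z s)"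
proof -
  let ?I = "\<lambda>z y. LINT s:{0..sbar}|law_S x z. u y s"
  have slice: "continuous_on {0..sbar} (u z)" if "z \<in> K x" for z
    by (rule continuous_on_compose2[OF u, where f = "\<lambda>s. (z, s)", simplified split_beta fst_conv snd_conv])
       (use that in \<open>auto intro!: continuous_intros\<close>)
  show ?thesis unfolding continuous_on_def
  proof (intro ballI tendstoI)
    fix z0 and e :: real assume z0: "z0 \<in> K x" and "e > 0"
    obtain X0 where X0: "z0 \<in> X0" "open X0"
      and near: "\<forall>z\<in>X0 \<inter> K x. \<forall>s\<in>{0..sbar}. dist (u z s) (u z0 s) \<le> e / 3"
      using continuous_on_prod_compactE[OF u compact_Icc z0, of "e / 3"] \<open>e > 0\<close>
      by (auto simp: split_beta)
    let ?u0 = "\<lambda>s. indicator {0..sbar} s *\<^sub>R u z0 s"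
    have "?u0 \<in> borel_measurable borel"
      by (rule borel_measurable_continuous_on_indicator[OF _ slice[OF z0]]) simp
    moreover have "bounded (range ?u0)"
    proof -
      have "bounded (insert 0 (u z0 ` {0..sbar}))"
        using compact_imp_bounded[OF compact_continuous_image[OF slice[OF z0] compact_Icc]] by simp
      then show ?thesis by (rule bounded_subset) (auto simp: indicator_def)
    qed
    ultimately have "continuous_on (K x) (\<lambda>z. LINT s:{0..sbar}|law_S x z. ?u0 s)"
      by (rule sojourn_integral_continuous)
    moreover have "(LINT s:{0..sbar}|law_S x z. ?u0 s) = ?I z z0" for z
      by (intro set_lebesgue_integral_cong) auto
    ultimately have "continuous_on (K x) (\<lambda>z. ?I z z0)" by simp
    then have "((\<lambda>z. ?I z z0) \<longlongrightarrow> ?I z0 z0) (at z0 within K x)"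
      using z0 by (auto simp: continuous_on_def)
    then have "\<forall>\<^sub>F z in at z0 within K x. dist (?I z z0) (?I z0 z0) < e / 3"
      using \<open>e > 0\<close> by (intro tendstoD) auto
    moreover have "\<forall>\<^sub>F z in at z0 within K x. z \<in> X0 \<inter> K x"
      using X0 by (auto simp: eventually_at_topological)
    ultimately show "\<forall>\<^sub>F z in at z0 within K x. dist (?I z z) (?I z0 z0) < e"
    proof eventually_elim
      case (elim z)
      then have z: "z \<in> K x" by simp
      have close: "\<bar>u z s - u z0 s\<bar> \<le> e / 3" if "0 \<le> s" "s \<le> sbar" for s
        using near[rule_format, OF elim(2), of s] that by (simp add: dist_real_def)
      have "?I z z \<le> (LINT s:{0..sbar}|law_S x z. u z0 s + e / 3)"
        using close by (intro sojourn_integral_mono z slice z0 continuous_intros) (smt (verit, best))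
      moreover have "(LINT s:{0..sbar}|law_S x z. u z0 s - e / 3) \<le> ?I z z"
        using close by (intro sojourn_integral_mono z slice z0 continuous_intros) (smt (verit, best))
      moreover have "(LINT s:{0..sbar}|law_S x z. u z0 s + e / 3) = ?I z z0 + e / 3"
        by (subst set_integral_add(2)) (auto intro!: set_integrable_sojourn z slice z0 simp: sojourn_integral_const[OF z])
      moreover have "(LINT s:{0..sbar}|law_S x z. u z0 s - e / 3) = ?I z z0 - e / 3"
        by (subst set_integral_diff(2)) (auto intro!: set_integrable_sojourn z slice z0 simp: sojourn_integral_const[OF z])
      ultimately show ?case using elim(1) unfolding dist_real_def by linarith
    qed
  qed
qed

lemma run_continuous: "continuous_on (K x \<times> {0..sbar}) (\<lambda>(z, s). run x z s)"
proof (rule continuous_on_primitive_param)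
  have rate: "continuous_on (adm1 G x \<times> adm2 G x \<times> {0..sbar}) (\<lambda>(a, b, s). rate G x a b s)"
    using assumption1 unfolding assumption1_def by auto
  show "continuous_on (K x \<times> {0..sbar}) (\<lambda>(z, t). rate G x (fst z) (snd z) t)"
    unfolding split_beta
    by (rule continuous_on_compose2[OF rate, unfolded split_beta, where f = "\<lambda>q. (fst (fst q), snd (fst q), snd q)", simplified])
       (auto intro!: continuous_intros)
qed

lemma run_slice_continuous: "z \<in> K x \<Longrightarrow> continuous_on {0..sbar} (run x z)"
  by (rule continuous_on_compose2[OF run_continuous, where f = "\<lambda>s. (z, s)", simplified split_beta fst_conv snd_conv])
     (auto intro!: continuous_intros)

text \<open>
  The only factor of the payoff in the optimality equation that depends on \<open>g\<close>.
\<close>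

definition gain :: "real \<Rightarrow> 's \<Rightarrow> 'a \<times> 'b \<Rightarrow> real" where
  "gain g x z = (LINT s:{0..sbar}|law_S x z. exp (\<theta> * (run x z s - g * s)))"

lemma gain_continuous: "continuous_on (K x) (gain g x)"
  unfolding gain_def
proof (rule sojourn_integral_param_continuous)
  show "continuous_on (K x \<times> {0..sbar}) (\<lambda>(z, s). exp (\<theta> * (run x z s - g * s)))"
    using run_continuous[of x] unfolding split_beta by (intro continuous_intros)
qed

lemma gain_integrand_continuous: "z \<in> K x \<Longrightarrow> continuous_on {0..sbar} (\<lambda>s. exp (\<theta> * (run x z s - g * s)))"
  using run_slice_continuous by (intro continuous_intros)

lemma gain_pos: "z \<in> K x \<Longrightarrow> 0 < gain g x z"
  unfolding gain_def by (intro sojourn_integral_pos gain_integrand_continuous) auto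

lemma gain_strict_decreasing:
  assumes z: "z \<in> K x" and "g < g'"
  shows "gain g' x z < gain g x z"
proof -
  note int = set_integrable_sojourn[OF z gain_integrand_continuous[OF z]]
  have "0 < (LINT s:{0..sbar}|law_S x z. exp (\<theta> * (run x z s - g * s)) - exp (\<theta> * (run x z s - g' * s)))"
  proof (rule sojourn_integral_pos[OF z])
    show "continuous_on {0..sbar} (\<lambda>s. exp (\<theta> * (run x z s - g * s)) - exp (\<theta> * (run x z s - g' * s)))"
      by (intro continuous_on_diff gain_integrand_continuous z)
    show "0 < exp (\<theta> * (run x z s - g * s)) - exp (\<theta> * (run x z s - g' * s))" if "0 < s" for s
      using that \<open>g < g'\<close> \<theta>_pos by simp
  qed simp
  then show ?thesis
    unfolding gain_def by (subst (asm) set_integral_diff(2)[OF int int]) simp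
qed

text \<open>
  The quotient of the two gains is continuous on the compact set \<open>K x\<close> and pointwise less than \<open>1\<close>,
  because sojourn times are positive; its maximum is the factor.
\<close>

lemma gain_contraction:
  assumes "g < g'"
  obtains q where "0 < q" "q < 1" "\<And>x z. z \<in> K x \<Longrightarrow> gain g' x z \<le> q * gain g x z"
proof -
  have "\<exists>q. 0 < q \<and> q < 1 \<and> (\<forall>z\<in>K x. gain g' x z \<le> q * gain g x z)" for x
  proof -
    have cont: "continuous_on (K x) (\<lambda>z. gain g' x z / gain g x z)"
      by (intro continuous_on_divide gain_continuous ballI less_imp_neq[THEN not_sym] gain_pos)
    obtain y where y: "y \<in> K x" "\<And>z. z \<in> K x \<Longrightarrow> gain g' x z / gain g x z \<le> gain g' x y / gain g x y"
      using continuous_attains_sup[OF compact_K K_nonempty cont] by blast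
    show ?thesis
      using gain_pos[OF y(1)] gain_strict_decreasing[OF y(1) assms]
    proof (intro exI[of _ "gain g' x y / gain g x y"] conjI ballI)
      show "gain g' x z \<le> gain g' x y / gain g x y * gain g x z" if "z \<in> K x" for z
        using y(2)[OF that] gain_pos[OF that, of g] by (simp only: pos_divide_le_eq)
    qed simp_all
  qed
  then have "\<exists>q. \<forall>x. 0 < q x \<and> q x < 1 \<and> (\<forall>z\<in>K x. gain g' x z \<le> q x * gain g x z)"
    by (rule choice[OF allI])
  then obtain q where q: "\<And>x. 0 < q x" "\<And>x. q x < 1" "\<And>x z. z \<in> K x \<Longrightarrow> gain g' x z \<le> q x * gain g x z"
    by blast
  let ?q = "Max (range q)"
  have "q x \<le> ?q" for x by simp
  then have "gain g' x z \<le> ?q * gain g x z" if "z \<in> K x" for x z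
    using q(3)[OF that] mult_right_mono[OF \<open>q x \<le> ?q\<close> less_imp_le[OF gain_pos[OF that, of g]]] by linarith
  moreover have "0 < ?q" "?q < 1" using q by (auto simp: Max_gr_iff)
  ultimately show ?thesis using that by blast
qed

text \<open>
  For fixed actions the Laplace transform of a positive random variable tends to \<open>0\<close>. It does so
  monotonically and continuously in the actions, hence uniformly by Dini's argument.
\<close>

lemma uniform_laplace_small:
  assumes "\<epsilon> > 0"
  obtains \<beta> :: real where "\<beta> \<ge> 0" "\<And>x z. z \<in> K x \<Longrightarrow> (LINT s:{0..sbar}|law_S x z. exp (- \<beta> * s)) \<le> \<epsilon>"
proof -
  define f where "f x n z = (LINT s:{0..sbar}|law_S x z. exp (- real n * s))" for x n z
  have dec: "f x n z \<le> f x m z" if "z \<in> K x" "m \<le> n" for x m n z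
    unfolding f_def
  proof (rule sojourn_integral_mono[OF that(1)])
    show "exp (- real n * s) \<le> exp (- real m * s)" if "0 \<le> s" for s
      using \<open>m \<le> n\<close> that by (simp add: mult_right_mono)
  qed (intro continuous_intros)+
  have "\<exists>n. \<forall>z\<in>K x. f x n z < \<epsilon>" for x
  proof (rule decreasing_to_zero_uniformly[OF compact_K _ _ _ assms])
    show "continuous_on (K x) (f x n)" for n
      unfolding f_def by (rule sojourn_integral_param_continuous) (auto simp: split_beta intro!: continuous_intros)
  next
    fix z assume z: "z \<in> K x"
    interpret real_distribution "law_S x z" using sojourn_law(1)[OF z] .
    have "(\<lambda>n. \<integral>s. indicator {0..sbar} s *\<^sub>R exp (- real n * s) \<partial>law_S x z) \<longlonglongrightarrow> (\<integral>s. 0 \<partial>law_S x z)"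
    proof (rule integral_dominated_convergence[where w = "\<lambda>_. 1"])
      show "AE s in law_S x z. (\<lambda>n. indicator {0..sbar} s *\<^sub>R exp (- real n * s)) \<longlonglongrightarrow> 0"
        using AE_sojourn[OF z]
      proof eventually_elim
        case (elim s)
        then have "(\<lambda>n. exp (- s) ^ n) \<longlonglongrightarrow> 0" by (intro LIMSEQ_realpow_zero) auto
        then show ?case using elim by (simp add: exp_of_nat_mult[symmetric])
      qed
    qed (auto simp: indicator_def intro!: mult_nonneg_nonneg)
    then show "(\<lambda>n. f x n z) \<longlonglongrightarrow> 0" by (simp add: f_def set_lebesgue_integral_def)
  qed (rule dec)
  then have "\<exists>n. \<forall>x. \<forall>z\<in>K x. f x (n x) z < \<epsilon>" by (rule choice[OF allI])
  then obtain n where n: "\<And>x z. z \<in> K x \<Longrightarrow> f x (n x) z < \<epsilon>" by blast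
  let ?n = "Max (range n)"
  have "f x ?n z \<le> \<epsilon>" if "z \<in> K x" for x z
    using dec[OF that, of "n x" ?n] n[OF that] by simp
  then show ?thesis using that[of "real ?n"] by (simp add: f_def)
qed

end

section \<open>The law of the process as an iterated integral\<close>

context regular_game
begin

abbreviation "MA x \<equiv> restrict_space borel (adm1 G x)"
abbreviation "MB x \<equiv> restrict_space borel (adm2 G x)"
abbreviation "Mtime \<equiv> restrict_space borel {0::real<..}"
abbreviation "law_S' x z \<equiv> restrict_space (law_S x z) {0<..}"

lemma space_MK: "space (MA x \<Otimes>\<^sub>M MB x) = K x"
  by (simp add: space_pair_measure space_restrict_space)

lemma space_stage: "space (stage_space G) = {(x, a, b, s). a \<in> adm1 G x \<and> b \<in> adm2 G x \<and> 0 < s}"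
  by (auto simp: stage_space_def space_restrict_space space_pair_measure)

lemma stage_insert_measurable:
  "(\<lambda>(z, s). (x, fst z, snd z, s)) \<in> (MA x \<Otimes>\<^sub>M MB x) \<Otimes>\<^sub>M Mtime \<rightarrow>\<^sub>M stage_space G"
  unfolding stage_space_def
proof (rule measurable_restrict_space2)
  have id: "(\<lambda>y. y) \<in> restrict_space borel Y \<rightarrow>\<^sub>M borel" for Y :: "'c::topological_space set"
    by (intro measurable_restrict_space1 measurable_ident_sets refl)
  show "(\<lambda>(z, s). (x, fst z, snd z, s)) \<in>
      (MA x \<Otimes>\<^sub>M MB x) \<Otimes>\<^sub>M Mtime \<rightarrow>\<^sub>M count_space UNIV \<Otimes>\<^sub>M borel \<Otimes>\<^sub>M borel \<Otimes>\<^sub>M borel"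
    unfolding split_beta
    by (intro measurable_Pair measurable_const measurable_compose[OF measurable_snd id]
        measurable_compose[OF measurable_compose[OF measurable_fst measurable_fst] id]
        measurable_compose[OF measurable_compose[OF measurable_fst measurable_snd] id]) simp
qed (auto simp: space_pair_measure space_restrict_space)

text \<open>
  The state is discrete, so measurability on the stage space may be checked for each state separately,
  on the product of the admissible sets with the positive half-line.
\<close>

lemma stage_measurable:
  assumes f: "\<And>x. (\<lambda>(z, s). f (x, fst z, snd z, s)) \<in> (MA x \<Otimes>\<^sub>M MB x) \<Otimes>\<^sub>M Mtime \<rightarrow>\<^sub>M N"
  shows "f \<in> stage_space G \<rightarrow>\<^sub>M N"
proof (rule measurable_piecewise_restrict[where C = "range (\<lambda>x. {w. fst w = x})"])
  let ?P = "count_space UNIV \<Otimes>\<^sub>M borel \<Otimes>\<^sub>M borel \<Otimes>\<^sub>M borel :: ('s \<times> 'a \<times> 'b \<times> real) measure"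
  have sub: "g \<in> ?P \<rightarrow>\<^sub>M L \<Longrightarrow> g \<in> stage_space G \<rightarrow>\<^sub>M L" for g and L :: "'d measure"
    unfolding stage_space_def by (rule measurable_restrict_space1)
  fix \<Omega> assume "\<Omega> \<in> range (\<lambda>x. {w :: 's \<times> 'a \<times> 'b \<times> real. fst w = x})"
  then obtain x where \<Omega>: "\<Omega> = {w. fst w = x}" by auto
  have "(\<lambda>w. fst w) -` {x} \<inter> space (stage_space G) \<in> sets (stage_space G)"
    by (rule measurable_sets[where A = "count_space UNIV"], rule sub, rule measurable_fst) simp
  moreover have "\<Omega> \<inter> space (stage_space G) = (\<lambda>w. fst w) -` {x} \<inter> space (stage_space G)"
    using \<Omega> by auto
  ultimately show "\<Omega> \<inter> space (stage_space G) \<in> sets (stage_space G)" by simp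
  let ?R = "restrict_space (stage_space G) \<Omega>"
  have in_R: "fst (snd w) \<in> adm1 G x" "fst (snd (snd w)) \<in> adm2 G x" "0 < snd (snd (snd w))" "fst w = x"
    if "w \<in> space ?R" for w
    using that \<Omega> by (auto simp: space_restrict_space space_stage)
  have "(\<lambda>w. ((fst (snd w), fst (snd (snd w))), snd (snd (snd w)))) \<in> ?R \<rightarrow>\<^sub>M (MA x \<Otimes>\<^sub>M MB x) \<Otimes>\<^sub>M Mtime"
  proof (intro measurable_Pair measurable_restrict_space2)
    show "(\<lambda>w. fst (snd w)) \<in> ?R \<rightarrow>\<^sub>M borel" "(\<lambda>w. fst (snd (snd w))) \<in> ?R \<rightarrow>\<^sub>M borel"
      "(\<lambda>w. snd (snd (snd w))) \<in> ?R \<rightarrow>\<^sub>M borel"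
      by (rule measurable_restrict_space1, rule sub, measurable)+
  qed (use in_R in auto)
  from measurable_compose[OF this f[of x]]
  have "(\<lambda>w. f (x, fst (snd w), fst (snd (snd w)), snd (snd (snd w)))) \<in> ?R \<rightarrow>\<^sub>M N" by simp
  then show "f \<in> ?R \<rightarrow>\<^sub>M N"
    by (rule measurable_cong[THEN iffD1, rotated]) (metis in_R(4) prod.collapse)
qed auto

lemma prob_space_law_S':
  assumes z: "z \<in> K x"
  shows "prob_space (law_S' x z)"
proof -
  interpret real_distribution "law_S x z" using sojourn_law(1)[OF z] .
  have "AE s in law_S x z. s \<in> {0<..}" using AE_sojourn[OF z] by eventually_elim simp
  then show ?thesis by (intro prob_space_restrict_space) (auto simp: emeasure_eq_1_AE)
qed

lemma nn_integral_law_S':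
  assumes z: "z \<in> K x" and u: "continuous_on {0..sbar} u" and nonneg: "\<And>s. 0 \<le> s \<Longrightarrow> s \<le> sbar \<Longrightarrow> 0 \<le> u s"
    and f: "\<And>s. 0 < s \<Longrightarrow> s \<le> sbar \<Longrightarrow> f s = ennreal (u s)"
  shows "(\<integral>\<^sup>+s. f s \<partial>law_S' x z) = ennreal (LINT s:{0..sbar}|law_S x z. u s)"
proof -
  have "(\<integral>\<^sup>+s. f s \<partial>law_S' x z) = (\<integral>\<^sup>+s. f s * indicator {0<..} s \<partial>law_S x z)"
    by (subst nn_integral_restrict_space) auto
  also have "\<dots> = (\<integral>\<^sup>+s. ennreal (indicator {0..sbar} s *\<^sub>R u s) \<partial>law_S x z)"
    by (rule nn_integral_cong_AE, use AE_sojourn[OF z] in eventually_elim) (simp add: f)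
  also have "\<dots> = ennreal (LINT s:{0..sbar}|law_S x z. u s)"
    unfolding set_lebesgue_integral_def using set_integrable_sojourn[OF z u] nonneg
    by (intro nn_integral_eq_integral) (auto simp: set_integrable_def indicator_def)
  finally show ?thesis .
qed

text \<open>
  The mass of a Borel set \<open>Y\<close> is the integral of the bounded measurable function \<open>indicator Y\<close>, hence
  continuous in the actions by the hypothesis on sojourn times.
\<close>

lemma law_S'_measurable: "law_S' x \<in> MA x \<Otimes>\<^sub>M MB x \<rightarrow>\<^sub>M prob_algebra Mtime"
proof (rule measurable_prob_algebraI)
  fix z assume "z \<in> space (MA x \<Otimes>\<^sub>M MB x)"
  then show "prob_space (law_S' x z)" by (simp add: space_MK prob_space_law_S')
next
  show "law_S' x \<in> MA x \<Otimes>\<^sub>M MB x \<rightarrow>\<^sub>M subprob_algebra Mtime"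
  proof (rule measurable_subprob_algebra)
    fix z assume "z \<in> space (MA x \<Otimes>\<^sub>M MB x)"
    then show "subprob_space (law_S' x z)" by (simp add: space_MK prob_space_law_S' prob_space_imp_subprob_space)
    show "sets (law_S' x z) = sets Mtime" by (intro sets_restrict_space_cong) simp
  next
    fix Y assume "Y \<in> sets Mtime"
    then have Y: "Y \<in> sets borel" "Y \<subseteq> {0<..}" by (auto simp: sets_restrict_space_iff)
    have "emeasure (law_S' x z) Y = ennreal (LINT s:{0..sbar}|law_S x z. indicator Y s)"
      if z: "z \<in> space (MA x \<Otimes>\<^sub>M MB x)" for z
    proof -
      have zK: "z \<in> K x" using z by (simp add: space_MK)
      interpret real_distribution "law_S x z" using sojourn_law(1)[OF zK] .
      have "emeasure (law_S' x z) Y = emeasure (law_S x z) Y"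
        using Y by (intro emeasure_restrict_space) auto
      also have "\<dots> = emeasure (law_S x z) (Y \<inter> {0..sbar})"
        using Y by (intro emeasure_eq_AE) (auto intro!: eventually_mono[OF AE_sojourn[OF zK]])
      also have "\<dots> = ennreal (measure (law_S x z) (Y \<inter> {0..sbar}))" by (simp add: emeasure_eq_measure)
      also have "measure (law_S x z) (Y \<inter> {0..sbar}) = (LINT s:{0..sbar}|law_S x z. indicator Y s)"
        unfolding set_lebesgue_integral_def using Y
        by (simp add: indicator_inter_arith[symmetric] Int_commute)
      finally show ?thesis .
    qed
    moreover have "continuous_on (K x) (\<lambda>z. LINT s:{0..sbar}|law_S x z. indicator Y s :: real)"
      using Y by (intro sojourn_integral_continuous) (auto simp: bounded_iff indicator_def intro!: exI[of _ 1])
    then have "(\<lambda>z. ennreal (LINT s:{0..sbar}|law_S x z. indicator Y s)) \<in> borel_measurable (MA x \<Otimes>\<^sub>M MB x)"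
      by (intro measurable_compose[OF _ measurable_ennreal] continuous_on_prod_measurable)
    ultimately show "(\<lambda>z. emeasure (law_S' x z) Y) \<in> borel_measurable (MA x \<Otimes>\<^sub>M MB x)"
      by (simp cong: measurable_cong)
  qed
qed

definition stage_law :: "'s \<Rightarrow> 'a \<times> 'b \<Rightarrow> ('s \<times> 'a \<times> 'b \<times> real) measure" where
  "stage_law x z = distr (law_S' x z) (stage_space G) (\<lambda>s. (x, fst z, snd z, s))"

lemma stage_law_measurable: "stage_law x \<in> MA x \<Otimes>\<^sub>M MB x \<rightarrow>\<^sub>M prob_algebra (stage_space G)"
  unfolding stage_law_def
  by (rule measurable_distr_prob_space2[OF law_S'_measurable stage_insert_measurable])

lemma transition_measurable:
  "(\<lambda>w. case w of (x, a, b, s) \<Rightarrow> transition G x j a b) \<in> borel_measurable (stage_space G)"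
  by (rule stage_measurable)
     (use continuous_on_prod_measurable[OF transition_continuous] in \<open>simp add: split_beta measurable_compose[OF measurable_fst]\<close>)

lemma next_state_prob:
  assumes "w \<in> space (stage_space G)"
  shows "prob_space (next_state G w)"
proof -
  obtain x a b s where w: "w = (x, a, b, s)" by (cases w)
  with assms have z: "(a, b) \<in> K x" by (simp add: space_stage)
  have "(\<Sum>j\<in>UNIV. ennreal (transition G x j a b)) = ennreal (\<Sum>j\<in>UNIV. transition G x j a b)"
    using transition_nonneg[OF z] by (intro sum_ennreal) simp
  also have "\<dots> = 1" using transition_sum[OF z] by simp
  finally show ?thesis
    by (intro prob_spaceI) (simp add: next_state_def w space_point_measure emeasure_point_measure_finite)
qed

lemma next_state_measurable: "next_state G \<in> stage_space G \<rightarrow>\<^sub>M prob_algebra (count_space UNIV)"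
proof (rule measurable_prob_algebraI)
  show "next_state G \<in> stage_space G \<rightarrow>\<^sub>M subprob_algebra (count_space UNIV)"
  proof (rule measurable_subprob_algebra)
    show "subprob_space (next_state G w)" if "w \<in> space (stage_space G)" for w
      using next_state_prob[OF that] by (rule prob_space_imp_subprob_space)
    show "sets (next_state G w) = sets (count_space UNIV)" for w
      by (simp add: next_state_def sets_point_measure split_beta)
    show "(\<lambda>w. emeasure (next_state G w) Y) \<in> borel_measurable (stage_space G)" for Y
    proof -
      have "emeasure (next_state G w) Y = (\<Sum>j\<in>Y. ennreal (case w of (x, a, b, s) \<Rightarrow> transition G x j a b))" for w
        by (simp add: next_state_def split_beta emeasure_point_measure_finite)
      then show ?thesis
        by (simp only:) (intro borel_measurable_sum measurable_compose[OF transition_measurable measurable_ennreal])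
    qed
  qed
qed (rule next_state_prob)

lemma restrict_kernel:
  fixes \<kappa> :: "'h \<Rightarrow> 'c::topological_space measure"
  assumes \<kappa>: "\<kappa> \<in> H \<rightarrow>\<^sub>M prob_algebra (restrict_space borel Y)" and Y: "Y \<in> sets borel"
    and X: "X \<in> sets borel" "X \<subseteq> Y" "X \<noteq> {}" and full: "\<And>h. h \<in> space H \<Longrightarrow> emeasure (\<kappa> h) X = 1"
  shows "(\<lambda>h. restrict_space (\<kappa> h) X) \<in> H \<rightarrow>\<^sub>M prob_algebra (restrict_space borel X)"
proof (rule measurable_prob_algebraI)
  have XY: "X \<in> sets (restrict_space borel Y)" using X Y by (simp add: sets_restrict_space_iff)
  have "(\<lambda>h. restrict_space (\<kappa> h) X) \<in> H \<rightarrow>\<^sub>M subprob_algebra (restrict_space (restrict_space borel Y) X)"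
    by (intro restrict_space_measurable X(3) XY measurable_prob_algebraD \<kappa>)
  moreover have "subprob_algebra (restrict_space (restrict_space borel Y) X) = subprob_algebra (restrict_space borel X)"
    using X(2) by (intro subprob_algebra_cong) (simp add: sets_restrict_restrict_space inf.absorb2)
  ultimately show "(\<lambda>h. restrict_space (\<kappa> h) X) \<in> H \<rightarrow>\<^sub>M subprob_algebra (restrict_space borel X)" by simp
next
  fix h assume h: "h \<in> space H"
  then have "\<kappa> h \<in> space (prob_algebra (restrict_space borel Y))" using measurable_space[OF \<kappa>] by blast
  then interpret prob_space "\<kappa> h" by (simp add: space_prob_algebra)
  show "prob_space (restrict_space (\<kappa> h) X)"
    using full[OF h] emeasure_notin_sets[of X "\<kappa> h"] by (intro prob_space_restrict_space) auto
qed

end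

text \<open>
  A play with initial state \<open>i\<close>. The stage kernels turn out to satisfy the hypotheses of the
  Ionescu-Tulcea theorem.
\<close>

locale controlled_game = regular_game G sbar \<theta>
  for G :: "('s::finite, 'a::polish_space, 'b::polish_space) smg" and sbar \<theta> +
  fixes i :: 's and \<pi>1 :: "nat \<Rightarrow> ('s, 'a, 'b) history \<Rightarrow> 'a measure"
    and \<pi>2 :: "nat \<Rightarrow> ('s, 'a, 'b) history \<Rightarrow> 'b measure"
  assumes \<pi>1: "\<pi>1 \<in> policies1 G" and \<pi>2: "\<pi>2 \<in> policies2 G"
begin

abbreviation "stages n \<equiv> PiM {0..<n :: nat} (\<lambda>_. stage_space G)"

definition state_law :: "nat \<Rightarrow> (nat \<Rightarrow> 's \<times> 'a \<times> 'b \<times> real) \<Rightarrow> 's measure" where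
  "state_law n \<omega> = (if n = 0 then return (count_space UNIV) i else next_state G (\<omega> (n - 1)))"

abbreviation "choice1 n \<omega> x \<equiv> restrict_space (\<pi>1 n (\<omega>, x)) (adm1 G x)"
abbreviation "choice2 n \<omega> x \<equiv> restrict_space (\<pi>2 n (\<omega>, x)) (adm2 G x)"

lemma history_in_space: "\<omega> \<in> space (stages n) \<Longrightarrow> (\<omega>, x) \<in> space (history_space G n)"
  by (simp add: history_space_def space_pair_measure)

lemma choice1_measurable: "(\<lambda>\<omega>. choice1 n \<omega> x) \<in> stages n \<rightarrow>\<^sub>M prob_algebra (MA x)"
proof (rule restrict_kernel[OF _ act1_borel adm1_borel adm1_nonempty])
  have "(\<lambda>\<omega>. (\<omega>, x)) \<in> stages n \<rightarrow>\<^sub>M history_space G n"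
    unfolding history_space_def by (intro measurable_Pair measurable_ident_sets measurable_const refl) simp
  moreover have "\<pi>1 n \<in> history_space G n \<rightarrow>\<^sub>M prob_algebra (restrict_space borel (act1 G))"
    using \<pi>1 by (auto simp: policies1_def)
  ultimately show "(\<lambda>\<omega>. \<pi>1 n (\<omega>, x)) \<in> stages n \<rightarrow>\<^sub>M prob_algebra (restrict_space borel (act1 G))"
    by (rule measurable_compose)
  show "emeasure (\<pi>1 n (\<omega>, x)) (adm1 G x) = 1" if "\<omega> \<in> space (stages n)" for \<omega>
    using \<pi>1 history_in_space[OF that, of x] unfolding policies1_def by force
qed

lemma choice2_measurable: "(\<lambda>\<omega>. choice2 n \<omega> x) \<in> stages n \<rightarrow>\<^sub>M prob_algebra (MB x)"
proof (rule restrict_kernel[OF _ act2_borel adm2_borel adm2_nonempty])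
  have "(\<lambda>\<omega>. (\<omega>, x)) \<in> stages n \<rightarrow>\<^sub>M history_space G n"
    unfolding history_space_def by (intro measurable_Pair measurable_ident_sets measurable_const refl) simp
  moreover have "\<pi>2 n \<in> history_space G n \<rightarrow>\<^sub>M prob_algebra (restrict_space borel (act2 G))"
    using \<pi>2 by (auto simp: policies2_def)
  ultimately show "(\<lambda>\<omega>. \<pi>2 n (\<omega>, x)) \<in> stages n \<rightarrow>\<^sub>M prob_algebra (restrict_space borel (act2 G))"
    by (rule measurable_compose)
  show "emeasure (\<pi>2 n (\<omega>, x)) (adm2 G x) = 1" if "\<omega> \<in> space (stages n)" for \<omega>
    using \<pi>2 history_in_space[OF that, of x] unfolding policies2_def by force
qed

lemma choice1_prob: "\<omega> \<in> space (stages n) \<Longrightarrow> choice1 n \<omega> x \<in> prob_measures (adm1 G x)"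
  using measurable_space[OF choice1_measurable] by (simp add: prob_measures_def)

lemma choice2_prob: "\<omega> \<in> space (stages n) \<Longrightarrow> choice2 n \<omega> x \<in> prob_measures (adm2 G x)"
  using measurable_space[OF choice2_measurable] by (simp add: prob_measures_def)

lemma state_law_measurable: "state_law n \<in> stages n \<rightarrow>\<^sub>M prob_algebra (count_space UNIV)"
proof (cases n)
  case 0
  then show ?thesis
    unfolding state_law_def by (simp add: space_prob_algebra prob_space_return)
next
  case (Suc m)
  have "(\<lambda>\<omega>. next_state G (\<omega> m)) \<in> stages n \<rightarrow>\<^sub>M prob_algebra (count_space UNIV)"
    by (rule measurable_compose[OF measurable_component_singleton[of m "{0..<n}"] next_state_measurable]) (simp add: Suc)
  then show ?thesis by (simp add: state_law_def[abs_def] Suc)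
qed

lemma stage_kernel_eq:
  "stage_kernel G i \<pi>1 \<pi>2 n \<omega> =
     state_law n \<omega> \<bind> (\<lambda>x. (choice1 n \<omega> x \<Otimes>\<^sub>M choice2 n \<omega> x) \<bind> stage_law x)"
  unfolding stage_kernel_def state_law_def stage_law_def case_prod_beta' ..

lemma actions_then_stage_measurable:
  "(\<lambda>\<omega>. (choice1 n \<omega> x \<Otimes>\<^sub>M choice2 n \<omega> x) \<bind> stage_law x) \<in> stages n \<rightarrow>\<^sub>M prob_algebra (stage_space G)"
  by (rule measurable_bind_prob_space[OF measurable_pair_prob[OF choice1_measurable choice2_measurable]
        stage_law_measurable])

lemma stage_kernel_measurable: "stage_kernel G i \<pi>1 \<pi>2 n \<in> stages n \<rightarrow>\<^sub>M prob_algebra (stage_space G)"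
proof -
  have "(\<lambda>\<omega>. state_law n \<omega> \<bind> (\<lambda>x. (choice1 n \<omega> x \<Otimes>\<^sub>M choice2 n \<omega> x) \<bind> stage_law x))
      \<in> stages n \<rightarrow>\<^sub>M prob_algebra (stage_space G)"
  proof (rule measurable_bind_prob_space2[OF state_law_measurable])
    show "(\<lambda>(\<omega>, x). (choice1 n \<omega> x \<Otimes>\<^sub>M choice2 n \<omega> x) \<bind> stage_law x)
        \<in> stages n \<Otimes>\<^sub>M count_space UNIV \<rightarrow>\<^sub>M prob_algebra (stage_space G)"
      unfolding split_beta
      by (rule measurable_compose_countable[where f = "\<lambda>x p. (choice1 n (fst p) x \<Otimes>\<^sub>M choice2 n (fst p) x) \<bind> stage_law x" and g = snd])
         (intro measurable_compose[OF measurable_fst actions_then_stage_measurable] measurable_snd)+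
  qed
  then show ?thesis by (simp add: stage_kernel_eq[abs_def])
qed

lemma nn_integral_stage_kernel:
  assumes \<omega>: "\<omega> \<in> space (stages n)" and F: "F \<in> borel_measurable (stage_space G)"
  shows "(\<integral>\<^sup>+w. F w \<partial>stage_kernel G i \<pi>1 \<pi>2 n \<omega>) =
    (\<integral>\<^sup>+x. \<integral>\<^sup>+a. \<integral>\<^sup>+b. \<integral>\<^sup>+s. F (x, a, b, s) \<partial>law_S' x (a, b) \<partial>choice2 n \<omega> x \<partial>choice1 n \<omega> x \<partial>state_law n \<omega>)"
proof -
  have inner: "(\<integral>\<^sup>+w. F w \<partial>((choice1 n \<omega> x \<Otimes>\<^sub>M choice2 n \<omega> x) \<bind> stage_law x)) =
    (\<integral>\<^sup>+a. \<integral>\<^sup>+b. \<integral>\<^sup>+s. F (x, a, b, s) \<partial>law_S' x (a, b) \<partial>choice2 n \<omega> x \<partial>choice1 n \<omega> x)" for x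
  proof -
    note p1 = choice1_prob[OF \<omega>, of x] and p2 = choice2_prob[OF \<omega>, of x]
    have sets_pair: "sets (choice1 n \<omega> x \<Otimes>\<^sub>M choice2 n \<omega> x) = sets (MA x \<Otimes>\<^sub>M MB x)"
      using p1 p2 by (intro sets_pair_measure_cong) (auto simp: prob_measures_iff)
    interpret C2: prob_space "choice2 n \<omega> x" using p2 by (simp add: prob_measures_iff)
    have stage: "stage_law x \<in> (choice1 n \<omega> x \<Otimes>\<^sub>M choice2 n \<omega> x) \<rightarrow>\<^sub>M subprob_algebra (stage_space G)"
      using measurable_prob_algebraD[OF stage_law_measurable[of x]] measurable_cong_sets[OF sets_pair refl] by blast
    have "(\<integral>\<^sup>+w. F w \<partial>((choice1 n \<omega> x \<Otimes>\<^sub>M choice2 n \<omega> x) \<bind> stage_law x)) =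
      (\<integral>\<^sup>+z. \<integral>\<^sup>+w. F w \<partial>stage_law x z \<partial>(choice1 n \<omega> x \<Otimes>\<^sub>M choice2 n \<omega> x))"
      by (rule nn_integral_bind[OF F stage])
    also have "\<dots> = (\<integral>\<^sup>+a. \<integral>\<^sup>+b. \<integral>\<^sup>+w. F w \<partial>stage_law x (a, b) \<partial>choice2 n \<omega> x \<partial>choice1 n \<omega> x)"
      by (rule C2.nn_integral_fst[symmetric])
         (rule measurable_compose[OF stage nn_integral_measurable_subprob_algebra[OF F]])
    also have "\<dots> = (\<integral>\<^sup>+a. \<integral>\<^sup>+b. \<integral>\<^sup>+s. F (x, a, b, s) \<partial>law_S' x (a, b) \<partial>choice2 n \<omega> x \<partial>choice1 n \<omega> x)"
    proof (intro nn_integral_cong)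
      fix a b assume "a \<in> space (choice1 n \<omega> x)" "b \<in> space (choice2 n \<omega> x)"
      then have z: "(a, b) \<in> K x" using prob_measures_space[OF p1] prob_measures_space[OF p2] by simp
      have "(\<lambda>s. (x, a, b, s)) \<in> law_S' x (a, b) \<rightarrow>\<^sub>M stage_space G"
        using measurable_compose[OF measurable_Pair1'[of "(a, b)" "MA x \<Otimes>\<^sub>M MB x" Mtime] stage_insert_measurable[of x]] z
        by (simp add: space_MK measurable_cong_sets[OF sets_restrict_space_cong[OF sets_interval_measure] refl])
      then show "(\<integral>\<^sup>+w. F w \<partial>stage_law x (a, b)) = (\<integral>\<^sup>+s. F (x, a, b, s) \<partial>law_S' x (a, b))"
        using F by (simp add: stage_law_def nn_integral_distr)
    qed
    finally show ?thesis .
  qed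
  have "sets (state_law n \<omega>) = sets (count_space UNIV)"
    using measurable_space[OF state_law_measurable \<omega>] by (simp add: space_prob_algebra)
  then have "(\<lambda>x. (choice1 n \<omega> x \<Otimes>\<^sub>M choice2 n \<omega> x) \<bind> stage_law x) \<in> state_law n \<omega> \<rightarrow>\<^sub>M subprob_algebra (stage_space G)"
    using measurable_space[OF measurable_prob_algebraD[OF actions_then_stage_measurable] \<omega>]
    by (simp add: measurable_cong_sets[of "state_law n \<omega>" "count_space UNIV"])
  from nn_integral_bind[OF F this] show ?thesis
    unfolding stage_kernel_eq inner .
qed

sublocale IT: Ionescu_Tulcea "stage_kernel G i \<pi>1 \<pi>2" "\<lambda>_. stage_space G"
proof (rule Ionescu_Tulcea.intro)
  show "stage_kernel G i \<pi>1 \<pi>2 n \<in> stages n \<rightarrow>\<^sub>M subprob_algebra (stage_space G)" for n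
    by (rule measurable_prob_algebraD[OF stage_kernel_measurable])
  show "prob_space (stage_kernel G i \<pi>1 \<pi>2 n \<omega>)" if "\<omega> \<in> space (stages n)" for n \<omega>
    using measurable_space[OF stage_kernel_measurable that] by (simp add: space_prob_algebra)
qed

abbreviation "law \<equiv> process_law G i \<pi>1 \<pi>2"
abbreviation "law_upto n \<equiv> IT.C 0 n (\<lambda>_. undefined)"

lemma space_law: "space law = space (PiM UNIV (\<lambda>_. stage_space G))"
  and sets_law: "sets law = sets (PiM UNIV (\<lambda>_. stage_space G))"
  by (simp_all add: process_law_def)

lemma undefined_in_stages_0: "(\<lambda>_. undefined) \<in> space (stages 0)"
  by (simp add: space_PiM)

lemma sets_law_upto: "sets (law_upto n) = sets (stages n)" and space_law_upto: "space (law_upto n) = space (stages n)"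
  using IT.sets_C[OF undefined_in_stages_0, of n] IT.space_C[OF undefined_in_stages_0, of n] by simp_all

text \<open>
  Functions of the first \<open>n\<close> stages may be integrated against the finite-dimensional law
  \<open>law_upto n\<close>, which is built stage by stage. The dependence on the first \<open>n\<close> stages is expressed by
  invariance under restriction, which lets one and the same function be used on infinite paths.
\<close>

lemma nn_integral_law_upto:
  assumes F: "F \<in> borel_measurable (stages n)" and dep: "\<And>\<omega>. F (restrict \<omega> {0..<n}) = F \<omega>"
  shows "(\<integral>\<^sup>+\<omega>. F \<omega> \<partial>law) = (\<integral>\<^sup>+\<omega>. F \<omega> \<partial>law_upto n)"
proof -
  have restr: "(\<lambda>\<omega>. restrict \<omega> {0..<n}) \<in> law \<rightarrow>\<^sub>M stages n"
    using measurable_restrict_subset[of "{0..<n}" UNIV "\<lambda>_. stage_space G"] by (simp add: measurable_cong_sets[OF sets_law refl])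
  have up_to: "IT.up_to {0..<n} \<le> n" by (simp add: IT.up_to_iff_Ico)
  have "IT.CI {0..<n} = law_upto n"
  proof (rule measure_eqI)
    show sets_eq: "sets (IT.CI {0..<n}) = sets (law_upto n)"
      by (simp add: IT.PF.sets_P sets_law_upto)
    fix X assume "X \<in> sets (IT.CI {0..<n})"
    then have X: "X \<in> sets (stages n)" by (simp add: sets_eq sets_law_upto)
    have "IT.PF.emb {0..<n} {0..<n} X = X" using sets.sets_into_space[OF X] by (intro prod_emb_id) (simp add: space_PiM)
    then show "emeasure (IT.CI {0..<n}) X = emeasure (law_upto n) X"
      using IT.emeasure_CI[OF order_refl X] by simp
  qed
  then have "distr law (stages n) (\<lambda>\<omega>. restrict \<omega> {0..<n}) = law_upto n"
    unfolding process_law_def using IT.distr_lim[of "{0..<n}"] by simp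
  then have "(\<integral>\<^sup>+\<omega>. F \<omega> \<partial>law_upto n) = (\<integral>\<^sup>+\<omega>. F (restrict \<omega> {0..<n}) \<partial>law)"
    using nn_integral_distr[OF restr, of F] F by (simp add: measurable_cong_sets[OF sets_law_upto refl])
  then show ?thesis by (simp add: dep)
qed

lemma nn_integral_law_upto_0: "F \<in> borel_measurable (stages 0) \<Longrightarrow> (\<integral>\<^sup>+\<omega>. F \<omega> \<partial>law_upto 0) = F (\<lambda>_. undefined)"
  using undefined_in_stages_0 by (simp add: nn_integral_return)

lemma nn_integral_law_upto_Suc:
  assumes F: "F \<in> borel_measurable (stages (Suc n))"
  shows "(\<integral>\<^sup>+\<omega>. F \<omega> \<partial>law_upto (Suc n)) =
    (\<integral>\<^sup>+\<omega>. \<integral>\<^sup>+w. F (fun_upd \<omega> n w) \<partial>stage_kernel G i \<pi>1 \<pi>2 n \<omega> \<partial>law_upto n)"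
proof -
  have "IT.eP n \<in> law_upto n \<rightarrow>\<^sub>M subprob_algebra (stages (Suc n))"
    using IT.measurable_eP[of n] by (simp add: measurable_cong_sets[OF sets_law_upto refl])
  from nn_integral_bind[OF F this]
  have "(\<integral>\<^sup>+\<omega>. F \<omega> \<partial>law_upto (Suc n)) = (\<integral>\<^sup>+\<omega>. \<integral>\<^sup>+\<omega>'. F \<omega>' \<partial>IT.eP n \<omega> \<partial>law_upto n)" by simp
  also have "\<dots> = (\<integral>\<^sup>+\<omega>. \<integral>\<^sup>+w. F (fun_upd \<omega> n w) \<partial>stage_kernel G i \<pi>1 \<pi>2 n \<omega> \<partial>law_upto n)"
    by (intro nn_integral_cong IT.nn_integral_eP F) (simp add: space_law_upto)
  finally show ?thesis .
qed

end

section \<open>One-step payoffs and the multiplicative potential\<close>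

definition stage_time :: "'s \<times> 'a \<times> 'b \<times> real \<Rightarrow> real" where
  "stage_time w = snd (snd (snd w))"

definition stage_actions :: "'s \<times> 'a \<times> 'b \<times> real \<Rightarrow> 'a \<times> 'b" where
  "stage_actions w = (fst (snd w), fst (snd (snd w)))"

lemma jump_time_eq: "jump_time \<omega> n = (\<Sum>k<n. stage_time (\<omega> k))"
  by (simp add: jump_time_def stage_time_def split_beta)

context regular_game
begin

text \<open>
  The rate is controlled only on \<open>[0, sbar]\<close>. Cutting the sojourn time at \<open>sbar\<close> changes the cost on a
  null set only and makes it bounded and measurable on the whole stage space.
\<close>

definition trunc_cost :: "'s \<times> 'a \<times> 'b \<times> real \<Rightarrow> real" where
  "trunc_cost w = stage_cost G w (min (stage_time w) sbar)"

text \<open>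
  Conditional expectation of \<open>exp (\<theta> h)\<close> at the next state, given the present state and actions.
\<close>

definition next_value :: "('s \<Rightarrow> real) \<Rightarrow> 's \<Rightarrow> 'a \<times> 'b \<Rightarrow> real" where
  "next_value h x z = (\<Sum>j\<in>UNIV. exp (\<theta> * h j) * transition G x j (fst z) (snd z))"

definition payoff :: "real \<Rightarrow> ('s \<Rightarrow> real) \<Rightarrow> 's \<Rightarrow> 'a \<times> 'b \<Rightarrow> real" where
  "payoff g h x z = exp (\<theta> * cost G x (fst z) (snd z)) * gain g x z * next_value h x z"

lemma bracket_eq: "bracket G sbar \<theta> g h x \<psi> \<phi> = (LINT a|\<psi>. LINT b|\<phi>. payoff g h x (a, b))"
  by (simp add: bracket_def payoff_def gain_def next_value_def)

lemma stage_cost_eq: "stage_cost G w r = cost G (fst w) (fst (snd w)) (fst (snd (snd w))) + run (fst w) (stage_actions w) r"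
  by (simp add: stage_cost_def stage_actions_def split_beta)

lemma in_stage_space: "w \<in> space (stage_space G) \<longleftrightarrow> stage_actions w \<in> K (fst w) \<and> 0 < stage_time w"
  by (cases w) (simp add: space_stage stage_actions_def stage_time_def)

lemma next_value_continuous: "continuous_on (K x) (next_value h x)"
  unfolding next_value_def by (intro continuous_intros transition_continuous)

lemma next_value_bounds:
  assumes z: "z \<in> K x"
  shows "Min (range (\<lambda>j. exp (\<theta> * h j))) \<le> next_value h x z" and "next_value h x z \<le> Max (range (\<lambda>j. exp (\<theta> * h j)))"
proof -
  let ?p = "\<lambda>j. transition G x j (fst z) (snd z)"
  let ?m = "Min (range (\<lambda>j. exp (\<theta> * h j)))" and ?M = "Max (range (\<lambda>j. exp (\<theta> * h j)))"
  have "(\<Sum>j\<in>UNIV. ?m * ?p j) \<le> next_value h x z" "next_value h x z \<le> (\<Sum>j\<in>UNIV. ?M * ?p j)"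
    unfolding next_value_def
    by (intro sum_mono mult_right_mono transition_nonneg[OF z] Min_le Max_ge finite_imageI finite rangeI)+
  then show "?m \<le> next_value h x z" "next_value h x z \<le> ?M"
    by (simp_all only: sum_distrib_left[symmetric] transition_sum[OF z] mult_1_right)
qed

lemma Min_exp_pos: "0 < Min (range (\<lambda>j :: 's. exp (\<theta> * h j)))"
  by simp

lemma next_value_pos: "z \<in> K x \<Longrightarrow> 0 < next_value h x z"
  using next_value_bounds(1)[of z x h] Min_exp_pos[of h] by linarith

lemma payoff_continuous: "continuous_on (K x) (payoff g h x)"
  unfolding payoff_def by (intro continuous_intros cost_continuous gain_continuous next_value_continuous)

lemma payoff_pos: "z \<in> K x \<Longrightarrow> 0 < payoff g h x z"
  unfolding payoff_def by (intro mult_pos_pos exp_gt_zero gain_pos next_value_pos)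

text \<open>
  Integrated form of the comparison of gains.
\<close>

lemma bracket_contraction:
  assumes "g < g'"
  obtains q where "0 < q" "q < 1"
    "\<And>x \<psi> \<phi>. \<psi> \<in> prob_measures (adm1 G x) \<Longrightarrow> \<phi> \<in> prob_measures (adm2 G x) \<Longrightarrow>
       bracket G sbar \<theta> g' h x \<psi> \<phi> \<le> q * bracket G sbar \<theta> g h x \<psi> \<phi>"
proof -
  obtain q where q: "0 < q" "q < 1" "\<And>x z. z \<in> K x \<Longrightarrow> gain g' x z \<le> q * gain g x z"
    using gain_contraction[OF assms] by blast
  have "bracket G sbar \<theta> g' h x \<psi> \<phi> \<le> q * bracket G sbar \<theta> g h x \<psi> \<phi>"
    if "\<psi> \<in> prob_measures (adm1 G x)" "\<phi> \<in> prob_measures (adm2 G x)" for x \<psi> \<phi>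
  proof -
    have "payoff g' h x z \<le> q * payoff g h x z" if z: "z \<in> K x" for z
    proof -
      have "exp (\<theta> * cost G x (fst z) (snd z)) * gain g' x z * next_value h x z
          \<le> exp (\<theta> * cost G x (fst z) (snd z)) * (q * gain g x z) * next_value h x z"
        using next_value_pos[OF z, of h] q(3)[OF z] by (intro mult_right_mono mult_left_mono) auto
      then show ?thesis by (simp add: payoff_def algebra_simps)
    qed
    then have "bracket G sbar \<theta> g' h x \<psi> \<phi> \<le> (LINT a|\<psi>. LINT b|\<phi>. q * payoff g h x (a, b))"
      unfolding bracket_eq
      by (intro mixed_mono[OF compact_adm1 compact_adm2 payoff_continuous _ that] continuous_intros payoff_continuous)
    then show ?thesis by (simp add: bracket_eq)
  qed
  then show ?thesis using that q(1,2) by blast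
qed

lemma stage_cost_bounded:
  obtains C where "\<And>w r. stage_actions w \<in> K (fst w) \<Longrightarrow> 0 \<le> r \<Longrightarrow> r \<le> sbar \<Longrightarrow> \<bar>stage_cost G w r\<bar> \<le> C"
proof -
  let ?f = "\<lambda>x p. cost G x (fst (fst p)) (snd (fst p)) + run x (fst p) (snd p)"
  have "\<exists>B. \<forall>p\<in>K x \<times> {0..sbar}. \<bar>?f x p\<bar> \<le> B" for x
  proof -
    have "continuous_on (K x \<times> {0..sbar}) (?f x)"
      using run_continuous[of x] unfolding split_beta
      by (intro continuous_on_add continuous_on_compose2[OF cost_continuous] continuous_intros) auto
    from compact_imp_bounded[OF compact_continuous_image[OF this compact_Times[OF compact_K compact_Icc]]]
    show ?thesis unfolding bounded_iff by simp
  qed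
  then have "\<exists>B. \<forall>x. \<forall>p\<in>K x \<times> {0..sbar}. \<bar>?f x p\<bar> \<le> B x" by (rule choice[OF allI])
  then obtain B where B: "\<And>x p. p \<in> K x \<times> {0..sbar} \<Longrightarrow> \<bar>?f x p\<bar> \<le> B x" by blast
  let ?C = "Max (range (\<lambda>x. \<bar>B x\<bar>))"
  have le: "\<bar>B x\<bar> \<le> ?C" for x by simp
  show ?thesis
  proof
    show "\<bar>stage_cost G w r\<bar> \<le> ?C" if "stage_actions w \<in> K (fst w)" "0 \<le> r" "r \<le> sbar" for w r
    proof -
      have "\<bar>?f (fst w) (stage_actions w, r)\<bar> \<le> B (fst w)" using that by (intro B) simp
      then show ?thesis using le[of "fst w"] by (simp add: stage_cost_eq stage_actions_def)
    qed
  qed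
qed

lemma stage_time_measurable: "stage_time \<in> borel_measurable (stage_space G)"
  unfolding stage_time_def[abs_def] stage_space_def by (rule measurable_restrict_space1) measurable

lemma trunc_cost_measurable: "trunc_cost \<in> borel_measurable (stage_space G)"
proof (rule stage_measurable)
  fix x
  have run: "(\<lambda>(z, s). run x z s) \<in> borel_measurable (restrict_space borel (K x) \<Otimes>\<^sub>M restrict_space borel {0..sbar})"
    by (rule continuous_on_prod_measurable[OF run_continuous])
  have clip: "(\<lambda>p. (fst p, min (snd p) sbar)) \<in>
      (MA x \<Otimes>\<^sub>M MB x) \<Otimes>\<^sub>M Mtime \<rightarrow>\<^sub>M restrict_space borel (K x) \<Otimes>\<^sub>M restrict_space borel {0..sbar}"
  proof (rule measurable_Pair)
    show "fst \<in> (MA x \<Otimes>\<^sub>M MB x) \<Otimes>\<^sub>M Mtime \<rightarrow>\<^sub>M restrict_space borel (K x)"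
      by (rule measurable_compose[OF measurable_fst identity_to_restrict_prod])
    show "(\<lambda>p. min (snd p) sbar) \<in> (MA x \<Otimes>\<^sub>M MB x) \<Otimes>\<^sub>M Mtime \<rightarrow>\<^sub>M restrict_space borel {0..sbar}"
    proof (rule measurable_restrict_space2)
      have "(\<lambda>s. min s sbar) \<in> borel_measurable Mtime"
        by (rule measurable_restrict_space1) measurable
      then show "(\<lambda>p. min (snd p) sbar) \<in> borel_measurable ((MA x \<Otimes>\<^sub>M MB x) \<Otimes>\<^sub>M Mtime)"
        by (rule measurable_compose[OF measurable_snd])
    qed (use sbar_pos in \<open>auto simp: space_pair_measure space_restrict_space\<close>)
  qed
  have "(\<lambda>p. run x (fst p) (min (snd p) sbar)) \<in> borel_measurable ((MA x \<Otimes>\<^sub>M MB x) \<Otimes>\<^sub>M Mtime)"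
    using measurable_compose[OF clip run] by simp
  moreover have "(\<lambda>p. cost G x (fst (fst p)) (snd (fst p))) \<in> borel_measurable ((MA x \<Otimes>\<^sub>M MB x) \<Otimes>\<^sub>M Mtime)"
    by (rule measurable_compose[OF measurable_fst continuous_on_prod_measurable[OF cost_continuous]])
  ultimately show "(\<lambda>(z, s). trunc_cost (x, fst z, snd z, s)) \<in> borel_measurable ((MA x \<Otimes>\<^sub>M MB x) \<Otimes>\<^sub>M Mtime)"
    by (simp add: trunc_cost_def stage_cost_eq stage_actions_def stage_time_def split_beta)
qed

lemma next_value_measurable: "(\<lambda>w. next_value h (fst w) (stage_actions w)) \<in> borel_measurable (stage_space G)"
proof (rule stage_measurable)
  show "(\<lambda>(z, s). next_value h (fst (x, fst z, snd z, s)) (stage_actions (x, fst z, snd z, s)))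
      \<in> borel_measurable ((MA x \<Otimes>\<^sub>M MB x) \<Otimes>\<^sub>M Mtime)" for x
    using measurable_compose[OF measurable_fst continuous_on_prod_measurable[OF next_value_continuous]]
    by (simp add: stage_actions_def split_beta')
qed

text \<open>
  Averaging over the sojourn time turns cost and discount of one stage into the payoff function of the
  optimality equation.
\<close>

lemma nn_integral_stage_payoff:
  assumes z: "(a, b) \<in> K x"
  shows "(\<integral>\<^sup>+s. ennreal (exp (\<theta> * (trunc_cost (x, a, b, s) - g * s)) * next_value h x (a, b)) \<partial>law_S' x (a, b))
    = ennreal (payoff g h x (a, b))"
proof -
  let ?c = "exp (\<theta> * cost G x a b) * next_value h x (a, b)"
  let ?u = "\<lambda>s. exp (\<theta> * (run x (a, b) s - g * s)) * ?c"
  have "(\<integral>\<^sup>+s. ennreal (exp (\<theta> * (trunc_cost (x, a, b, s) - g * s)) * next_value h x (a, b)) \<partial>law_S' x (a, b))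
    = ennreal (LINT s:{0..sbar}|law_S x (a, b). ?u s)"
  proof (rule nn_integral_law_S'[OF z])
    show "continuous_on {0..sbar} ?u"
      by (intro continuous_on_mult continuous_on_const gain_integrand_continuous z)
    show "0 \<le> ?u s" for s using next_value_pos[OF z, of h] by simp
    show "ennreal (exp (\<theta> * (trunc_cost (x, a, b, s) - g * s)) * next_value h x (a, b)) = ennreal (?u s)"
      if "s \<le> sbar" for s
    proof -
      have "\<theta> * (trunc_cost (x, a, b, s) - g * s) = \<theta> * (run x (a, b) s - g * s) + \<theta> * cost G x a b"
        using that by (simp add: trunc_cost_def stage_cost_eq stage_actions_def stage_time_def algebra_simps)
      then show ?thesis by (simp add: exp_add mult.assoc)
    qed
  qed
  also have "(LINT s:{0..sbar}|law_S x (a, b). ?u s) = payoff g h x (a, b)"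
    by (simp add: payoff_def gain_def)
  finally show ?thesis .
qed

end

context controlled_game
begin

definition discounted_cost :: "real \<Rightarrow> nat \<Rightarrow> (nat \<Rightarrow> 's \<times> 'a \<times> 'b \<times> real) \<Rightarrow> real" where
  "discounted_cost g n \<omega> = (\<Sum>k<n. trunc_cost (\<omega> k) - g * stage_time (\<omega> k))"

text \<open>
  Conditional expectation of \<open>exp (\<theta> h(X\<^sub>n))\<close> given the stages before \<open>n\<close>. Stage \<open>n\<close> records the
  state \<open>X\<^sub>n\<close> itself, so this form keeps the potential a function of the first \<open>n\<close> stages.
\<close>

definition current_value :: "('s \<Rightarrow> real) \<Rightarrow> nat \<Rightarrow> (nat \<Rightarrow> 's \<times> 'a \<times> 'b \<times> real) \<Rightarrow> real" where
  "current_value h n \<omega> = (if n = 0 then exp (\<theta> * h i) else next_value h (fst (\<omega> (n - 1))) (stage_actions (\<omega> (n - 1))))"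

definition potential :: "real \<Rightarrow> ('s \<Rightarrow> real) \<Rightarrow> nat \<Rightarrow> (nat \<Rightarrow> 's \<times> 'a \<times> 'b \<times> real) \<Rightarrow> real" where
  "potential g h n \<omega> = exp (\<theta> * discounted_cost g n \<omega>) * current_value h n \<omega>"

lemma coordinate_measurable:
  "f \<in> stage_space G \<rightarrow>\<^sub>M N \<Longrightarrow> k < n \<Longrightarrow> (\<lambda>\<omega>. f (\<omega> k)) \<in> stages n \<rightarrow>\<^sub>M N"
  by (rule measurable_compose[OF measurable_component_singleton[of k "{0..<n}"]]) simp_all

lemma discounted_cost_measurable: "discounted_cost g n \<in> borel_measurable (stages n)"
  unfolding discounted_cost_def[abs_def]
  by (intro borel_measurable_sum borel_measurable_diff borel_measurable_times borel_measurable_const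
      coordinate_measurable trunc_cost_measurable stage_time_measurable) simp_all

lemma jump_time_measurable: "m \<le> n \<Longrightarrow> (\<lambda>\<omega>. jump_time \<omega> m) \<in> borel_measurable (stages n)"
  unfolding jump_time_eq
  by (intro borel_measurable_sum coordinate_measurable stage_time_measurable) simp

lemma potential_measurable: "potential g h n \<in> borel_measurable (stages n)"
proof -
  have "current_value h n \<in> borel_measurable (stages n)"
    by (cases n) (simp_all add: current_value_def[abs_def] coordinate_measurable[OF next_value_measurable])
  then show ?thesis
    unfolding potential_def[abs_def] using discounted_cost_measurable[of g n] by measurable
qed

lemma potential_restrict: "potential g h n (restrict \<omega> {0..<n}) = potential g h n \<omega>"
  by (simp add: potential_def discounted_cost_def current_value_def)

lemma jump_time_restrict: "m \<le> n \<Longrightarrow> jump_time (restrict \<omega> {0..<n}) m = jump_time \<omega> m"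
  unfolding jump_time_eq by (intro sum.cong) auto

lemma current_value_bounds:
  assumes "\<And>k. k < n \<Longrightarrow> \<omega> k \<in> space (stage_space G)"
  shows "Min (range (\<lambda>j. exp (\<theta> * h j))) \<le> current_value h n \<omega>"
    and "current_value h n \<omega> \<le> Max (range (\<lambda>j. exp (\<theta> * h j)))"
proof -
  have "Min (range (\<lambda>j. exp (\<theta> * h j))) \<le> current_value h n \<omega> \<and>
    current_value h n \<omega> \<le> Max (range (\<lambda>j. exp (\<theta> * h j)))"
  proof (cases n)
    case (Suc m)
    have "stage_actions (\<omega> m) \<in> K (fst (\<omega> m))"
      using assms[of m] by (simp add: Suc in_stage_space)
    from next_value_bounds[OF this, of h] show ?thesis unfolding current_value_def Suc by simp
  next
    case 0
    have "Min (range (\<lambda>j. exp (\<theta> * h j))) \<le> exp (\<theta> * h i)" by (rule Min_le[OF _ rangeI]) simp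
    moreover have "exp (\<theta> * h i) \<le> Max (range (\<lambda>j. exp (\<theta> * h j)))" by (rule Max_ge[OF _ rangeI]) simp
    ultimately show ?thesis unfolding current_value_def 0 by simp
  qed
  then show "Min (range (\<lambda>j. exp (\<theta> * h j))) \<le> current_value h n \<omega>"
    and "current_value h n \<omega> \<le> Max (range (\<lambda>j. exp (\<theta> * h j)))" by blast+
qed

lemma stages_coordinate: "\<omega> \<in> space (stages n) \<Longrightarrow> k < n \<Longrightarrow> \<omega> k \<in> space (stage_space G)"
  unfolding space_PiM PiE_iff by simp

lemma current_value_pos: "\<omega> \<in> space (stages n) \<Longrightarrow> 0 < current_value h n \<omega>"
proof -
  assume \<omega>: "\<omega> \<in> space (stages n)"
  have "Min (range (\<lambda>j. exp (\<theta> * h j))) \<le> current_value h n \<omega>"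
    by (rule current_value_bounds(1)) (rule stages_coordinate[OF \<omega>])
  then show "0 < current_value h n \<omega>" using Min_exp_pos[of h] by linarith
qed

lemma nn_integral_state_law_value:
  assumes \<omega>: "\<omega> \<in> space (stages n)"
  shows "(\<integral>\<^sup>+x. ennreal (exp (\<theta> * h x)) \<partial>state_law n \<omega>) = ennreal (current_value h n \<omega>)"
proof (cases n)
  case 0
  then show ?thesis by (simp add: state_law_def current_value_def nn_integral_return)
next
  case (Suc m)
  obtain x a b s where w: "\<omega> m = (x, a, b, s)" by (cases "\<omega> m")
  have z: "(a, b) \<in> K x" using stages_coordinate[OF \<omega>, of m] by (simp add: Suc w space_stage)
  have "(\<integral>\<^sup>+x. ennreal (exp (\<theta> * h x)) \<partial>state_law n \<omega>)
      = (\<Sum>j\<in>UNIV. ennreal (transition G x j a b) * ennreal (exp (\<theta> * h j)))"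
    by (simp add: state_law_def Suc w next_state_def nn_integral_point_measure_finite)
  also have "\<dots> = (\<Sum>j\<in>UNIV. ennreal (exp (\<theta> * h j) * transition G x j a b))"
    using transition_nonneg[OF z] by (simp add: ennreal_mult mult.commute)
  also have "\<dots> = ennreal (current_value h n \<omega>)"
    using transition_nonneg[OF z] by (simp add: current_value_def Suc w next_value_def stage_actions_def sum_ennreal)
  finally show ?thesis .
qed

text \<open>
  The step of the martingale argument: compared with the potential at \<open>n\<close>, the bracket at the
  current mixed actions has replaced \<open>exp (\<theta> h)\<close> under the law of the current state.
\<close>

lemma nn_integral_potential_Suc:
  assumes \<omega>: "\<omega> \<in> space (stages n)"
  shows "(\<integral>\<^sup>+w. ennreal (potential g h (Suc n) (fun_upd \<omega> n w)) \<partial>stage_kernel G i \<pi>1 \<pi>2 n \<omega>)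
    = ennreal (exp (\<theta> * discounted_cost g n \<omega>)) *
      (\<integral>\<^sup>+x. ennreal (bracket G sbar \<theta> g h x (choice1 n \<omega> x) (choice2 n \<omega> x)) \<partial>state_law n \<omega>)"
proof -
  let ?F = "\<lambda>w. ennreal (exp (\<theta> * (trunc_cost w - g * stage_time w)) * next_value h (fst w) (stage_actions w))"
  have F: "?F \<in> borel_measurable (stage_space G)"
    using trunc_cost_measurable stage_time_measurable next_value_measurable by measurable
  have sp: "space (stage_kernel G i \<pi>1 \<pi>2 n \<omega>) = space (stage_space G)" by (rule IT.space_P[OF \<omega>])
  have sets: "sets (stage_kernel G i \<pi>1 \<pi>2 n \<omega>) = sets (stage_space G)" by (rule IT.sets_P[OF \<omega>])
  have "(\<integral>\<^sup>+w. ennreal (potential g h (Suc n) (fun_upd \<omega> n w)) \<partial>stage_kernel G i \<pi>1 \<pi>2 n \<omega>)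
    = (\<integral>\<^sup>+w. ennreal (exp (\<theta> * discounted_cost g n \<omega>)) * ?F w \<partial>stage_kernel G i \<pi>1 \<pi>2 n \<omega>)"
  proof (rule nn_integral_cong)
    fix w assume "w \<in> space (stage_kernel G i \<pi>1 \<pi>2 n \<omega>)"
    have "discounted_cost g (Suc n) (fun_upd \<omega> n w) = discounted_cost g n \<omega> + (trunc_cost w - g * stage_time w)"
      by (simp add: discounted_cost_def)
    then show "ennreal (potential g h (Suc n) (fun_upd \<omega> n w)) = ennreal (exp (\<theta> * discounted_cost g n \<omega>)) * ?F w"
      by (simp add: potential_def current_value_def ennreal_mult'[symmetric] exp_add distrib_left mult.assoc)
  qed
  also have "\<dots> = ennreal (exp (\<theta> * discounted_cost g n \<omega>)) * (\<integral>\<^sup>+w. ?F w \<partial>stage_kernel G i \<pi>1 \<pi>2 n \<omega>)"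
    using F by (intro nn_integral_cmult) (simp add: measurable_cong_sets[OF sets refl])
  also have "(\<integral>\<^sup>+w. ?F w \<partial>stage_kernel G i \<pi>1 \<pi>2 n \<omega>) =
    (\<integral>\<^sup>+x. ennreal (bracket G sbar \<theta> g h x (choice1 n \<omega> x) (choice2 n \<omega> x)) \<partial>state_law n \<omega>)"
    unfolding nn_integral_stage_kernel[OF \<omega> F]
  proof (rule nn_integral_cong)
    fix x
    note p1 = choice1_prob[OF \<omega>, of x] and p2 = choice2_prob[OF \<omega>, of x]
    have "(\<integral>\<^sup>+a. \<integral>\<^sup>+b. \<integral>\<^sup>+s. ?F (x, a, b, s) \<partial>law_S' x (a, b) \<partial>choice2 n \<omega> x \<partial>choice1 n \<omega> x) =
      (\<integral>\<^sup>+a. \<integral>\<^sup>+b. ennreal (payoff g h x (a, b)) \<partial>choice2 n \<omega> x \<partial>choice1 n \<omega> x)"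
      using prob_measures_space[OF p1] prob_measures_space[OF p2]
      by (intro nn_integral_cong) (simp add: nn_integral_stage_payoff[symmetric] stage_actions_def stage_time_def)
    also have "\<dots> = ennreal (bracket G sbar \<theta> g h x (choice1 n \<omega> x) (choice2 n \<omega> x))"
      unfolding bracket_eq using less_imp_le[OF payoff_pos]
      by (intro nn_mixed[OF compact_adm1 compact_adm2 payoff_continuous p1 p2])
    finally show "(\<integral>\<^sup>+a. \<integral>\<^sup>+b. \<integral>\<^sup>+s. ?F (x, a, b, s) \<partial>law_S' x (a, b) \<partial>choice2 n \<omega> x \<partial>choice1 n \<omega> x) =
      ennreal (bracket G sbar \<theta> g h x (choice1 n \<omega> x) (choice2 n \<omega> x))" .
  qed
  finally show ?thesis .
qed

lemma nn_integral_stage_kernel_le: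
  assumes \<omega>: "\<omega> \<in> space (stages n)" and F: "F \<in> borel_measurable (stage_space G)"
    and le: "\<And>x a b. (a, b) \<in> K x \<Longrightarrow> (\<integral>\<^sup>+s. F (x, a, b, s) \<partial>law_S' x (a, b)) \<le> c"
  shows "(\<integral>\<^sup>+w. F w \<partial>stage_kernel G i \<pi>1 \<pi>2 n \<omega>) \<le> c"
proof -
  have avg: "(\<integral>\<^sup>+y. f y \<partial>M) \<le> c" if "prob_space M" "\<And>y. y \<in> space M \<Longrightarrow> f y \<le> c" for f :: "'c \<Rightarrow> ennreal" and M
  proof -
    interpret prob_space M by fact
    have "(\<integral>\<^sup>+y. f y \<partial>M) \<le> (\<integral>\<^sup>+y. c \<partial>M)" by (intro nn_integral_mono that(2))
    then show ?thesis by (simp add: emeasure_space_1)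
  qed
  have "prob_space (state_law n \<omega>)"
    using measurable_space[OF state_law_measurable \<omega>] by (simp add: space_prob_algebra)
  then show ?thesis
    unfolding nn_integral_stage_kernel[OF \<omega> F]
  proof (rule avg)
    fix x
    note p1 = choice1_prob[OF \<omega>, of x] and p2 = choice2_prob[OF \<omega>, of x]
    show "(\<integral>\<^sup>+a. \<integral>\<^sup>+b. \<integral>\<^sup>+s. F (x, a, b, s) \<partial>law_S' x (a, b) \<partial>choice2 n \<omega> x \<partial>choice1 n \<omega> x) \<le> c"
      using p1 p2 prob_measures_space[OF p1] prob_measures_space[OF p2]
      by (intro avg le) (simp_all add: prob_measures_iff)
  qed
qed

text \<open>
  Used with exponential functions of the sojourn times, to bound Laplace transforms of jump times.
\<close>

lemma nn_integral_prod_le: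
  assumes f: "f \<in> borel_measurable (stage_space G)"
    and le: "\<And>x a b. (a, b) \<in> K x \<Longrightarrow> (\<integral>\<^sup>+s. f (x, a, b, s) \<partial>law_S' x (a, b)) \<le> c"
  shows "(\<integral>\<^sup>+\<omega>. (\<Prod>k<n. f (\<omega> k)) \<partial>law_upto n) \<le> (c :: ennreal) ^ n"
proof (induction n)
  case 0
  show ?case by (subst nn_integral_law_upto_0) simp_all
next
  case (Suc n)
  have meas: "(\<lambda>\<omega>. \<Prod>k<m. f (\<omega> k)) \<in> borel_measurable (stages m)" for m
    by (intro borel_measurable_prod_ennreal coordinate_measurable f) simp
  have "(\<integral>\<^sup>+\<omega>. (\<Prod>k<Suc n. f (\<omega> k)) \<partial>law_upto (Suc n)) =
      (\<integral>\<^sup>+\<omega>. \<integral>\<^sup>+w. (\<Prod>k<Suc n. f (fun_upd \<omega> n w k)) \<partial>stage_kernel G i \<pi>1 \<pi>2 n \<omega> \<partial>law_upto n)"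
    by (rule nn_integral_law_upto_Suc[OF meas])
  also have "\<dots> \<le> (\<integral>\<^sup>+\<omega>. (\<Prod>k<n. f (\<omega> k)) * c \<partial>law_upto n)"
  proof (rule nn_integral_mono)
    fix \<omega> assume "\<omega> \<in> space (law_upto n)"
    then have \<omega>: "\<omega> \<in> space (stages n)" by (simp add: space_law_upto)
    have "(\<integral>\<^sup>+w. (\<Prod>k<Suc n. f (fun_upd \<omega> n w k)) \<partial>stage_kernel G i \<pi>1 \<pi>2 n \<omega>) =
        (\<integral>\<^sup>+w. (\<Prod>k<n. f (\<omega> k)) * f w \<partial>stage_kernel G i \<pi>1 \<pi>2 n \<omega>)"
      by (simp add: mult.commute)
    also have "\<dots> = (\<Prod>k<n. f (\<omega> k)) * (\<integral>\<^sup>+w. f w \<partial>stage_kernel G i \<pi>1 \<pi>2 n \<omega>)"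
      using f by (intro nn_integral_cmult) (simp add: measurable_cong_sets[OF IT.sets_P[OF \<omega>] refl])
    also have "\<dots> \<le> (\<Prod>k<n. f (\<omega> k)) * c"
      by (intro mult_left_mono nn_integral_stage_kernel_le[OF \<omega> f le]) simp_all
    finally show "(\<integral>\<^sup>+w. (\<Prod>k<Suc n. f (fun_upd \<omega> n w k)) \<partial>stage_kernel G i \<pi>1 \<pi>2 n \<omega>) \<le> (\<Prod>k<n. f (\<omega> k)) * c" .
  qed
  also have "\<dots> = (\<integral>\<^sup>+\<omega>. (\<Prod>k<n. f (\<omega> k)) \<partial>law_upto n) * c"
    using meas[of n] by (intro nn_integral_multc) (simp add: measurable_cong_sets[OF sets_law_upto refl])
  also have "\<dots> \<le> c ^ n * c" by (intro mult_right_mono Suc) simp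
  finally show ?case by (simp add: mult.commute)
qed

lemma law_measurable:
  assumes F: "F \<in> stages n \<rightarrow>\<^sub>M N" and dep: "\<And>\<omega>. F (restrict \<omega> {0..<n}) = F \<omega>"
  shows "F \<in> law \<rightarrow>\<^sub>M N"
proof -
  have "(\<lambda>\<omega>. restrict \<omega> {0..<n}) \<in> law \<rightarrow>\<^sub>M stages n"
    using measurable_restrict_subset[of "{0..<n}" UNIV "\<lambda>_. stage_space G"]
    by (simp add: measurable_cong_sets[OF sets_law refl])
  from measurable_compose[OF this F] show ?thesis by (simp add: dep)
qed

end

section \<open>Paths up to a fixed time\<close>

context controlled_game
begin

text \<open>
  Geometric decay of the supermartingale under a strict supersolution.
\<close>

lemma nn_integral_potential_le:
  assumes q: "q \<ge> 0" and contr: "\<And>n \<omega> x. \<omega> \<in> space (stages n) \<Longrightarrow>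
      bracket G sbar \<theta> g h x (choice1 n \<omega> x) (choice2 n \<omega> x) \<le> q * exp (\<theta> * h x)"
  shows "(\<integral>\<^sup>+\<omega>. ennreal (potential g h n \<omega>) \<partial>law_upto n) \<le> ennreal (q ^ n * exp (\<theta> * h i))"
proof (induction n)
  case 0
  show ?case
    using potential_measurable[of g h 0]
    by (subst nn_integral_law_upto_0) (auto simp: potential_def discounted_cost_def current_value_def)
next
  case (Suc n)
  have "(\<integral>\<^sup>+\<omega>. ennreal (potential g h (Suc n) \<omega>) \<partial>law_upto (Suc n)) =
    (\<integral>\<^sup>+\<omega>. \<integral>\<^sup>+w. ennreal (potential g h (Suc n) (fun_upd \<omega> n w)) \<partial>stage_kernel G i \<pi>1 \<pi>2 n \<omega> \<partial>law_upto n)"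
    by (rule nn_integral_law_upto_Suc[OF measurable_compose[OF potential_measurable measurable_ennreal]])
  also have "\<dots> \<le> (\<integral>\<^sup>+\<omega>. ennreal q * ennreal (potential g h n \<omega>) \<partial>law_upto n)"
  proof (rule nn_integral_mono)
    fix \<omega> assume "\<omega> \<in> space (law_upto n)"
    then have \<omega>: "\<omega> \<in> space (stages n)" by (simp add: space_law_upto)
    have "(\<integral>\<^sup>+x. ennreal (bracket G sbar \<theta> g h x (choice1 n \<omega> x) (choice2 n \<omega> x)) \<partial>state_law n \<omega>)
        \<le> (\<integral>\<^sup>+x. ennreal q * ennreal (exp (\<theta> * h x)) \<partial>state_law n \<omega>)"
      using contr[OF \<omega>] by (intro nn_integral_mono) (simp add: ennreal_mult'[OF q, symmetric] ennreal_leI)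
    also have "\<dots> = ennreal q * ennreal (current_value h n \<omega>)"
      using measurable_space[OF state_law_measurable \<omega>]
      by (subst nn_integral_cmult) (simp_all add: nn_integral_state_law_value[OF \<omega>] space_prob_algebra measurable_cong_sets[of "state_law n \<omega>" "count_space UNIV"])
    finally have "(\<integral>\<^sup>+w. ennreal (potential g h (Suc n) (fun_upd \<omega> n w)) \<partial>stage_kernel G i \<pi>1 \<pi>2 n \<omega>)
        \<le> ennreal (exp (\<theta> * discounted_cost g n \<omega>)) * (ennreal q * ennreal (current_value h n \<omega>))"
      unfolding nn_integral_potential_Suc[OF \<omega>] by (rule mult_left_mono) simp
    also have "\<dots> = ennreal q * ennreal (potential g h n \<omega>)"
      using q current_value_pos[OF \<omega>, of h] by (simp add: potential_def ennreal_mult ac_simps)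
    finally show "(\<integral>\<^sup>+w. ennreal (potential g h (Suc n) (fun_upd \<omega> n w)) \<partial>stage_kernel G i \<pi>1 \<pi>2 n \<omega>)
        \<le> ennreal q * ennreal (potential g h n \<omega>)" .
  qed
  also have "\<dots> = ennreal q * (\<integral>\<^sup>+\<omega>. ennreal (potential g h n \<omega>) \<partial>law_upto n)"
    using potential_measurable[of g h n]
    by (intro nn_integral_cmult) (simp add: measurable_cong_sets[OF sets_law_upto refl])
  also have "\<dots> \<le> ennreal q * ennreal (q ^ n * exp (\<theta> * h i))" by (rule mult_left_mono[OF Suc]) simp
  finally show ?case using q by (simp add: ennreal_mult'[symmetric] mult.assoc)
qed

lemma path_coordinate: "\<omega> \<in> space law \<Longrightarrow> \<omega> k \<in> space (stage_space G)"
  unfolding space_law space_PiM PiE_iff by simp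

lemma AE_stage_time_le: "AE \<omega> in law. \<forall>k. stage_time (\<omega> k) \<le> sbar"
proof (subst AE_all_countable, rule allI)
  fix k
  let ?F = "\<lambda>w. indicator {sbar<..} (stage_time w) :: ennreal"
  have F: "?F \<in> borel_measurable (stage_space G)"
    using stage_time_measurable by measurable
  have F_k: "(\<lambda>\<omega>. ?F (\<omega> k)) \<in> borel_measurable (stages (Suc k))"
    by (rule coordinate_measurable[OF F]) simp
  have "(\<integral>\<^sup>+\<omega>. ?F (\<omega> k) \<partial>law) = (\<integral>\<^sup>+\<omega>. ?F (\<omega> k) \<partial>law_upto (Suc k))"
    by (rule nn_integral_law_upto[OF F_k]) simp
  also have "\<dots> = (\<integral>\<^sup>+\<omega>. \<integral>\<^sup>+w. ?F (fun_upd \<omega> k w k) \<partial>stage_kernel G i \<pi>1 \<pi>2 k \<omega> \<partial>law_upto k)"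
    by (rule nn_integral_law_upto_Suc[OF F_k])
  also have "\<dots> \<le> (\<integral>\<^sup>+\<omega>. 0 \<partial>law_upto k)"
  proof (rule nn_integral_mono)
    fix \<omega> assume "\<omega> \<in> space (law_upto k)"
    then have \<omega>: "\<omega> \<in> space (stages k)" by (simp add: space_law_upto)
    have "(\<integral>\<^sup>+w. ?F w \<partial>stage_kernel G i \<pi>1 \<pi>2 k \<omega>) \<le> 0"
    proof (rule nn_integral_stage_kernel_le[OF \<omega> F])
      fix x a b assume "(a, b) \<in> K x"
      then have "(\<integral>\<^sup>+s. ?F (x, a, b, s) \<partial>law_S' x (a, b)) = ennreal (LINT s:{0..sbar}|law_S x (a, b). 0)"
        by (rule nn_integral_law_S') (simp_all add: stage_time_def)
      then show "(\<integral>\<^sup>+s. ?F (x, a, b, s) \<partial>law_S' x (a, b)) \<le> 0" by simp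
    qed
    then show "(\<integral>\<^sup>+w. ?F (fun_upd \<omega> k w k) \<partial>stage_kernel G i \<pi>1 \<pi>2 k \<omega>) \<le> 0" by simp
  qed
  finally have zero: "(\<integral>\<^sup>+\<omega>. ?F (\<omega> k) \<partial>law) = 0" by simp
  have "(\<lambda>\<omega>. ?F (\<omega> k)) \<in> borel_measurable law"
    by (rule law_measurable[OF F_k]) simp
  from nn_integral_0_iff_AE[OF this] zero have "AE \<omega> in law. ?F (\<omega> k) = 0" by simp
  then show "AE \<omega> in law. stage_time (\<omega> k) \<le> sbar"
    by (rule eventually_mono) (simp add: indicator_def split: if_splits)
qed

lemma jump_time_mono:
  assumes "\<omega> \<in> space law"
  shows "strict_mono (jump_time \<omega>)"
proof (rule strict_mono_Suc_iff[THEN iffD2], rule allI)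
  fix n
  have "0 < stage_time (\<omega> n)" using path_coordinate[OF assms, of n] by (simp add: in_stage_space)
  then show "jump_time \<omega> n < jump_time \<omega> (Suc n)" by (simp add: jump_time_eq)
qed

text \<open>
  For suitable \<open>\<beta>\<close> the expectation of \<open>exp (- \<beta> T\<^sub>n)\<close> is at most \<open>2\<^sup>-\<^sup>n\<close>. The sum over \<open>n\<close> is therefore
  almost surely finite, whereas infinitely many jumps up to \<open>t\<close> would bound all its terms from below.
\<close>

lemma AE_finitely_many_jumps: "AE \<omega> in law. finite {n. jump_time \<omega> n \<le> t}"
proof -
  obtain \<beta> where \<beta>: "\<beta> \<ge> 0" "\<And>x z. z \<in> K x \<Longrightarrow> (LINT s:{0..sbar}|law_S x z. exp (- \<beta> * s)) \<le> 1/2"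
    using uniform_laplace_small[of "1/2"] by auto
  define f where "f w = ennreal (exp (- \<beta> * stage_time w))" for w :: "'s \<times> 'a \<times> 'b \<times> real"
  have f: "f \<in> borel_measurable (stage_space G)"
    unfolding f_def[abs_def] using stage_time_measurable by measurable
  have prod_eq: "(\<Prod>k<n. f (\<omega> k)) = ennreal (exp (- \<beta> * jump_time \<omega> n))" for n \<omega>
    by (simp add: f_def prod_ennreal jump_time_eq exp_sum[symmetric] sum_distrib_left sum_negf)
  have meas: "(\<lambda>\<omega>. ennreal (exp (- \<beta> * jump_time \<omega> n))) \<in> borel_measurable (stages n)" for n
    using jump_time_measurable[OF order_refl, of n] by measurable
  have law_meas: "(\<lambda>\<omega>. ennreal (exp (- \<beta> * jump_time \<omega> n))) \<in> borel_measurable law" for n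
    by (rule law_measurable[OF meas]) (simp add: jump_time_restrict)
  have le: "(\<integral>\<^sup>+\<omega>. ennreal (exp (- \<beta> * jump_time \<omega> n)) \<partial>law) \<le> ennreal ((1/2) ^ n)" for n
  proof -
    have "(\<integral>\<^sup>+\<omega>. ennreal (exp (- \<beta> * jump_time \<omega> n)) \<partial>law) = (\<integral>\<^sup>+\<omega>. (\<Prod>k<n. f (\<omega> k)) \<partial>law_upto n)"
      unfolding prod_eq by (rule nn_integral_law_upto[OF meas]) (simp add: jump_time_restrict)
    also have "\<dots> \<le> ennreal (1/2) ^ n"
    proof (rule nn_integral_prod_le[OF f])
      fix x a b assume z: "(a, b) \<in> K x"
      have "(\<integral>\<^sup>+s. f (x, a, b, s) \<partial>law_S' x (a, b)) = ennreal (LINT s:{0..sbar}|law_S x (a, b). exp (- \<beta> * s))"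
        by (rule nn_integral_law_S'[OF z]) (simp_all add: f_def stage_time_def continuous_intros)
      also have "\<dots> \<le> ennreal (1/2)" by (rule ennreal_leI[OF \<beta>(2)[OF z]])
      finally show "(\<integral>\<^sup>+s. f (x, a, b, s) \<partial>law_S' x (a, b)) \<le> ennreal (1/2)" .
    qed
    also have "ennreal (1/2) ^ n = ennreal ((1/2) ^ n)" by (rule ennreal_power) simp
    finally show ?thesis .
  qed
  have "(\<integral>\<^sup>+\<omega>. (\<Sum>n. ennreal (exp (- \<beta> * jump_time \<omega> n))) \<partial>law) = (\<Sum>n. \<integral>\<^sup>+\<omega>. ennreal (exp (- \<beta> * jump_time \<omega> n)) \<partial>law)"
    by (rule nn_integral_suminf[OF law_meas])
  also have "\<dots> \<le> (\<Sum>n. ennreal ((1/2) ^ n))" by (intro suminf_le le) simp_all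
  also have "\<dots> = ennreal (\<Sum>n. (1/2) ^ n)"
    by (rule suminf_ennreal2) (simp_all add: summable_geometric)
  also have "\<dots> < \<infinity>" by simp
  finally have "AE \<omega> in law. (\<Sum>n. ennreal (exp (- \<beta> * jump_time \<omega> n))) \<noteq> \<infinity>"
    by (intro nn_integral_PInf_AE borel_measurable_suminf_order law_meas) simp
  with AE_space show ?thesis
  proof eventually_elim
    case (elim \<omega>)
    note mono = strict_mono_mono[OF jump_time_mono[OF elim(1)]]
    show ?case
    proof (rule ccontr)
      assume inf: "infinite {n. jump_time \<omega> n \<le> t}"
      have all: "jump_time \<omega> n \<le> t" for n
      proof -
        obtain m where "m \<ge> n" "jump_time \<omega> m \<le> t" using inf unfolding infinite_nat_iff_unbounded_le by auto
        then show ?thesis using monoD[OF mono, of n m] by simp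
      qed
      have "summable (\<lambda>n. exp (- \<beta> * jump_time \<omega> n))"
        using elim(2) by (intro summable_suminf_not_top) simp_all
      then have "(\<lambda>n. exp (- \<beta> * jump_time \<omega> n)) \<longlonglongrightarrow> 0" by (rule summable_LIMSEQ_zero)
      moreover have "exp (- \<beta> * t) \<le> exp (- \<beta> * jump_time \<omega> n)" for n
        using all[of n] \<beta>(1) by (simp add: mult_left_mono)
      ultimately have "exp (- \<beta> * t) \<le> 0" by (intro LIMSEQ_le_const) auto
      then show False by simp
    qed
  qed
qed

text \<open>
  The paths, of full measure, on which the supremum defining the jump count is a maximum and the
  truncation of costs has no effect.
\<close>

definition regular_path :: "real \<Rightarrow> (nat \<Rightarrow> 's \<times> 'a \<times> 'b \<times> real) \<Rightarrow> bool" where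
  "regular_path t \<omega> \<longleftrightarrow> \<omega> \<in> space law \<and> (\<forall>k. stage_time (\<omega> k) \<le> sbar) \<and> finite {n. jump_time \<omega> n \<le> t}"

lemma AE_regular_path: "AE \<omega> in law. regular_path t \<omega>"
  using AE_space AE_stage_time_le AE_finitely_many_jumps[of t]
  by eventually_elim (simp add: regular_path_def)

lemma regular_path_jump_count:
  assumes \<omega>: "regular_path t \<omega>" and "t \<ge> 0"
  shows "jump_time \<omega> (jump_count \<omega> t) \<le> t" and "t < jump_time \<omega> (Suc (jump_count \<omega> t))"
    and "jump_time \<omega> k \<le> t \<Longrightarrow> t < jump_time \<omega> (Suc k) \<Longrightarrow> k = jump_count \<omega> t"
proof -
  let ?N = "{n. jump_time \<omega> n \<le> t}"
  have fin: "finite ?N" and sp: "\<omega> \<in> space law" using \<omega> by (simp_all add: regular_path_def)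
  have "0 \<in> ?N" using \<open>t \<ge> 0\<close> by (simp add: jump_time_eq)
  then have ne: "?N \<noteq> {}" by blast
  have count: "jump_count \<omega> t = Max ?N" unfolding jump_count_def by (rule cSup_eq_Max[OF fin ne])
  show le: "jump_time \<omega> (jump_count \<omega> t) \<le> t" using Max_in[OF fin ne] unfolding count by simp
  show gt: "t < jump_time \<omega> (Suc (jump_count \<omega> t))"
  proof (rule ccontr)
    assume "\<not> ?thesis"
    then have "Suc (Max ?N) \<in> ?N" unfolding count by simp
    from Max_ge[OF fin this] show False by simp
  qed
  show "k = jump_count \<omega> t" if "jump_time \<omega> k \<le> t" "t < jump_time \<omega> (Suc k)"
  proof -
    have "jump_time \<omega> k < jump_time \<omega> (Suc (jump_count \<omega> t))" "jump_time \<omega> (jump_count \<omega> t) < jump_time \<omega> (Suc k)"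
      using that le gt by linarith+
    then show ?thesis unfolding strict_mono_less[OF jump_time_mono[OF sp]] by simp
  qed
qed

lemma regular_path_total_cost:
  assumes \<omega>: "regular_path t \<omega>"
  shows "total_cost G t \<omega> = (\<Sum>k<jump_count \<omega> t. trunc_cost (\<omega> k))
    + stage_cost G (\<omega> (jump_count \<omega> t)) (t - jump_time \<omega> (jump_count \<omega> t))"
proof -
  have "stage_cost G (\<omega> k) (case \<omega> k of (x, a, b, s) \<Rightarrow> s) = trunc_cost (\<omega> k)" for k
    using \<omega> by (simp add: regular_path_def trunc_cost_def stage_time_def split_beta min_absorb1)
  then show ?thesis by (simp add: total_cost_def Let_def)
qed

text \<open>
  Comparison of the total cost with the costs completed at the jumps just before and just after \<open>t\<close>: one
  or two stage costs of size at most \<open>C\<close> are exchanged, and \<open>g T\<close> differs from \<open>g t\<close> by at most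
  \<open>\<bar>g\<bar> sbar\<close>.
\<close>

lemma regular_path_bounds:
  assumes \<omega>: "regular_path t \<omega>" and t: "t \<ge> 0" and N: "N = jump_count \<omega> t"
    and C: "\<And>w r. stage_actions w \<in> K (fst w) \<Longrightarrow> 0 \<le> r \<Longrightarrow> r \<le> sbar \<Longrightarrow> \<bar>stage_cost G w r\<bar> \<le> C"
  shows "total_cost G t \<omega> \<le> discounted_cost g N \<omega> + g * t + \<bar>g\<bar> * sbar + C"
    and "discounted_cost g (Suc N) \<omega> + g * t \<le> total_cost G t \<omega> + 2 * C + \<bar>g\<bar> * sbar"
proof -
  have T: "jump_time \<omega> N \<le> t" "t < jump_time \<omega> (Suc N)" unfolding N by (rule regular_path_jump_count[OF \<omega> t])+
  have \<omega>N: "\<omega> N \<in> space (stage_space G)" "stage_time (\<omega> N) \<le> sbar"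
    using \<omega> path_coordinate by (simp_all add: regular_path_def)
  then have acts: "stage_actions (\<omega> N) \<in> K (fst (\<omega> N))" and "0 < stage_time (\<omega> N)"
    by (simp_all only: in_stage_space)
  have Suc: "jump_time \<omega> (Suc N) = jump_time \<omega> N + stage_time (\<omega> N)" by (simp add: jump_time_eq)
  have dist: "\<bar>g * (r - t)\<bar> \<le> \<bar>g\<bar> * sbar" if "\<bar>r - t\<bar> \<le> sbar" for r
    using that by (simp add: abs_mult mult_left_mono)
  have last: "\<bar>stage_cost G (\<omega> N) (t - jump_time \<omega> N)\<bar> \<le> C" "\<bar>trunc_cost (\<omega> N)\<bar> \<le> C"
    unfolding trunc_cost_def using T Suc \<omega>N(2) \<open>0 < stage_time (\<omega> N)\<close> sbar_pos by (intro C acts; simp)+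
  have total: "total_cost G t \<omega> = (\<Sum>k<N. trunc_cost (\<omega> k)) + stage_cost G (\<omega> N) (t - jump_time \<omega> N)"
    unfolding N by (rule regular_path_total_cost[OF \<omega>])
  have disc: "discounted_cost g n \<omega> = (\<Sum>k<n. trunc_cost (\<omega> k)) - g * jump_time \<omega> n" for n
    by (simp add: discounted_cost_def jump_time_eq sum_subtractf sum_distrib_left)
  have "\<bar>g * (jump_time \<omega> N - t)\<bar> \<le> \<bar>g\<bar> * sbar" "\<bar>g * (jump_time \<omega> (Suc N) - t)\<bar> \<le> \<bar>g\<bar> * sbar"
    using T Suc \<omega>N(2) by (intro dist; simp)+
  then have "g * jump_time \<omega> N \<le> g * t + \<bar>g\<bar> * sbar" "g * t - g * jump_time \<omega> (Suc N) \<le> \<bar>g\<bar> * sbar"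
    by (simp_all add: right_diff_distrib abs_le_iff)
  then show "total_cost G t \<omega> \<le> discounted_cost g N \<omega> + g * t + \<bar>g\<bar> * sbar + C"
    and "discounted_cost g (Suc N) \<omega> + g * t \<le> total_cost G t \<omega> + 2 * C + \<bar>g\<bar> * sbar"
    unfolding total disc using last by (simp_all add: abs_le_iff)
qed

section \<open>Growth bounds from sub- and supersolutions\<close>

text \<open>
  The index of the last jump before \<open>t\<close> is random. Since the expected potentials are summable, its
  potential may simply be bounded by the sum of all potentials.
\<close>

lemma expected_cost_upper:
  assumes q: "q \<ge> 0" "q < 1" and contr: "\<And>n \<omega> x. \<omega> \<in> space (stages n) \<Longrightarrow>
      bracket G sbar \<theta> g h x (choice1 n \<omega> x) (choice2 n \<omega> x) \<le> q * exp (\<theta> * h x)"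
  obtains c where "c > 0" "\<And>t. t > 0 \<Longrightarrow> (\<integral>\<^sup>+\<omega>. ennreal (exp (\<theta> * total_cost G t \<omega>)) \<partial>law) \<le> ennreal (c * exp (\<theta> * g * t))"
proof -
  obtain C where C: "\<And>w r. stage_actions w \<in> K (fst w) \<Longrightarrow> 0 \<le> r \<Longrightarrow> r \<le> sbar \<Longrightarrow> \<bar>stage_cost G w r\<bar> \<le> C"
    by (rule stage_cost_bounded, rule that)
  define m where "m = Min (range (\<lambda>j :: 's. exp (\<theta> * h j)))"
  have m: "m > 0" unfolding m_def by (rule Min_exp_pos)
  (* The lower bound m of the current value converts the discounted cost into the potential. *)
  define k where "k = exp (\<theta> * (\<bar>g\<bar> * sbar + C)) / m"
  have k: "k > 0" unfolding k_def using m by simp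
  have pot_law: "(\<lambda>\<omega>. ennreal (potential g h n \<omega>)) \<in> borel_measurable law" for n
    by (rule law_measurable[OF measurable_compose[OF potential_measurable measurable_ennreal]])
       (simp add: potential_restrict)
  have pot_le: "(\<integral>\<^sup>+\<omega>. ennreal (potential g h n \<omega>) \<partial>law) \<le> ennreal (q ^ n * exp (\<theta> * h i))" for n
  proof -
    have "(\<integral>\<^sup>+\<omega>. ennreal (potential g h n \<omega>) \<partial>law) = (\<integral>\<^sup>+\<omega>. ennreal (potential g h n \<omega>) \<partial>law_upto n)"
      by (rule nn_integral_law_upto[OF measurable_compose[OF potential_measurable measurable_ennreal]])
         (simp add: potential_restrict)
    also have "\<dots> \<le> ennreal (q ^ n * exp (\<theta> * h i))" by (rule nn_integral_potential_le[OF q(1) contr])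
    finally show ?thesis .
  qed
  have "(\<integral>\<^sup>+\<omega>. ennreal (exp (\<theta> * total_cost G t \<omega>)) \<partial>law)
      \<le> ennreal (k / (1 - q) * exp (\<theta> * h i) * exp (\<theta> * g * t))" if t: "t > 0" for t
  proof -
    have "(\<integral>\<^sup>+\<omega>. ennreal (exp (\<theta> * total_cost G t \<omega>)) \<partial>law)
        \<le> (\<integral>\<^sup>+\<omega>. ennreal (k * exp (\<theta> * g * t)) * (\<Sum>n. ennreal (potential g h n \<omega>)) \<partial>law)"
    proof (rule nn_integral_mono_AE)
      show "AE \<omega> in law. ennreal (exp (\<theta> * total_cost G t \<omega>))
          \<le> ennreal (k * exp (\<theta> * g * t)) * (\<Sum>n. ennreal (potential g h n \<omega>))"
        using AE_regular_path[of t]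
      proof eventually_elim
        case (elim \<omega>)
        define N where "N = jump_count \<omega> t"
        have sp: "\<omega> \<in> space law" using elim by (simp add: regular_path_def)
        have cv: "m \<le> current_value h N \<omega>" unfolding m_def by (rule current_value_bounds(1)) (rule path_coordinate[OF sp])
        have "\<theta> * total_cost G t \<omega> \<le> \<theta> * (discounted_cost g N \<omega> + g * t + \<bar>g\<bar> * sbar + C)"
          by (rule mult_left_mono[OF regular_path_bounds(1)[OF elim less_imp_le[OF t] N_def C] less_imp_le[OF \<theta>_pos]])
        then have "exp (\<theta> * total_cost G t \<omega>) \<le> exp (\<theta> * (discounted_cost g N \<omega> + g * t + \<bar>g\<bar> * sbar + C))" by simp
        also have "\<dots> = exp (\<theta> * (\<bar>g\<bar> * sbar + C)) * exp (\<theta> * g * t) * exp (\<theta> * discounted_cost g N \<omega>)"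
          unfolding exp_add[symmetric] by (simp add: algebra_simps)
        also have "\<dots> = k * exp (\<theta> * g * t) * (exp (\<theta> * discounted_cost g N \<omega>) * m)"
          using m by (simp add: k_def)
        also have "\<dots> \<le> k * exp (\<theta> * g * t) * potential g h N \<omega>"
          unfolding potential_def using k cv by (intro mult_left_mono) simp_all
        finally have "ennreal (exp (\<theta> * total_cost G t \<omega>)) \<le> ennreal (k * exp (\<theta> * g * t)) * ennreal (potential g h N \<omega>)"
          using k by (subst ennreal_mult'[symmetric]) (simp_all add: ennreal_leI)
        also have "\<dots> \<le> ennreal (k * exp (\<theta> * g * t)) * (\<Sum>n. ennreal (potential g h n \<omega>))"
          using sum_le_suminf[of "\<lambda>n. ennreal (potential g h n \<omega>)" "{N}"] by (intro mult_left_mono) simp_all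
        finally show ?case .
      qed
    qed
    also have "\<dots> = ennreal (k * exp (\<theta> * g * t)) * (\<Sum>n. \<integral>\<^sup>+\<omega>. ennreal (potential g h n \<omega>) \<partial>law)"
    proof (subst nn_integral_cmult)
      show "(\<lambda>\<omega>. \<Sum>n. ennreal (potential g h n \<omega>)) \<in> borel_measurable law" by (rule borel_measurable_suminf_order[OF pot_law])
    qed (simp add: nn_integral_suminf[OF pot_law])
    also have "\<dots> \<le> ennreal (k * exp (\<theta> * g * t)) * (\<Sum>n. ennreal (q ^ n * exp (\<theta> * h i)))"
      by (intro mult_left_mono suminf_le pot_le) simp_all
    also have "(\<Sum>n. ennreal (q ^ n * exp (\<theta> * h i))) = ennreal (1 / (1 - q) * exp (\<theta> * h i))"
    proof (subst suminf_ennreal2)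
      show "summable (\<lambda>n. q ^ n * exp (\<theta> * h i))" using q by (intro summable_mult2 summable_geometric) simp
      have "(\<Sum>n. q ^ n * exp (\<theta> * h i)) = (\<Sum>n. q ^ n) * exp (\<theta> * h i)"
        using q by (intro suminf_mult2[symmetric] summable_geometric) simp
      also have "(\<Sum>n. q ^ n) = 1 / (1 - q)" using q by (intro suminf_geometric) simp
      finally show "ennreal (\<Sum>n. q ^ n * exp (\<theta> * h i)) = ennreal (1 / (1 - q) * exp (\<theta> * h i))" by simp
    qed (use q in simp)
    also have "ennreal (k * exp (\<theta> * g * t)) * ennreal (1 / (1 - q) * exp (\<theta> * h i))
        = ennreal (k / (1 - q) * exp (\<theta> * h i) * exp (\<theta> * g * t))"
      using k q by (simp add: ennreal_mult'[symmetric] mult_ac)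
    finally show ?thesis .
  qed
  moreover have "k / (1 - q) * exp (\<theta> * h i) > 0" using k q by simp
  ultimately show ?thesis by (intro that[of "k / (1 - q) * exp (\<theta> * h i)"])
qed

lemma Max_exp_pos: "0 < Max (range (\<lambda>j :: 's. exp (\<theta> * h j)))"
  by (rule less_le_trans[of _ "exp (\<theta> * h undefined)"]) (rule exp_gt_zero, rule Max_ge[OF _ rangeI], simp)

text \<open>
  The potential on the event that stage \<open>n\<close> starts at or before \<open>t\<close>.
\<close>

definition alive :: "real \<Rightarrow> ('s \<Rightarrow> real) \<Rightarrow> real \<Rightarrow> nat \<Rightarrow> (nat \<Rightarrow> 's \<times> 'a \<times> 'b \<times> real) \<Rightarrow> real" where
  "alive g h t n \<omega> = (if jump_time \<omega> n \<le> t then potential g h n \<omega> else 0)"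

text \<open>
  The potential at the first jump after \<open>t\<close>, on the event that this jump has number \<open>Suc n\<close>.
\<close>

definition stopped :: "real \<Rightarrow> ('s \<Rightarrow> real) \<Rightarrow> real \<Rightarrow> nat \<Rightarrow> (nat \<Rightarrow> 's \<times> 'a \<times> 'b \<times> real) \<Rightarrow> real" where
  "stopped g h t n \<omega> = (if jump_time \<omega> n \<le> t \<and> t < jump_time \<omega> (Suc n) then potential g h (Suc n) \<omega> else 0)"

lemma alive_measurable: "(\<lambda>\<omega>. ennreal (alive g h t n \<omega>)) \<in> borel_measurable (stages n)"
  unfolding alive_def using potential_measurable[of g h n] jump_time_measurable[OF order_refl, of n] by measurable

lemma stopped_measurable: "(\<lambda>\<omega>. ennreal (stopped g h t n \<omega>)) \<in> borel_measurable (stages (Suc n))"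
  unfolding stopped_def
  using potential_measurable[of g h "Suc n"] jump_time_measurable[of n "Suc n"] jump_time_measurable[OF order_refl, of "Suc n"]
  by measurable

text \<open>
  Submartingale inequality on the event \<open>T\<^sub>n \<le> t\<close>, which splits according to whether the next jump is
  still at or before \<open>t\<close>.
\<close>

lemma alive_step:
  assumes reply: "\<And>n \<omega> x. \<omega> \<in> space (stages n) \<Longrightarrow>
      exp (\<theta> * h x) \<le> bracket G sbar \<theta> g h x (choice1 n \<omega> x) (choice2 n \<omega> x)"
  shows "(\<integral>\<^sup>+\<omega>. ennreal (alive g h t n \<omega>) \<partial>law_upto n) \<le>
    (\<integral>\<^sup>+\<omega>. ennreal (stopped g h t n \<omega>) \<partial>law_upto (Suc n)) + (\<integral>\<^sup>+\<omega>. ennreal (alive g h t (Suc n) \<omega>) \<partial>law_upto (Suc n))"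
proof -
  let ?next = "\<lambda>\<omega>. ennreal (potential g h (Suc n) \<omega>) * indicator {..t} (jump_time \<omega> n)"
  have next_meas: "?next \<in> borel_measurable (stages (Suc n))"
    using potential_measurable[of g h "Suc n"] jump_time_measurable[of n "Suc n"] by measurable
  have "(\<integral>\<^sup>+\<omega>. ennreal (alive g h t n \<omega>) \<partial>law_upto n) \<le>
    (\<integral>\<^sup>+\<omega>. \<integral>\<^sup>+w. ?next (fun_upd \<omega> n w) \<partial>stage_kernel G i \<pi>1 \<pi>2 n \<omega> \<partial>law_upto n)"
  proof (rule nn_integral_mono)
    fix \<omega> assume "\<omega> \<in> space (law_upto n)"
    then have \<omega>: "\<omega> \<in> space (stages n)" by (simp add: space_law_upto)
    have "ennreal (potential g h n \<omega>) = ennreal (exp (\<theta> * discounted_cost g n \<omega>)) * (\<integral>\<^sup>+x. ennreal (exp (\<theta> * h x)) \<partial>state_law n \<omega>)"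
      unfolding nn_integral_state_law_value[OF \<omega>] potential_def by (simp add: ennreal_mult')
    also have "\<dots> \<le> (\<integral>\<^sup>+w. ennreal (potential g h (Suc n) (fun_upd \<omega> n w)) \<partial>stage_kernel G i \<pi>1 \<pi>2 n \<omega>)"
      unfolding nn_integral_potential_Suc[OF \<omega>] by (intro mult_left_mono nn_integral_mono ennreal_leI reply \<omega>) simp
    finally have le: "ennreal (potential g h n \<omega>) \<le>
      (\<integral>\<^sup>+w. ennreal (potential g h (Suc n) (fun_upd \<omega> n w)) \<partial>stage_kernel G i \<pi>1 \<pi>2 n \<omega>)" .
    have "jump_time (fun_upd \<omega> n w) n = jump_time \<omega> n" for w by (simp add: jump_time_eq)
    with le show "ennreal (alive g h t n \<omega>) \<le> (\<integral>\<^sup>+w. ?next (fun_upd \<omega> n w) \<partial>stage_kernel G i \<pi>1 \<pi>2 n \<omega>)"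
      by (cases "jump_time \<omega> n \<le> t") (simp_all add: alive_def)
  qed
  also have "\<dots> = (\<integral>\<^sup>+\<omega>. ?next \<omega> \<partial>law_upto (Suc n))"
    by (rule nn_integral_law_upto_Suc[OF next_meas, symmetric])
  also have "\<dots> = (\<integral>\<^sup>+\<omega>. ennreal (stopped g h t n \<omega>) + ennreal (alive g h t (Suc n) \<omega>) \<partial>law_upto (Suc n))"
  proof (rule nn_integral_cong)
    fix \<omega> assume "\<omega> \<in> space (law_upto (Suc n))"
    then have \<omega>: "\<omega> \<in> space (stages (Suc n))" by (simp only: space_law_upto)
    have "0 < stage_time (\<omega> n)" using stages_coordinate[OF \<omega>, of n] by (simp add: in_stage_space)
    then have "jump_time \<omega> n < jump_time \<omega> (Suc n)" by (simp add: jump_time_eq)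
    then show "?next \<omega> = ennreal (stopped g h t n \<omega>) + ennreal (alive g h t (Suc n) \<omega>)"
      by (simp add: stopped_def alive_def indicator_def)
  qed
  also have "\<dots> = (\<integral>\<^sup>+\<omega>. ennreal (stopped g h t n \<omega>) \<partial>law_upto (Suc n)) + (\<integral>\<^sup>+\<omega>. ennreal (alive g h t (Suc n) \<omega>) \<partial>law_upto (Suc n))"
    by (intro nn_integral_add; subst measurable_cong_sets[OF sets_law_upto refl]; rule stopped_measurable alive_measurable)
  finally show ?thesis .
qed

text \<open>
  On \<open>T\<^sub>n \<le> t\<close> the factor \<open>exp (\<beta> (t - T\<^sub>n))\<close> is at least \<open>1\<close>. Inserting it bounds the potential by a
  constant times a product of stage factors, each of which has integral at most \<open>1/2\<close> once \<open>\<beta>\<close> is large.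
\<close>

lemma alive_vanishes:
  obtains c where "c \<ge> 0" "\<And>n. (\<integral>\<^sup>+\<omega>. ennreal (alive g h t n \<omega>) \<partial>law_upto n) \<le> ennreal (c * (1/2) ^ n)"
proof -
  obtain C where C: "\<And>w r. stage_actions w \<in> K (fst w) \<Longrightarrow> 0 \<le> r \<Longrightarrow> r \<le> sbar \<Longrightarrow> \<bar>stage_cost G w r\<bar> \<le> C"
    by (rule stage_cost_bounded, rule that)
  obtain \<beta>' where \<beta>': "\<beta>' \<ge> 0" "\<And>x z. z \<in> K x \<Longrightarrow> (LINT s:{0..sbar}|law_S x z. exp (- \<beta>' * s)) \<le> exp (- \<theta> * C) / 2"
    by (rule uniform_laplace_small[of "exp (- \<theta> * C) / 2"]) (simp, rule that)
  (* The second summand makes up for a negative g, whose factor exp (- \<theta> g s) grows with s. *)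
  define \<beta> where "\<beta> = \<beta>' + \<theta> * \<bar>g\<bar>"
  have \<beta>: "\<beta> \<ge> 0" using \<beta>'(1) \<theta>_pos by (simp add: \<beta>_def)
  define M where "M = Max (range (\<lambda>j :: 's. exp (\<theta> * h j)))"
  have M: "M \<ge> 0" unfolding M_def by (rule less_imp_le[OF Max_exp_pos])
  define f where "f w = ennreal (exp (\<theta> * (trunc_cost w - g * stage_time w) - \<beta> * stage_time w))" for w
  have f: "f \<in> borel_measurable (stage_space G)"
    unfolding f_def[abs_def] using stage_time_measurable trunc_cost_measurable by measurable
  have prod_eq: "(\<Prod>k<n. f (\<omega> k)) = ennreal (exp (\<theta> * discounted_cost g n \<omega> - \<beta> * jump_time \<omega> n))" for n \<omega>
    unfolding f_def discounted_cost_def jump_time_eq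
    by (simp add: prod_ennreal exp_sum[symmetric] sum_distrib_left[symmetric] sum_subtractf)
  have f_le: "(\<integral>\<^sup>+s. f (x, a, b, s) \<partial>law_S' x (a, b)) \<le> ennreal (1/2)" if z: "(a, b) \<in> K x" for x a b
  proof -
    have "(\<integral>\<^sup>+s. f (x, a, b, s) \<partial>law_S' x (a, b)) \<le> (\<integral>\<^sup>+s. ennreal (exp (\<theta> * C) * exp (- \<beta>' * s)) \<partial>law_S' x (a, b))"
    proof (rule nn_integral_mono)
      fix s assume "s \<in> space (law_S' x (a, b))"
      then have s: "s > 0" by (simp add: space_restrict_space)
      have "trunc_cost (x, a, b, s) \<le> C"
        unfolding trunc_cost_def using C[of "(x, a, b, s)" "min s sbar"] z s sbar_pos
        by (simp add: stage_actions_def stage_time_def abs_le_iff)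
      then have "\<theta> * trunc_cost (x, a, b, s) \<le> \<theta> * C" using \<theta>_pos by simp
      moreover have "- (\<theta> * g * s) \<le> \<theta> * \<bar>g\<bar> * s"
        using \<theta>_pos s mult_right_mono[of "- g" "\<bar>g\<bar>" "\<theta> * s"] by (simp add: mult_ac)
      ultimately have "\<theta> * (trunc_cost (x, a, b, s) - g * s) - \<beta> * s \<le> \<theta> * C + (- \<beta>' * s)"
        by (simp add: \<beta>_def algebra_simps)
      then have "exp (\<theta> * (trunc_cost (x, a, b, s) - g * s) - \<beta> * s) \<le> exp (\<theta> * C + (- \<beta>' * s))" by simp
      then show "f (x, a, b, s) \<le> ennreal (exp (\<theta> * C) * exp (- \<beta>' * s))"
        unfolding f_def exp_add[symmetric] by (simp add: stage_time_def ennreal_leI)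
    qed
    also have "\<dots> = ennreal (LINT s:{0..sbar}|law_S x (a, b). exp (\<theta> * C) * exp (- \<beta>' * s))"
      by (rule nn_integral_law_S'[OF z]) (intro continuous_intros, simp_all)
    also have "\<dots> \<le> ennreal (exp (\<theta> * C) * (exp (- \<theta> * C) / 2))"
      using mult_left_mono[OF \<beta>'(2)[OF z], of "exp (\<theta> * C)"] by (intro ennreal_leI) simp
    also have "exp (\<theta> * C) * (exp (- \<theta> * C) / 2) = 1/2" by (simp add: exp_minus)
    finally show ?thesis .
  qed
  have "(\<integral>\<^sup>+\<omega>. ennreal (alive g h t n \<omega>) \<partial>law_upto n) \<le> ennreal (M * exp (\<beta> * t) * (1/2) ^ n)" for n
  proof -
    have "(\<integral>\<^sup>+\<omega>. ennreal (alive g h t n \<omega>) \<partial>law_upto n) \<le> (\<integral>\<^sup>+\<omega>. ennreal (M * exp (\<beta> * t)) * (\<Prod>k<n. f (\<omega> k)) \<partial>law_upto n)"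
    proof (rule nn_integral_mono)
      fix \<omega> assume "\<omega> \<in> space (law_upto n)"
      then have \<omega>: "\<omega> \<in> space (stages n)" by (simp add: space_law_upto)
      show "ennreal (alive g h t n \<omega>) \<le> ennreal (M * exp (\<beta> * t)) * (\<Prod>k<n. f (\<omega> k))"
      proof (cases "jump_time \<omega> n \<le> t")
        case True
        have "current_value h n \<omega> \<le> M"
          unfolding M_def by (rule current_value_bounds(2)) (rule stages_coordinate[OF \<omega>])
        then have "potential g h n \<omega> \<le> exp (\<theta> * discounted_cost g n \<omega>) * M"
          unfolding potential_def by (rule mult_left_mono) simp
        also have "\<dots> \<le> exp (\<theta> * discounted_cost g n \<omega> + \<beta> * (t - jump_time \<omega> n)) * M"
          using True \<beta> M by (intro mult_right_mono) simp_all
        also have "\<dots> = M * exp (\<beta> * t) * exp (\<theta> * discounted_cost g n \<omega> - \<beta> * jump_time \<omega> n)"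
          by (simp add: exp_add[symmetric] algebra_simps)
        finally show ?thesis
          using M True unfolding prod_eq by (subst ennreal_mult'[symmetric]) (simp_all add: ennreal_leI alive_def)
      qed (simp add: alive_def)
    qed
    also have "\<dots> = ennreal (M * exp (\<beta> * t)) * (\<integral>\<^sup>+\<omega>. (\<Prod>k<n. f (\<omega> k)) \<partial>law_upto n)"
    proof (rule nn_integral_cmult)
      have "(\<lambda>\<omega>. \<Prod>k<n. f (\<omega> k)) \<in> borel_measurable (stages n)"
        by (intro borel_measurable_prod_ennreal coordinate_measurable f) simp
      then show "(\<lambda>\<omega>. \<Prod>k<n. f (\<omega> k)) \<in> borel_measurable (law_upto n)"
        by (simp only: measurable_cong_sets[OF sets_law_upto refl])
    qed
    also have "\<dots> \<le> ennreal (M * exp (\<beta> * t)) * ennreal (1/2) ^ n"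
      by (intro mult_left_mono nn_integral_prod_le[OF f] f_le) simp_all
    also have "ennreal (1/2) ^ n = ennreal ((1/2) ^ n)" by (rule ennreal_power) simp
    also have "ennreal (M * exp (\<beta> * t)) * ennreal ((1/2) ^ n) = ennreal (M * exp (\<beta> * t) * (1/2) ^ n)"
      using M by (intro ennreal_mult'[symmetric]) simp
    finally show ?thesis .
  qed
  then show ?thesis using M by (intro that[of "M * exp (\<beta> * t)"]) simp_all
qed

text \<open>
  Optional stopping at the first jump after \<open>t\<close>: iterating the step leaves a remainder that vanishes.
\<close>

lemma initial_le_stopped_sum:
  assumes reply: "\<And>n \<omega> x. \<omega> \<in> space (stages n) \<Longrightarrow>
      exp (\<theta> * h x) \<le> bracket G sbar \<theta> g h x (choice1 n \<omega> x) (choice2 n \<omega> x)"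
    and "t \<ge> 0"
  shows "ennreal (exp (\<theta> * h i)) \<le> (\<Sum>n. \<integral>\<^sup>+\<omega>. ennreal (stopped g h t n \<omega>) \<partial>law_upto (Suc n))"
proof -
  let ?a = "\<lambda>n. \<integral>\<^sup>+\<omega>. ennreal (alive g h t n \<omega>) \<partial>law_upto n"
  let ?b = "\<lambda>n. \<integral>\<^sup>+\<omega>. ennreal (stopped g h t n \<omega>) \<partial>law_upto (Suc n)"
  have "?a 0 = ennreal (exp (\<theta> * h i))"
    unfolding nn_integral_law_upto_0[OF alive_measurable] using \<open>t \<ge> 0\<close>
    by (simp add: alive_def jump_time_eq potential_def discounted_cost_def current_value_def)
  moreover have "?a 0 \<le> (\<Sum>k<n. ?b k) + ?a n" for n
  proof (induction n)
    case (Suc n)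
    note Suc
    also have "(\<Sum>k<n. ?b k) + ?a n \<le> (\<Sum>k<n. ?b k) + (?b n + ?a (Suc n))"
      by (intro add_left_mono alive_step reply)
    finally show ?case by (simp only: sum.lessThan_Suc add.assoc)
  qed simp
  ultimately have le: "ennreal (exp (\<theta> * h i)) \<le> (\<Sum>k<n. ?b k) + ?a n" for n by simp
  obtain c where c: "c \<ge> 0" "\<And>n. ?a n \<le> ennreal (c * (1/2) ^ n)" by (rule alive_vanishes, rule that)
  show ?thesis
  proof (rule ennreal_le_epsilon)
    fix e :: real assume "e > 0"
    have "(\<lambda>n. c * (1/2) ^ n) \<longlonglongrightarrow> c * 0" by (intro tendsto_intros LIMSEQ_realpow_zero) simp_all
    then have "\<forall>\<^sub>F n in sequentially. c * (1/2) ^ n < e" using \<open>e > 0\<close> by (intro order_tendstoD(2)) simp_all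
    then obtain n where n: "c * (1/2) ^ n < e" by (auto simp: eventually_sequentially)
    have "ennreal (exp (\<theta> * h i)) \<le> (\<Sum>k<n. ?b k) + ?a n" by (rule le)
    also have "\<dots> \<le> (\<Sum>k. ?b k) + ennreal e"
      using n by (intro add_mono sum_le_suminf order_trans[OF c(2)] ennreal_leI) simp_all
    finally show "ennreal (exp (\<theta> * h i)) \<le> (\<Sum>k. ?b k) + ennreal e" .
  qed
qed

text \<open>
  On a regular path exactly one of the stopped potentials is nonzero, and it is at most a constant times
  \<open>exp (\<theta> (\<C>\<^sub>t - g t))\<close>.
\<close>

lemma expected_cost_lower:
  assumes reply: "\<And>n \<omega> x. \<omega> \<in> space (stages n) \<Longrightarrow>
      exp (\<theta> * h x) \<le> bracket G sbar \<theta> g h x (choice1 n \<omega> x) (choice2 n \<omega> x)"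
  obtains c where "c > 0" "\<And>t. t > 0 \<Longrightarrow> ennreal (c * exp (\<theta> * g * t)) \<le> (\<integral>\<^sup>+\<omega>. ennreal (exp (\<theta> * total_cost G t \<omega>)) \<partial>law)"
proof -
  obtain C where C: "\<And>w r. stage_actions w \<in> K (fst w) \<Longrightarrow> 0 \<le> r \<Longrightarrow> r \<le> sbar \<Longrightarrow> \<bar>stage_cost G w r\<bar> \<le> C"
    by (rule stage_cost_bounded, rule that)
  define M where "M = Max (range (\<lambda>j :: 's. exp (\<theta> * h j)))"
  have M: "M > 0" unfolding M_def by (rule Max_exp_pos)
  define k where "k = exp (- \<theta> * (2 * C + \<bar>g\<bar> * sbar)) / M"
  have k: "k > 0" unfolding k_def using M by simp
  have stopped_law: "(\<lambda>\<omega>. ennreal (stopped g h t n \<omega>)) \<in> borel_measurable law" for t n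
    by (rule law_measurable[OF stopped_measurable]) (simp add: stopped_def jump_time_restrict potential_restrict)
  have stopped_int: "(\<integral>\<^sup>+\<omega>. ennreal (stopped g h t n \<omega>) \<partial>law) = (\<integral>\<^sup>+\<omega>. ennreal (stopped g h t n \<omega>) \<partial>law_upto (Suc n))" for t n
    by (rule nn_integral_law_upto[OF stopped_measurable]) (simp add: stopped_def jump_time_restrict potential_restrict)
  have "ennreal (k * exp (\<theta> * h i) * exp (\<theta> * g * t)) \<le> (\<integral>\<^sup>+\<omega>. ennreal (exp (\<theta> * total_cost G t \<omega>)) \<partial>law)" if t: "t > 0" for t
  proof -
    have "ennreal (k * exp (\<theta> * h i) * exp (\<theta> * g * t)) = ennreal (k * exp (\<theta> * g * t)) * ennreal (exp (\<theta> * h i))"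
      using k by (simp add: ennreal_mult'[symmetric] mult_ac)
    also have "\<dots> \<le> ennreal (k * exp (\<theta> * g * t)) * (\<Sum>n. \<integral>\<^sup>+\<omega>. ennreal (stopped g h t n \<omega>) \<partial>law)"
      unfolding stopped_int using t by (intro mult_left_mono initial_le_stopped_sum reply) simp_all
    also have "\<dots> = (\<integral>\<^sup>+\<omega>. ennreal (k * exp (\<theta> * g * t)) * (\<Sum>n. ennreal (stopped g h t n \<omega>)) \<partial>law)"
    proof (subst nn_integral_cmult)
      show "(\<lambda>\<omega>. \<Sum>n. ennreal (stopped g h t n \<omega>)) \<in> borel_measurable law" by (rule borel_measurable_suminf_order[OF stopped_law])
    qed (simp add: nn_integral_suminf[OF stopped_law])
    also have "\<dots> \<le> (\<integral>\<^sup>+\<omega>. ennreal (exp (\<theta> * total_cost G t \<omega>)) \<partial>law)"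
    proof (rule nn_integral_mono_AE)
      show "AE \<omega> in law. ennreal (k * exp (\<theta> * g * t)) * (\<Sum>n. ennreal (stopped g h t n \<omega>)) \<le> ennreal (exp (\<theta> * total_cost G t \<omega>))"
        using AE_regular_path[of t]
      proof eventually_elim
        case (elim \<omega>)
        define N where "N = jump_count \<omega> t"
        have sp: "\<omega> \<in> space law" using elim by (simp add: regular_path_def)
        note count = regular_path_jump_count[OF elim less_imp_le[OF t], folded N_def]
        have cv: "current_value h (Suc N) \<omega> \<le> M"
          unfolding M_def by (rule current_value_bounds(2)) (rule path_coordinate[OF sp])
        have "(\<Sum>n. ennreal (stopped g h t n \<omega>)) = (\<Sum>n\<in>{N}. ennreal (stopped g h t n \<omega>))"
        proof (rule suminf_finite)
          show "ennreal (stopped g h t n \<omega>) = 0" if "n \<notin> {N}" for n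
            using that count(3)[of n] by (auto simp: stopped_def)
        qed simp
        also have "\<dots> = ennreal (potential g h (Suc N) \<omega>)" using count(1,2) by (simp add: stopped_def)
        finally have sum: "(\<Sum>n. ennreal (stopped g h t n \<omega>)) = ennreal (potential g h (Suc N) \<omega>)" .
        have "k * exp (\<theta> * g * t) * potential g h (Suc N) \<omega> \<le> k * exp (\<theta> * g * t) * (exp (\<theta> * discounted_cost g (Suc N) \<omega>) * M)"
          unfolding potential_def using k cv by (intro mult_left_mono) simp_all
        also have "\<dots> = exp (- \<theta> * (2 * C + \<bar>g\<bar> * sbar)) * exp (\<theta> * g * t) * exp (\<theta> * discounted_cost g (Suc N) \<omega>)"
          using M by (simp add: k_def)
        also have "\<dots> = exp (\<theta> * (discounted_cost g (Suc N) \<omega> + g * t - (2 * C + \<bar>g\<bar> * sbar)))"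
          unfolding exp_add[symmetric] by (simp add: algebra_simps)
        also have "\<dots> \<le> exp (\<theta> * total_cost G t \<omega>)"
        proof -
          have "discounted_cost g (Suc N) \<omega> + g * t - (2 * C + \<bar>g\<bar> * sbar) \<le> total_cost G t \<omega>"
            using regular_path_bounds(2)[OF elim less_imp_le[OF t] N_def C, of g] by linarith
          from mult_left_mono[OF this less_imp_le[OF \<theta>_pos]] show ?thesis by simp
        qed
        finally show ?case
          unfolding sum using k by (subst ennreal_mult'[symmetric]) (simp_all add: ennreal_leI)
      qed
    qed
    finally show ?thesis .
  qed
  moreover have "k * exp (\<theta> * h i) > 0" using k by simp
  ultimately show ?thesis by (intro that[of "k * exp (\<theta> * h i)"])
qed

lemma J_le_of_supersolution:
  assumes "q \<ge> 0" "q < 1" "\<And>n \<omega> x. \<omega> \<in> space (stages n) \<Longrightarrow>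
      bracket G sbar \<theta> g h x (choice1 n \<omega> x) (choice2 n \<omega> x) \<le> q * exp (\<theta> * h x)"
  shows "J G \<theta> i \<pi>1 \<pi>2 \<le> ereal g"
proof -
  obtain c where c: "c > 0" "\<And>t. t > 0 \<Longrightarrow> (\<integral>\<^sup>+\<omega>. ennreal (exp (\<theta> * total_cost G t \<omega>)) \<partial>law) \<le> ennreal (c * exp (\<theta> * g * t))"
    using expected_cost_upper[OF assms] by metis
  show ?thesis unfolding J_def by (rule growth_rate_upper[OF \<theta>_pos c])
qed

lemma J_ge_of_subsolution:
  assumes "\<And>n \<omega> x. \<omega> \<in> space (stages n) \<Longrightarrow>
      exp (\<theta> * h x) \<le> bracket G sbar \<theta> g h x (choice1 n \<omega> x) (choice2 n \<omega> x)"
  shows "ereal g \<le> J G \<theta> i \<pi>1 \<pi>2"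
proof -
  obtain c where c: "c > 0" "\<And>t. t > 0 \<Longrightarrow> ennreal (c * exp (\<theta> * g * t)) \<le> (\<integral>\<^sup>+\<omega>. ennreal (exp (\<theta> * total_cost G t \<omega>)) \<partial>law)"
    using expected_cost_lower[OF assms] by metis
  show ?thesis unfolding J_def by (rule growth_rate_lower[OF \<theta>_pos c])
qed

end

section \<open>The value and the saddle point\<close>

context regular_game
begin

lemma stationary_policy1:
  assumes \<phi>: "\<phi> \<in> selectors1 G"
  shows "stationary \<phi> \<in> policies1 G"
proof -
  have \<phi>': "\<phi> \<in> count_space UNIV \<rightarrow>\<^sub>M prob_algebra (restrict_space borel (act1 G))" "\<And>x. emeasure (\<phi> x) (adm1 G x) = 1"
    using \<phi> by (simp_all add: selectors1_def)
  have "stationary \<phi> n \<in> history_space G n \<rightarrow>\<^sub>M prob_algebra (restrict_space borel (act1 G))" for n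
    unfolding stationary_def[abs_def] history_space_def by (rule measurable_compose[OF measurable_snd \<phi>'(1)])
  then show ?thesis using \<phi>'(2) by (simp add: policies1_def stationary_def)
qed

lemma stationary_policy2:
  assumes \<phi>: "\<phi> \<in> selectors2 G"
  shows "stationary \<phi> \<in> policies2 G"
proof -
  have \<phi>': "\<phi> \<in> count_space UNIV \<rightarrow>\<^sub>M prob_algebra (restrict_space borel (act2 G))" "\<And>x. emeasure (\<phi> x) (adm2 G x) = 1"
    using \<phi> by (simp_all add: selectors2_def)
  have "stationary \<phi> n \<in> history_space G n \<rightarrow>\<^sub>M prob_algebra (restrict_space borel (act2 G))" for n
    unfolding stationary_def[abs_def] history_space_def by (rule measurable_compose[OF measurable_snd \<phi>'(1)])
  then show ?thesis using \<phi>'(2) by (simp add: policies2_def stationary_def)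
qed

lemma selector_of_mixed_actions1:
  assumes "\<And>x. \<psi> x \<in> prob_measures (adm1 G x)"
  obtains \<phi> where "\<phi> \<in> selectors1 G" "\<And>x. restrict_space (\<phi> x) (adm1 G x) = \<psi> x"
proof
  let ?\<phi> = "\<lambda>x. distr (\<psi> x) (restrict_space borel (act1 G)) (\<lambda>a. a)"
  note ext = extend_prob_measure[OF assms adm1_borel act1_borel]
  show "?\<phi> \<in> selectors1 G" unfolding selectors1_def using ext(1,2) by simp
  show "restrict_space (?\<phi> x) (adm1 G x) = \<psi> x" for x by (rule ext(3))
qed

lemma selector_of_mixed_actions2:
  assumes "\<And>x. \<phi>' x \<in> prob_measures (adm2 G x)"
  obtains \<phi> where "\<phi> \<in> selectors2 G" "\<And>x. restrict_space (\<phi> x) (adm2 G x) = \<phi>' x"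
proof
  let ?\<phi> = "\<lambda>x. distr (\<phi>' x) (restrict_space borel (act2 G)) (\<lambda>b. b)"
  note ext = extend_prob_measure[OF assms adm2_borel act2_borel]
  show "?\<phi> \<in> selectors2 G" unfolding selectors2_def using ext(1,2) by simp
  show "restrict_space (?\<phi> x) (adm2 G x) = \<phi>' x" for x by (rule ext(3))
qed

text \<open>
  The contraction factor \<open>q\<close> between \<open>g\<close> and \<open>g'\<close> leaves room for a relative error \<open>\<epsilon>\<close> with
  \<open>q (1 + \<epsilon>) < 1\<close>.
\<close>

lemma J_le_of_near_minimizer:
  assumes "g < g'"
  shows "\<exists>\<epsilon>>0. \<forall>\<phi>1\<in>selectors1 G. \<forall>\<pi>2\<in>policies2 G. \<forall>i.
    (\<forall>x. \<forall>\<phi>\<in>prob_measures (adm2 G x).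
       bracket G sbar \<theta> g h x (restrict_space (\<phi>1 x) (adm1 G x)) \<phi> \<le> (1 + \<epsilon>) * exp (\<theta> * h x)) \<longrightarrow>
    J G \<theta> i (stationary \<phi>1) \<pi>2 \<le> ereal g'"
proof -
  obtain q where q: "0 < q" "q < 1"
    "\<And>x \<psi> \<phi>. \<psi> \<in> prob_measures (adm1 G x) \<Longrightarrow> \<phi> \<in> prob_measures (adm2 G x) \<Longrightarrow>
       bracket G sbar \<theta> g' h x \<psi> \<phi> \<le> q * bracket G sbar \<theta> g h x \<psi> \<phi>"
    by (rule bracket_contraction[OF assms, of h], rule that)
  define \<epsilon> where "\<epsilon> = (1 - q) / 2"
  have "\<epsilon> > 0" using q by (simp add: \<epsilon>_def)
  have "q * \<epsilon> < 1 * (1 - q)" using q by (intro mult_strict_mono) (simp_all add: \<epsilon>_def)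
  then have q\<epsilon>: "q * (1 + \<epsilon>) < 1" by (simp add: distrib_left)
  have "J G \<theta> i (stationary \<phi>1) \<pi>2 \<le> ereal g'"
    if \<phi>1: "\<phi>1 \<in> selectors1 G" and \<pi>2: "\<pi>2 \<in> policies2 G"
      and le: "\<And>x \<phi>. \<phi> \<in> prob_measures (adm2 G x) \<Longrightarrow>
         bracket G sbar \<theta> g h x (restrict_space (\<phi>1 x) (adm1 G x)) \<phi> \<le> (1 + \<epsilon>) * exp (\<theta> * h x)"
    for \<phi>1 \<pi>2 i
  proof -
    interpret play: controlled_game G sbar \<theta> i "stationary \<phi>1" \<pi>2
      using stationary_policy1[OF \<phi>1] \<pi>2 by unfold_locales
    show ?thesis
    proof (rule play.J_le_of_supersolution[where q = "q * (1 + \<epsilon>)" and h = h])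
      show "0 \<le> q * (1 + \<epsilon>)" using q \<open>\<epsilon> > 0\<close> by simp
      fix n \<omega> x assume \<omega>: "\<omega> \<in> space (play.stages n)"
      have c1: "play.choice1 n \<omega> x = restrict_space (\<phi>1 x) (adm1 G x)" by (simp add: stationary_def)
      have "bracket G sbar \<theta> g' h x (play.choice1 n \<omega> x) (play.choice2 n \<omega> x)
          \<le> q * bracket G sbar \<theta> g h x (play.choice1 n \<omega> x) (play.choice2 n \<omega> x)"
        by (rule q(3)[OF play.choice1_prob[OF \<omega>] play.choice2_prob[OF \<omega>]])
      also have "\<dots> \<le> q * ((1 + \<epsilon>) * exp (\<theta> * h x))"
        unfolding c1 using le[OF play.choice2_prob[OF \<omega>]] q(1) by (intro mult_left_mono) simp_all
      finally show "bracket G sbar \<theta> g' h x (play.choice1 n \<omega> x) (play.choice2 n \<omega> x) \<le> q * (1 + \<epsilon>) * exp (\<theta> * h x)"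
        by (simp only: mult.assoc)
    qed (rule q\<epsilon>)
  qed
  then show ?thesis using \<open>\<epsilon> > 0\<close> by (intro exI[of _ \<epsilon>]) simp
qed

text \<open>
  Here \<open>g' < g\<close>, so the contraction factor \<open>q\<close> acts in the other direction and a relative error of
  \<open>1 - q\<close> is admissible.
\<close>

lemma J_ge_of_near_maximizer:
  assumes "g' < g"
  shows "\<exists>\<epsilon>>0. \<forall>\<phi>2\<in>selectors2 G. \<forall>\<pi>1\<in>policies1 G. \<forall>i.
    (\<forall>x. \<forall>\<psi>\<in>prob_measures (adm1 G x).
       (1 - \<epsilon>) * exp (\<theta> * h x) \<le> bracket G sbar \<theta> g h x \<psi> (restrict_space (\<phi>2 x) (adm2 G x))) \<longrightarrow>
    ereal g' \<le> J G \<theta> i \<pi>1 (stationary \<phi>2)"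
proof -
  obtain q where q: "0 < q" "q < 1"
    "\<And>x \<psi> \<phi>. \<psi> \<in> prob_measures (adm1 G x) \<Longrightarrow> \<phi> \<in> prob_measures (adm2 G x) \<Longrightarrow>
       bracket G sbar \<theta> g h x \<psi> \<phi> \<le> q * bracket G sbar \<theta> g' h x \<psi> \<phi>"
    by (rule bracket_contraction[OF assms, of h], rule that)
  have "ereal g' \<le> J G \<theta> i \<pi>1 (stationary \<phi>2)"
    if \<phi>2: "\<phi>2 \<in> selectors2 G" and \<pi>1: "\<pi>1 \<in> policies1 G"
      and ge: "\<And>x \<psi>. \<psi> \<in> prob_measures (adm1 G x) \<Longrightarrow>
         (1 - (1 - q)) * exp (\<theta> * h x) \<le> bracket G sbar \<theta> g h x \<psi> (restrict_space (\<phi>2 x) (adm2 G x))"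
    for \<phi>2 \<pi>1 i
  proof -
    interpret play: controlled_game G sbar \<theta> i \<pi>1 "stationary \<phi>2"
      using stationary_policy2[OF \<phi>2] \<pi>1 by unfold_locales
    show ?thesis
    proof (rule play.J_ge_of_subsolution[where h = h])
      fix n \<omega> x assume \<omega>: "\<omega> \<in> space (play.stages n)"
      have c2: "play.choice2 n \<omega> x = restrict_space (\<phi>2 x) (adm2 G x)" by (simp add: stationary_def)
      have "q * exp (\<theta> * h x) \<le> bracket G sbar \<theta> g h x (play.choice1 n \<omega> x) (play.choice2 n \<omega> x)"
        unfolding c2 using ge[OF play.choice1_prob[OF \<omega>]] by simp
      also have "\<dots> \<le> q * bracket G sbar \<theta> g' h x (play.choice1 n \<omega> x) (play.choice2 n \<omega> x)"
        by (rule q(3)[OF play.choice1_prob[OF \<omega>] play.choice2_prob[OF \<omega>]])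
      finally show "exp (\<theta> * h x) \<le> bracket G sbar \<theta> g' h x (play.choice1 n \<omega> x) (play.choice2 n \<omega> x)"
        using q(1) by (simp only: mult_le_cancel_left_pos)
    qed
  qed
  then show ?thesis using q(2) by (intro exI[of _ "1 - q"]) simp
qed

text \<open>
  A number strictly between the two sides could be secured against every mixed action of the
  minimizer by some pure reply; the minimax theorem then yields a mixed action of the maximizer that guarantees more
  than the lower side.
\<close>

lemma inf_sup_eq_sup_inf:
  assumes "sup_inf_rhs G sbar \<theta> g h x = ereal e"
  shows "inf_sup_rhs G sbar \<theta> g h x = ereal e"
proof (rule antisym)
  let ?br = "bracket G sbar \<theta> g h x"
  note cont = payoff_continuous[of x g h]
  note cA = compact_adm1[of x] and cB = compact_adm2[of x]
  show "ereal e \<le> inf_sup_rhs G sbar \<theta> g h x"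
    unfolding assms[symmetric] sup_inf_rhs_def inf_sup_rhs_def by (rule SUP_INF_le_INF_SUP)
  show "inf_sup_rhs G sbar \<theta> g h x \<le> ereal e"
  proof (rule ccontr)
    assume "\<not> ?thesis"
    then have "ereal e < inf_sup_rhs G sbar \<theta> g h x" by simp
    from ereal_dense2[OF this] obtain v where v: "e < v" "ereal v < inf_sup_rhs G sbar \<theta> g h x" by auto
    have reply: "\<exists>b\<in>adm2 G x. v \<le> (\<integral>a. payoff g h x (a, b) \<partial>\<psi>)" if \<psi>: "\<psi> \<in> prob_measures (adm1 G x)" for \<psi>
    proof -
      have "ereal v < (SUP \<phi>\<in>prob_measures (adm2 G x). ereal (?br \<psi> \<phi>))"
        using v(2) \<psi> unfolding inf_sup_rhs_def by (meson INF_lower less_le_trans)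
      then obtain \<phi> where \<phi>: "\<phi> \<in> prob_measures (adm2 G x)" "v < ?br \<psi> \<phi>"
        unfolding less_SUP_iff by auto
      show ?thesis
      proof (rule ccontr)
        assume "\<not> ?thesis"
        then have "?br \<psi> \<phi> \<le> v"
          unfolding bracket_eq by (intro mixed_bound_slices(2)[OF cA cB cont \<psi> \<phi>(1)]) force
        then show False using \<phi>(2) by simp
      qed
    qed
    have "(v - e) / 2 > 0" using v(1) by simp
    from minimax_mixed[OF cA adm1_nonempty cB cont reply this]
    obtain \<phi> where \<phi>: "\<phi> \<in> prob_measures (adm2 G x)"
      "\<And>a. a \<in> adm1 G x \<Longrightarrow> v - (v - e) / 2 \<le> (\<integral>b. payoff g h x (a, b) \<partial>\<phi>)" by blast
    have "ereal (v - (v - e) / 2) \<le> (INF \<psi>\<in>prob_measures (adm1 G x). ereal (?br \<psi> \<phi>))"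
      unfolding bracket_eq using mixed_bound_slices(1)[OF cA cB cont _ \<phi>(1) \<phi>(2)] by (intro INF_greatest) simp
    also have "\<dots> \<le> sup_inf_rhs G sbar \<theta> g h x"
      unfolding sup_inf_rhs_def by (rule SUP_upper[OF \<phi>(1)])
    finally have "v - (v - e) / 2 \<le> e" unfolding assms by simp
    then show False using v(1) by (simp add: field_simps)
  qed
qed

lemma lower_value_le_upper_value: "lower_value G \<theta> i \<le> upper_value G \<theta> i"
  unfolding lower_value_def upper_value_def by (rule SUP_INF_le_INF_SUP)

end

text \<open>
  Empty admissible sets would make one side of the equation infinite.
\<close>

lemma regular_game_of_equation:
  fixes G :: "('s::finite, 'a::polish_space, 'b::polish_space) smg" and r :: "'s \<Rightarrow> real"
  assumes "semi_markov_game G" "assumption1 G sbar" "\<theta> > 0"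
    and eq: "\<And>x. sup_inf_rhs G sbar \<theta> g h x = ereal (r x)"
  shows "regular_game G sbar \<theta>"
proof
  show "semi_markov_game G" "assumption1 G sbar" "\<theta> > 0" by fact+
  have ne2: "prob_measures (adm2 G x) \<noteq> {}" for x
    using eq[of x] by (auto simp: sup_inf_rhs_def bot_ereal_def)
  then show "adm2 G x \<noteq> {}" for x using prob_measures_empty by metis
  show "adm1 G x \<noteq> {}" for x
  proof
    assume "adm1 G x = {}"
    then have "sup_inf_rhs G sbar \<theta> g h x = \<infinity>"
      using ne2[of x] by (simp add: sup_inf_rhs_def prob_measures_empty top_ereal_def)
    then show False using eq[of x] by simp
  qed
qed

theorem theorem1:
  fixes G :: "('s::finite, 'a::polish_space, 'b::polish_space) smg"
    and sbar \<theta> g :: real and h :: "'s \<Rightarrow> real"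
  assumes "semi_markov_game G"
    and "assumption1 G sbar"
    and "\<theta> > 0"
    and E1: "\<And>i. ereal (exp (\<theta> * h i)) = sup_inf_rhs G sbar \<theta> g h i"
  shows "(\<forall>i. ereal (exp (\<theta> * h i)) = inf_sup_rhs G sbar \<theta> g h i) \<and>
         is_value G \<theta> (\<lambda>i. ereal g) \<and>
         (\<forall>\<phi>1\<in>selectors1 G. \<forall>\<phi>2\<in>selectors2 G.
            outer_minimizing G sbar \<theta> g h \<phi>1 \<longrightarrow> outer_maximizing G sbar \<theta> g h \<phi>2 \<longrightarrow>
            saddle_point G \<theta> (stationary \<phi>1) (stationary \<phi>2))"
proof -
  interpret regular_game G sbar \<theta>
    by (rule regular_game_of_equation[OF assms(1-3) E1[symmetric]])
  have E2: "inf_sup_rhs G sbar \<theta> g h x = ereal (exp (\<theta> * h x))" for x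
    by (rule inf_sup_eq_sup_inf[OF E1[symmetric]])
  let ?br = "bracket G sbar \<theta> g h"
  have near_min: "\<exists>\<phi>1\<in>selectors1 G. \<forall>x. \<forall>\<phi>\<in>prob_measures (adm2 G x).
      ?br x (restrict_space (\<phi>1 x) (adm1 G x)) \<phi> \<le> (1 + \<epsilon>) * exp (\<theta> * h x)" if "\<epsilon> > 0" for \<epsilon>
  proof -
    have "\<exists>\<psi>. \<psi> \<in> prob_measures (adm1 G x) \<and> (\<forall>\<phi>\<in>prob_measures (adm2 G x). ?br x \<psi> \<phi> \<le> (1 + \<epsilon>) * exp (\<theta> * h x))" for x
    proof -
      have "inf_sup_rhs G sbar \<theta> g h x < ereal ((1 + \<epsilon>) * exp (\<theta> * h x))" unfolding E2 using \<open>\<epsilon> > 0\<close> by simp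
      then obtain \<psi> where \<psi>: "\<psi> \<in> prob_measures (adm1 G x)"
        "(SUP \<phi>\<in>prob_measures (adm2 G x). ereal (?br x \<psi> \<phi>)) < ereal ((1 + \<epsilon>) * exp (\<theta> * h x))"
        unfolding inf_sup_rhs_def INF_less_iff by blast
      have "?br x \<psi> \<phi> \<le> (1 + \<epsilon>) * exp (\<theta> * h x)" if "\<phi> \<in> prob_measures (adm2 G x)" for \<phi>
      proof -
        have "ereal (?br x \<psi> \<phi>) \<le> (SUP \<phi>\<in>prob_measures (adm2 G x). ereal (?br x \<psi> \<phi>))" by (rule SUP_upper[OF that])
        also note less_imp_le[OF \<psi>(2)]
        finally show ?thesis by simp
      qed
      then show ?thesis using \<psi>(1) by blast
    qed
    then have "\<exists>\<psi>. \<forall>x. \<psi> x \<in> prob_measures (adm1 G x) \<and>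
        (\<forall>\<phi>\<in>prob_measures (adm2 G x). ?br x (\<psi> x) \<phi> \<le> (1 + \<epsilon>) * exp (\<theta> * h x))"
      by (rule choice[OF allI])
    then obtain \<psi> where \<psi>: "\<And>x. \<psi> x \<in> prob_measures (adm1 G x)"
      "\<And>x \<phi>. \<phi> \<in> prob_measures (adm2 G x) \<Longrightarrow> ?br x (\<psi> x) \<phi> \<le> (1 + \<epsilon>) * exp (\<theta> * h x)" by blast
    obtain \<phi>1 where "\<phi>1 \<in> selectors1 G" "\<And>x. restrict_space (\<phi>1 x) (adm1 G x) = \<psi> x"
      using selector_of_mixed_actions1[of \<psi>] \<psi>(1) by blast
    then show ?thesis using \<psi>(2) by (intro bexI[of _ \<phi>1]) simp_all
  qed
  have near_max: "\<exists>\<phi>2\<in>selectors2 G. \<forall>x. \<forall>\<psi>\<in>prob_measures (adm1 G x).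
      (1 - \<epsilon>) * exp (\<theta> * h x) \<le> ?br x \<psi> (restrict_space (\<phi>2 x) (adm2 G x))" if "\<epsilon> > 0" for \<epsilon>
  proof -
    have "\<exists>\<phi>. \<phi> \<in> prob_measures (adm2 G x) \<and> (\<forall>\<psi>\<in>prob_measures (adm1 G x). (1 - \<epsilon>) * exp (\<theta> * h x) \<le> ?br x \<psi> \<phi>)" for x
    proof -
      have "ereal ((1 - \<epsilon>) * exp (\<theta> * h x)) < sup_inf_rhs G sbar \<theta> g h x" unfolding E1[symmetric] using \<open>\<epsilon> > 0\<close> by simp
      then obtain \<phi> where \<phi>: "\<phi> \<in> prob_measures (adm2 G x)"
        "ereal ((1 - \<epsilon>) * exp (\<theta> * h x)) < (INF \<psi>\<in>prob_measures (adm1 G x). ereal (?br x \<psi> \<phi>))"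
        unfolding sup_inf_rhs_def less_SUP_iff by blast
      have "(1 - \<epsilon>) * exp (\<theta> * h x) \<le> ?br x \<psi> \<phi>" if "\<psi> \<in> prob_measures (adm1 G x)" for \<psi>
      proof -
        note less_imp_le[OF \<phi>(2)]
        also have "(INF \<psi>\<in>prob_measures (adm1 G x). ereal (?br x \<psi> \<phi>)) \<le> ereal (?br x \<psi> \<phi>)" by (rule INF_lower[OF that])
        finally show ?thesis by simp
      qed
      then show ?thesis using \<phi>(1) by blast
    qed
    then have "\<exists>\<phi>. \<forall>x. \<phi> x \<in> prob_measures (adm2 G x) \<and>
        (\<forall>\<psi>\<in>prob_measures (adm1 G x). (1 - \<epsilon>) * exp (\<theta> * h x) \<le> ?br x \<psi> (\<phi> x))"
      by (rule choice[OF allI])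
    then obtain \<phi> where \<phi>: "\<And>x. \<phi> x \<in> prob_measures (adm2 G x)"
      "\<And>x \<psi>. \<psi> \<in> prob_measures (adm1 G x) \<Longrightarrow> (1 - \<epsilon>) * exp (\<theta> * h x) \<le> ?br x \<psi> (\<phi> x)" by blast
    obtain \<phi>2 where "\<phi>2 \<in> selectors2 G" "\<And>x. restrict_space (\<phi>2 x) (adm2 G x) = \<phi> x"
      using selector_of_mixed_actions2[of \<phi>] \<phi>(1) by blast
    then show ?thesis using \<phi>(2) by (intro bexI[of _ \<phi>2]) simp_all
  qed
  have upper: "upper_value G \<theta> i \<le> ereal g" for i
  proof (rule le_ereal_if_le_all_above)
    fix g' assume "g < g'"
    obtain \<epsilon> where \<epsilon>: "\<epsilon> > 0" "\<forall>\<phi>1\<in>selectors1 G. \<forall>\<pi>2\<in>policies2 G. \<forall>i.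
        (\<forall>x. \<forall>\<phi>\<in>prob_measures (adm2 G x). ?br x (restrict_space (\<phi>1 x) (adm1 G x)) \<phi> \<le> (1 + \<epsilon>) * exp (\<theta> * h x)) \<longrightarrow>
        J G \<theta> i (stationary \<phi>1) \<pi>2 \<le> ereal g'"
      using J_le_of_near_minimizer[OF \<open>g < g'\<close>, of h] by (elim exE conjE) (rule that)
    obtain \<phi>1 where \<phi>1: "\<phi>1 \<in> selectors1 G"
      "\<And>x \<phi>. \<phi> \<in> prob_measures (adm2 G x) \<Longrightarrow> ?br x (restrict_space (\<phi>1 x) (adm1 G x)) \<phi> \<le> (1 + \<epsilon>) * exp (\<theta> * h x)"
      using near_min[OF \<epsilon>(1)] by blast
    have "upper_value G \<theta> i \<le> (SUP \<pi>2\<in>policies2 G. J G \<theta> i (stationary \<phi>1) \<pi>2)"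
      unfolding upper_value_def by (rule INF_lower[OF stationary_policy1[OF \<phi>1(1)]])
    also have "\<dots> \<le> ereal g'" by (intro SUP_least \<epsilon>(2)[rule_format] \<phi>1)
    finally show "upper_value G \<theta> i \<le> ereal g'" .
  qed
  have lower: "ereal g \<le> lower_value G \<theta> i" for i
  proof (rule ereal_le_if_le_all_below)
    fix g' assume "g' < g"
    obtain \<epsilon> where \<epsilon>: "\<epsilon> > 0" "\<forall>\<phi>2\<in>selectors2 G. \<forall>\<pi>1\<in>policies1 G. \<forall>i.
        (\<forall>x. \<forall>\<psi>\<in>prob_measures (adm1 G x). (1 - \<epsilon>) * exp (\<theta> * h x) \<le> ?br x \<psi> (restrict_space (\<phi>2 x) (adm2 G x))) \<longrightarrow>
        ereal g' \<le> J G \<theta> i \<pi>1 (stationary \<phi>2)"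
      using J_ge_of_near_maximizer[OF \<open>g' < g\<close>, of h] by (elim exE conjE) (rule that)
    obtain \<phi>2 where \<phi>2: "\<phi>2 \<in> selectors2 G"
      "\<And>x \<psi>. \<psi> \<in> prob_measures (adm1 G x) \<Longrightarrow> (1 - \<epsilon>) * exp (\<theta> * h x) \<le> ?br x \<psi> (restrict_space (\<phi>2 x) (adm2 G x))"
      using near_max[OF \<epsilon>(1)] by blast
    have "ereal g' \<le> (INF \<pi>1\<in>policies1 G. J G \<theta> i \<pi>1 (stationary \<phi>2))" by (intro INF_greatest \<epsilon>(2)[rule_format] \<phi>2)
    also have "\<dots> \<le> lower_value G \<theta> i"
      unfolding lower_value_def by (rule SUP_upper[OF stationary_policy2[OF \<phi>2(1)]])
    finally show "ereal g' \<le> lower_value G \<theta> i" .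
  qed
  have up_eq: "upper_value G \<theta> i = ereal g" and low_eq: "lower_value G \<theta> i = ereal g" for i
    by (rule antisym[OF upper order_trans[OF lower lower_value_le_upper_value]])
       (rule antisym[OF order_trans[OF lower_value_le_upper_value upper] lower])
  then have val: "is_value G \<theta> (\<lambda>i. ereal g)" by (simp add: is_value_def)
  have opt1: "optimal1 G \<theta> (stationary \<phi>1)" if \<phi>1: "\<phi>1 \<in> selectors1 G" and min: "outer_minimizing G sbar \<theta> g h \<phi>1" for \<phi>1
  proof -
    have br_le: "?br x (restrict_space (\<phi>1 x) (adm1 G x)) \<phi> \<le> exp (\<theta> * h x)" if "\<phi> \<in> prob_measures (adm2 G x)" for x \<phi>
    proof -
      have "ereal (?br x (restrict_space (\<phi>1 x) (adm1 G x)) \<phi>)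
          \<le> (SUP \<phi>\<in>prob_measures (adm2 G x). ereal (?br x (restrict_space (\<phi>1 x) (adm1 G x)) \<phi>))"
        by (rule SUP_upper[OF that])
      also have "\<dots> = ereal (exp (\<theta> * h x))" using min unfolding outer_minimizing_def E2 by blast
      finally show ?thesis by simp
    qed
    have guarantee: "(SUP \<pi>2\<in>policies2 G. J G \<theta> i (stationary \<phi>1) \<pi>2) = ereal g" for i
    proof (rule antisym)
      show "(SUP \<pi>2\<in>policies2 G. J G \<theta> i (stationary \<phi>1) \<pi>2) \<le> ereal g"
      proof (rule le_ereal_if_le_all_above, rule SUP_least)
        fix g' \<pi>2 assume \<pi>2: "\<pi>2 \<in> policies2 G" and "g < g'"
        obtain \<epsilon> where \<epsilon>: "\<epsilon> > 0" "\<forall>\<phi>1\<in>selectors1 G. \<forall>\<pi>2\<in>policies2 G. \<forall>i.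
        (\<forall>x. \<forall>\<phi>\<in>prob_measures (adm2 G x). ?br x (restrict_space (\<phi>1 x) (adm1 G x)) \<phi> \<le> (1 + \<epsilon>) * exp (\<theta> * h x)) \<longrightarrow>
        J G \<theta> i (stationary \<phi>1) \<pi>2 \<le> ereal g'"
      using J_le_of_near_minimizer[OF \<open>g < g'\<close>, of h] by (elim exE conjE) (rule that)
        show "J G \<theta> i (stationary \<phi>1) \<pi>2 \<le> ereal g'"
        proof (rule \<epsilon>(2)[rule_format, OF \<phi>1 \<pi>2])
          show "?br x (restrict_space (\<phi>1 x) (adm1 G x)) \<phi> \<le> (1 + \<epsilon>) * exp (\<theta> * h x)"
            if "\<phi> \<in> prob_measures (adm2 G x)" for x \<phi>
            using br_le[OF that] mult_pos_pos[OF \<epsilon>(1) exp_gt_zero, of "\<theta> * h x"] by (simp only: distrib_right mult_1)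
        qed
      qed
      have "ereal g = upper_value G \<theta> i" by (rule up_eq[symmetric])
      also have "\<dots> \<le> (SUP \<pi>2\<in>policies2 G. J G \<theta> i (stationary \<phi>1) \<pi>2)"
        unfolding upper_value_def by (rule INF_lower[OF stationary_policy1[OF \<phi>1]])
      finally show "ereal g \<le> (SUP \<pi>2\<in>policies2 G. J G \<theta> i (stationary \<phi>1) \<pi>2)" .
    qed
    show ?thesis
      unfolding optimal1_def
      by (intro conjI exI[of _ "\<lambda>_. ereal g"] allI stationary_policy1 \<phi>1 val guarantee[symmetric])
  qed
  have opt2: "optimal2 G \<theta> (stationary \<phi>2)" if \<phi>2: "\<phi>2 \<in> selectors2 G" and max: "outer_maximizing G sbar \<theta> g h \<phi>2" for \<phi>2
  proof -
    have br_ge: "exp (\<theta> * h x) \<le> ?br x \<psi> (restrict_space (\<phi>2 x) (adm2 G x))" if "\<psi> \<in> prob_measures (adm1 G x)" for x \<psi>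
    proof -
      have "ereal (exp (\<theta> * h x)) = (INF \<psi>\<in>prob_measures (adm1 G x). ereal (?br x \<psi> (restrict_space (\<phi>2 x) (adm2 G x))))"
        using max unfolding outer_maximizing_def E1[symmetric] by simp
      also have "\<dots> \<le> ereal (?br x \<psi> (restrict_space (\<phi>2 x) (adm2 G x)))" by (rule INF_lower[OF that])
      finally show ?thesis by simp
    qed
    have guarantee: "(INF \<pi>1\<in>policies1 G. J G \<theta> i \<pi>1 (stationary \<phi>2)) = ereal g" for i
    proof (rule antisym)
      show "ereal g \<le> (INF \<pi>1\<in>policies1 G. J G \<theta> i \<pi>1 (stationary \<phi>2))"
      proof (rule ereal_le_if_le_all_below, rule INF_greatest)
        fix g' \<pi>1 assume \<pi>1: "\<pi>1 \<in> policies1 G" and "g' < g"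
        obtain \<epsilon> where \<epsilon>: "\<epsilon> > 0" "\<forall>\<phi>2\<in>selectors2 G. \<forall>\<pi>1\<in>policies1 G. \<forall>i.
        (\<forall>x. \<forall>\<psi>\<in>prob_measures (adm1 G x). (1 - \<epsilon>) * exp (\<theta> * h x) \<le> ?br x \<psi> (restrict_space (\<phi>2 x) (adm2 G x))) \<longrightarrow>
        ereal g' \<le> J G \<theta> i \<pi>1 (stationary \<phi>2)"
      using J_ge_of_near_maximizer[OF \<open>g' < g\<close>, of h] by (elim exE conjE) (rule that)
        show "ereal g' \<le> J G \<theta> i \<pi>1 (stationary \<phi>2)"
        proof (rule \<epsilon>(2)[rule_format, OF \<phi>2 \<pi>1])
          show "(1 - \<epsilon>) * exp (\<theta> * h x) \<le> ?br x \<psi> (restrict_space (\<phi>2 x) (adm2 G x))"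
            if "\<psi> \<in> prob_measures (adm1 G x)" for x \<psi>
            using br_ge[OF that] mult_pos_pos[OF \<epsilon>(1) exp_gt_zero, of "\<theta> * h x"] by (simp only: left_diff_distrib mult_1)
        qed
      qed
      have "(INF \<pi>1\<in>policies1 G. J G \<theta> i \<pi>1 (stationary \<phi>2)) \<le> lower_value G \<theta> i"
        unfolding lower_value_def by (rule SUP_upper[OF stationary_policy2[OF \<phi>2]])
      also have "\<dots> = ereal g" by (rule low_eq)
      finally show "(INF \<pi>1\<in>policies1 G. J G \<theta> i \<pi>1 (stationary \<phi>2)) \<le> ereal g" .
    qed
    show ?thesis
      unfolding optimal2_def
      by (intro conjI exI[of _ "\<lambda>_. ereal g"] allI stationary_policy2 \<phi>2 val guarantee[symmetric])
  qed
  show ?thesis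
    unfolding saddle_point_def by (intro conjI allI ballI impI E2[symmetric] val opt1 opt2; assumption)
qed

end
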